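(* Let $r_1$ be a positive integer, $x>0$ and $\rho>\tfrac12 r_1-1$. Define the iterated integral \[ K_{\rho+1/2}(x;-\tfrac12;r_1+1):=\int_0^{\infty}u_{r_1}^{\rho}J_{-1/2}(u_{r_1})\,du_{r_1}\int_0^{\infty}u_{r_1-1}^{\rho}J_{-1/2}(u_{r_1-1})\,du_{r_1-1}\cdots\int_0^{\infty}u_1^{\rho}J_{-1/2}(u_1)\,J_{\rho+1/2}\Big(\frac{x}{u_1u_2\cdots u_{r_1}}\Big)\,du_1 . \] Then \[ K_{\rho+1/2}(x;-\tfrac12;r_1+1)=2^{-\rho+(r_1+1)/2}\,x^{\rho-1/2}\,G^{0,r_1+1}_{2(r_1+1),0}\!\left(\frac{4^{r_1+1}}{x^2}\,\middle|\,\begin{matrix}\tfrac12,\dots,\tfrac12,\rho+1,0,\dots,0\\ -\end{matrix}\right), \] where there are $r_1+1$ entries $\tfrac12$, followed by $\rho+1$, followed by $r_1$ entries $0$, and no lower parameters.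
   Context: $J_\nu$ denotes the ordinary Bessel function of the first kind of order $\nu$. The Meijer $G$-function is $G_{p,q}^{m,n}\!\left(y\,\middle|\,\begin{matrix}a_1,\dots,a_p\\ b_1,\dots,b_q\end{matrix}\right)=\frac{1}{2\pi i}\int_L\frac{\prod_{j=1}^m\Gamma(b_j-s)\prod_{j=1}^n\Gamma(1-a_j+s)}{\prod_{j=m+1}^q\Gamma(1-b_j+s)\prod_{j=n+1}^p\Gamma(a_j-s)}y^s\,ds$, where $L$ runs from $-i\infty$ to $+i\infty$ separating the poles of $\Gamma(b_1-s)\cdots\Gamma(b_m-s)$ from those of $\Gamma(1-a_1+s)\cdots\Gamma(1-a_n+s)$. *)

theory Defs
  imports "HOL-Analysis.Analysis"
begin

text \<open>Bessel function of the first kind, for real order and positive real argument.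
  The reciprocal Gamma function makes the series meaningful for all real orders.\<close>

definition bessel_J :: "real \<Rightarrow> real \<Rightarrow> real" where
  "bessel_J \<nu> x =
     (\<Sum>k. (-1) ^ k / fact k * rGamma (\<nu> + real k + 1) * (x / 2) powr (2 * real k + \<nu>))"

text \<open>The iterated integral with \<open>r\<close> integrations. The integration variable of the successor
  step is the outermost one, \<open>u\<^sub>r\<close>; after unfolding, the innermost integrand contains
  \<open>J\<^bsub>\<rho>+1/2\<^esub>(x / (u\<^sub>1 \<dots> u\<^sub>r))\<close>. The integrals are only conditionally convergent at infinity;
  the Henstock-Kurzweil integral over the half-line coincides with the improper integral.\<close>

definition K_integrand :: "real \<Rightarrow> (real \<Rightarrow> real) \<Rightarrow> real \<Rightarrow> real \<Rightarrow> real" where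
  "K_integrand \<rho> F x u = u powr \<rho> * bessel_J (-1/2) u * F (x / u)"

primrec K_iter :: "real \<Rightarrow> nat \<Rightarrow> real \<Rightarrow> real" where
  "K_iter \<rho> 0 = bessel_J (\<rho> + 1/2)"
| "K_iter \<rho> (Suc r) = (\<lambda>x. integral {0<..} (K_integrand \<rho> (K_iter \<rho> r) x))"

text \<open>Contours running from \<open>-\<i>\<infinity>\<close> to \<open>+\<i>\<infinity>\<close>: simple, piecewise continuously differentiable
  curves that are vertical outside a compact part (the two ends may have different abscissae).\<close>

definition vertical_contour :: "(real \<Rightarrow> complex) \<Rightarrow> bool" where
  "vertical_contour L \<longleftrightarrow>
     inj L \<and> (\<forall>a b. L piecewise_C1_differentiable_on {a..b}) \<and>
     (\<exists>T c d. (\<forall>t\<le>-T. L t = Complex c t) \<and> (\<forall>t\<ge>T. L t = Complex d t))"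

text \<open>A point lies to the left (right) of \<open>L\<close> if it can be joined, without meeting \<open>L\<close>, to a
  point whose real part is smaller (larger) than that of every point of \<open>L\<close>.\<close>

definition left_of_contour :: "(real \<Rightarrow> complex) \<Rightarrow> complex set" where
  "left_of_contour L =
     {z. \<exists>w. (\<forall>t. Re w < Re (L t)) \<and> connected_component (- range L) z w}"

definition right_of_contour :: "(real \<Rightarrow> complex) \<Rightarrow> complex set" where
  "right_of_contour L =
     {z. \<exists>w. (\<forall>t. Re (L t) < Re w) \<and> connected_component (- range L) z w}"

text \<open>In \<open>G\<^bsub>p,q\<^esub>\<^bsup>m,n\<^esup>\<close> the numbers \<open>p\<close> and \<open>q\<close> are the lengths of the parameter lists \<open>as\<close>
  and \<open>bs\<close>; lists are indexed from \<open>0\<close>. The Gamma factors of the denominator are written with the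
  entire function \<open>rGamma = 1/Gamma\<close>.\<close>

definition meijer_integrand ::
  "nat \<Rightarrow> nat \<Rightarrow> complex list \<Rightarrow> complex list \<Rightarrow> complex \<Rightarrow> complex \<Rightarrow> complex" where
  "meijer_integrand m n as bs y s =
     (\<Prod>j<m. Gamma (bs ! j - s)) * (\<Prod>j<n. Gamma (1 - as ! j + s)) *
     (\<Prod>j=m..<length bs. rGamma (1 - bs ! j + s)) *
     (\<Prod>j=n..<length as. rGamma (as ! j - s)) * y powr s"

definition separates_poles ::
  "nat \<Rightarrow> nat \<Rightarrow> complex list \<Rightarrow> complex list \<Rightarrow> (real \<Rightarrow> complex) \<Rightarrow> bool" where
  "separates_poles m n as bs L \<longleftrightarrow>
     {s. \<exists>j<m. bs ! j - s \<in> \<int>\<^sub>\<le>\<^sub>0} \<subseteq> right_of_contour L \<and>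
     {s. \<exists>j<n. 1 - as ! j + s \<in> \<int>\<^sub>\<le>\<^sub>0} \<subseteq> left_of_contour L"

text \<open>As the integral over the whole real line is a Henstock-Kurzweil integral, conditional
  convergence of the contour integral at both ends is allowed.\<close>

definition has_meijer_G ::
  "nat \<Rightarrow> nat \<Rightarrow> complex list \<Rightarrow> complex list \<Rightarrow> complex \<Rightarrow> complex \<Rightarrow> bool" where
  "has_meijer_G m n as bs y v \<longleftrightarrow>
     (\<exists>L I. vertical_contour L \<and> separates_poles m n as bs L \<and>
        ((\<lambda>t. meijer_integrand m n as bs y (L t) * vector_derivative L (at t)) has_integral I) UNIV \<and>
        v = 1 / (2 * of_real pi * \<i>) * I)"

definition meijer_G ::
  "nat \<Rightarrow> nat \<Rightarrow> complex list \<Rightarrow> complex list \<Rightarrow> complex \<Rightarrow> complex" where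
  "meijer_G m n as bs y = (THE v. has_meijer_G m n as bs y v)"

end

theory Submission
  imports Defs "HOL-Complex_Analysis.Complex_Analysis"
begin

text \<open>
  Since \<open>J\<^bsub>-1/2\<^esub>(u) = sqrt (2 / (pi * u)) * cos u\<close>, each integration is a multiplicative convolution
  with a cosine, that is, a multiplication by
  \<open>sqrt pi * 4 powr s * Gamma (1/2 + s) / Gamma (- s)\<close> on the Mellin side.
  Summing residues gives a Mellin-Barnes integral for \<open>J\<^bsub>\<rho>+1/2\<^esub>\<close> over a line \<open>Re s = \<sigma>\<close> slightly to
  the right of \<open>-1/2\<close>; the same line serves for all iterates, with absolute convergence in \<open>s\<close>.
  The \<open>u\<close>-integral converges only conditionally; it is cut off at \<open>R\<close>, and the
  truncated cosine integrals are \<open>O(\<bar>s\<bar> powr (2 * \<sigma> + 1))\<close> uniformly in \<open>R\<close>, which dominates the limit.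

  The value of the contour integral does not depend on the contour: the integrand has a primitive
  \<open>P\<close> on the plane slit along \<open>{..-1/2}\<close>, and closing a contour far to the right shows that every
  admissible contour contributes increments of \<open>P\<close> between its two vertical ends. Along vertical lines the
  logarithmic derivative of the integrand is \<open>(2 * r + 2) * ln \<bar>Im s\<bar> + O(1)\<close>, so mere convergence along
  one vertical end forces the integrals over the horizontal segments joining two ends to vanish.
\<close>

section \<open>Gamma and Digamma on vertical lines\<close>

text \<open>At height \<open>t\<close> a cosine step changes the size of the kernel by
  \<open>\<bar>t\<bar> powr (2 * \<sigma> + 1/2)\<close>, while dominating the truncated cosine
  integrals costs \<open>\<bar>t\<bar> powr (2 * \<sigma> + 1)\<close>. Near \<open>-1/2\<close> the
  former is a gain of almost a square root and the latter an arbitrarily small loss, hence the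
  choice of the line. The poles of every iterate lie among the points \<open>-1/2 - k\<close>, so
  nothing is crossed between steps. Independence of the contour has to be proved because
  \<open>meijer_G\<close> is a definite description over all contours. Some of them end at abscissae
  where the integrand is not absolutely integrable and the integral converges only through its
  oscillation, whose frequency is of order \<open>ln t\<close>. Estimates by absolute values are
  useless on such an end; all that its convergence gives is that the increments of \<open>P\<close>
  along it tend to 0.\<close>

lemma norm_Ln_add_one_approx:
  fixes w :: complex
  assumes "Im w \<noteq> 0" "0 < B" "\<And>v. v \<in> {0..1} \<Longrightarrow> B \<le> norm (w + of_real v)"
  shows "norm (Ln (w + 1) - Ln w - 1 / w) \<le> 1 / B\<^sup>2"
proof -
  define S where "S = closed_segment w (w + 1)"
  have S: "\<exists>v\<in>{0..1}. z = w + of_real v" if "z \<in> S" for z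
    using that by (force simp: S_def in_segment algebra_simps scaleR_conv_of_real)
  have z0: "z \<notin> \<real>\<^sub>\<le>\<^sub>0" if "z \<in> S" for z
    using S[OF that] assms(1) by (auto simp: complex_nonpos_Reals_iff)
  have w: "w \<noteq> 0"
    using assms(1) by auto
  \<comment> \<open>Subtracting \<open>z / w\<close> makes the derivative vanish at
    \<open>w\<close>; on the segment it equals \<open>- v / (w * z)\<close>, which is of second
    order. The nonzero imaginary part keeps the segment off the branch cut.\<close>
  have deriv: "((\<lambda>z. Ln z - z / w) has_field_derivative (1 / z - 1 / w)) (at z within S)"
    if "z \<in> S" for z
    using z0[OF that] w by (auto intro!: derivative_eq_intros simp: field_simps)
  have bnd: "norm (1 / z - 1 / w) \<le> 1 / B\<^sup>2" if "z \<in> S" for z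
  proof -
    obtain v where v: "v \<in> {0..1}" "z = w + of_real v"
      using S[OF \<open>z \<in> S\<close>] by auto
    have "z \<noteq> 0" using z0[OF \<open>z \<in> S\<close>] by auto
    hence "1 / z - 1 / w = - of_real v / (w * z)"
      using w v(2) by (simp add: field_simps)
    hence "norm (1 / z - 1 / w) = v / (norm w * norm z)"
      using v(1) by (simp add: norm_divide norm_mult)
    also have "\<dots> \<le> 1 / (B * B)"
      using v assms(2) assms(3)[of 0] assms(3)[of v]
      by (intro frac_le mult_mono) auto
    finally show ?thesis by (simp add: power2_eq_square)
  qed
  have "norm ((Ln (w + 1) - (w + 1) / w) - (Ln w - w / w)) \<le> (1 / B\<^sup>2) * norm ((w + 1) - w)"
    by (rule field_differentiable_bound[where S = S, OF _ deriv bnd]) (auto simp: S_def)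
  thus ?thesis using w by (simp add: add_divide_distrib algebra_simps)
qed

text \<open>\<open>max 1 (real k - M)\<close> is the lower bound for
  \<open>norm (z + of_nat k)\<close> in a strip: 1 comes from the imaginary part,
  \<open>real k - M\<close> from the real part. It exceeds \<open>real k / 2\<close>
  eventually.\<close>

lemma summable_inverse_max_square:
  fixes M :: real
  shows "summable (\<lambda>k. 1 / (max 1 (real k - M))\<^sup>2)"
proof (rule summable_comparison_test_ev)
  show "summable (\<lambda>k. 4 * inverse (real k ^ 2))"
    by (intro summable_mult inverse_power_summable) auto
  show "\<forall>\<^sub>F k in sequentially. norm (1 / (max 1 (real k - M))\<^sup>2) \<le> 4 * inverse (real k ^ 2)"
    using eventually_ge_at_top[of "nat \<lceil>2 * \<bar>M\<bar>\<rceil> + 1"]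
  proof eventually_elim
    case (elim k)
    hence k: "real k \<ge> 2 * \<bar>M\<bar>" "k \<ge> 1" by linarith+
    have "real k / 2 \<le> max 1 (real k - M)" using k by linarith
    hence "(real k / 2)\<^sup>2 \<le> (max 1 (real k - M))\<^sup>2" by (rule power_mono) simp
    hence "1 / (max 1 (real k - M))\<^sup>2 \<le> 1 / (real k / 2)\<^sup>2"
      using k by (intro divide_left_mono mult_pos_pos zero_less_power) auto
    thus ?case by (simp add: field_simps power2_eq_square)
  qed
qed

lemma tendsto_Ln_add_of_nat:
  "(\<lambda>n. Ln (z + of_nat n) - of_real (ln (real n))) \<longlonglongrightarrow> 0"
proof -
  have *: "(\<lambda>n. Ln (z / of_nat n + 1)) \<longlonglongrightarrow> Ln (0 + 1)"
    by (intro tendsto_intros lim_const_over_n) auto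
  have ev: "\<forall>\<^sub>F n in sequentially. Ln (z / of_nat n + 1) = Ln (z + of_nat n) - of_real (ln (real n))"
    using eventually_ge_at_top[of "nat \<lceil>norm z\<rceil> + 1"]
  proof eventually_elim
    case (elim n)
    hence n: "real n > norm z" "n > 0" by linarith+
    have "\<bar>Re z\<bar> \<le> norm z" by (rule abs_Re_le_cmod)
    hence "z + of_nat n \<noteq> 0" using n by (auto simp: complex_eq_iff)
    thus ?case
      using n Ln_divide_of_real[of "real n" "z + of_nat n"] by (simp add: add_divide_distrib Ln_of_real)
  qed
  have "(\<lambda>n. Ln (z + of_nat n) - of_real (ln (real n))) \<longlonglongrightarrow> Ln (0 + 1)"
    by (rule Lim_transform_eventually[OF * ev])
  thus ?thesis by simp
qed

text \<open>\<open>Digamma z\<close> is the limit of \<open>ln n\<close> minus the sum of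
  \<open>1 / (z + k)\<close>. Telescoping \<open>Ln (z + k)\<close> turns the difference from
  \<open>Ln z\<close> into the series of the errors \<open>u k\<close>. The bound is uniform in a
  strip reaching into the left half-plane, above and below the real axis.\<close>

lemma norm_Digamma_minus_Ln_le:
  assumes "\<bar>Re z\<bar> \<le> M" "\<bar>Im z\<bar> \<ge> 1"
  shows "norm (Digamma z - Ln z) \<le> (\<Sum>k. 1 / (max 1 (real k - M))\<^sup>2)"
proof -
  define u where "u = (\<lambda>k::nat. Ln (z + of_nat k + 1) - Ln (z + of_nat k) - 1 / (z + of_nat k))"
  have z: "z \<noteq> 0" using assms(2) by auto
  have u_le: "norm (u k) \<le> 1 / (max 1 (real k - M))\<^sup>2" for k
    unfolding u_def
  proof (rule norm_Ln_add_one_approx)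
    show "Im (z + of_nat k) \<noteq> 0" using assms(2) by auto
    show "max 1 (real k - M) \<le> norm (z + of_nat k + of_real v)" if "v \<in> {0..1}" for v
      using that assms abs_Im_le_cmod[of "z + of_nat k + of_real v"]
        abs_Re_le_cmod[of "z + of_nat k + of_real v"] by auto
  qed auto
  have sum_u: "(\<Sum>k<n. u k) = (Ln (z + of_nat n) - of_real (ln (real n))) - Ln z
      + (of_real (ln (real n)) - (\<Sum>k<n. inverse (z + of_nat k)))" for n
  proof -
    have "(\<Sum>k<n. u k) = (\<Sum>k<n. Ln (z + of_nat (Suc k)) - Ln (z + of_nat k))
        - (\<Sum>k<n. inverse (z + of_nat k))"
      by (simp add: u_def sum_subtractf [symmetric] field_simps)
    thus ?thesis by (subst (asm) sum_lessThan_telescope) simp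
  qed
  have "(\<lambda>n. \<Sum>k<n. u k) \<longlonglongrightarrow> 0 - Ln z + Digamma z"
    unfolding sum_u by (intro tendsto_intros tendsto_Ln_add_of_nat Digamma_LIMSEQ z)
  hence "u sums (Digamma z - Ln z)" by (simp add: sums_def)
  hence "norm (Digamma z - Ln z) = norm (suminf u)" by (simp add: sums_iff)
  also have "\<dots> \<le> (\<Sum>k. 1 / (max 1 (real k - M))\<^sup>2)"
    by (rule norm_suminf_le[OF u_le summable_inverse_max_square])
  finally show ?thesis .
qed

text \<open>In the strip \<open>Ln z\<close> differs from \<open>ln \<bar>Im z\<bar>\<close> by at
  most \<open>M + pi\<close>: its imaginary part is at most \<open>pi\<close> in modulus, and
  \<open>norm z\<close> lies between \<open>\<bar>Im z\<bar>\<close> and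
  \<open>(1 + M) * \<bar>Im z\<bar>\<close>.\<close>

lemma Digamma_approx_ln:
  fixes M :: real
  obtains C where "C > 0"
    "\<And>z. \<lbrakk>\<bar>Re z\<bar> \<le> M; \<bar>Im z\<bar> \<ge> 1\<rbrakk> \<Longrightarrow> norm (Digamma z - of_real (ln \<bar>Im z\<bar>)) \<le> C"
proof -
  define C where "C = (\<Sum>k. 1 / (max 1 (real k - M))\<^sup>2) + (\<bar>M\<bar> + pi)"
  have "norm (Digamma z - of_real (ln \<bar>Im z\<bar>)) \<le> C" if z: "\<bar>Re z\<bar> \<le> M" "\<bar>Im z\<bar> \<ge> 1" for z
  proof -
    have z0: "z \<noteq> 0" using z by auto
    have "norm z \<le> \<bar>Re z\<bar> + \<bar>Im z\<bar>" by (rule cmod_le)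
    also have "\<dots> \<le> \<bar>Im z\<bar> * (1 + M)"
      using z mult_mono[of "1" "\<bar>Im z\<bar>" "\<bar>Re z\<bar>" M] by (simp add: algebra_simps)
    finally have "ln (norm z) \<le> ln (\<bar>Im z\<bar> * (1 + M))"
      using z0 by (subst ln_le_cancel_iff) (use z in \<open>auto intro!: mult_pos_pos\<close>)
    also have "\<dots> = ln \<bar>Im z\<bar> + ln (1 + M)"
      using z by (subst ln_mult) auto
    also have "\<dots> \<le> ln \<bar>Im z\<bar> + M"
      using z ln_add_one_self_le_self[of M] by auto
    finally have up: "ln (norm z) - ln \<bar>Im z\<bar> \<le> M" by simp
    have lo: "ln \<bar>Im z\<bar> \<le> ln (norm z)"
      using z z0 abs_Im_le_cmod[of z] by (subst ln_le_cancel_iff) auto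
    have "norm (Ln z - of_real (ln \<bar>Im z\<bar>)) \<le> \<bar>Re (Ln z - of_real (ln \<bar>Im z\<bar>))\<bar> + \<bar>Im (Ln z - of_real (ln \<bar>Im z\<bar>))\<bar>"
      by (rule cmod_le)
    also have "\<dots> \<le> M + pi"
      using up lo z0 mpi_less_Im_Ln[OF z0] Im_Ln_le_pi[OF z0] by auto
    finally have "norm (Ln z - of_real (ln \<bar>Im z\<bar>)) \<le> M + pi" .
    moreover have "norm (Digamma z - of_real (ln \<bar>Im z\<bar>)) \<le> norm (Digamma z - Ln z) + norm (Ln z - of_real (ln \<bar>Im z\<bar>))"
      by norm
    ultimately show ?thesis
      using norm_Digamma_minus_Ln_le[OF z] by (simp add: C_def)
  qed
  moreover have "C > 0"
    unfolding C_def by (intro add_nonneg_pos suminf_nonneg summable_inverse_max_square) (auto intro: add_nonneg_pos)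
  ultimately show ?thesis using that by blast
qed

text \<open>After subtraction of \<open>ln \<bar>t\<bar> * z\<close> the derivative is bounded by
  \<open>C\<close> on the whole horizontal segment at height \<open>t\<close>, with \<open>C\<close>
  depending on the strip only.\<close>

lemma ln_Gamma_minus_linear_Lipschitz:
  fixes M :: real
  obtains C where "C > 0"
    "\<And>a b t. \<lbrakk>\<bar>a\<bar> \<le> M; \<bar>b\<bar> \<le> M; \<bar>t\<bar> \<ge> 1\<rbrakk> \<Longrightarrow>
       norm (ln_Gamma (Complex a t) - ln_Gamma (Complex b t) - of_real ((a - b) * ln \<bar>t\<bar>)) \<le> C * \<bar>a - b\<bar>"
proof -
  obtain C where C: "C > 0"
    "\<And>z. \<lbrakk>\<bar>Re z\<bar> \<le> M; \<bar>Im z\<bar> \<ge> 1\<rbrakk> \<Longrightarrow> norm (Digamma z - of_real (ln \<bar>Im z\<bar>)) \<le> C"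
    using Digamma_approx_ln[of M] by blast
  have "norm (ln_Gamma (Complex a t) - ln_Gamma (Complex b t) - of_real ((a - b) * ln \<bar>t\<bar>)) \<le> C * \<bar>a - b\<bar>"
    if ab: "\<bar>a\<bar> \<le> M" "\<bar>b\<bar> \<le> M" and t: "\<bar>t\<bar> \<ge> 1" for a b t
  proof -
    define S where "S = cbox (Complex (- M) t) (Complex M t)"
    have S: "z \<in> S \<longleftrightarrow> \<bar>Re z\<bar> \<le> M \<and> Im z = t" for z
      by (auto simp: S_def in_cbox_complex_iff)
    have "norm ((ln_Gamma (Complex a t) - of_real (ln \<bar>t\<bar>) * Complex a t)
        - (ln_Gamma (Complex b t) - of_real (ln \<bar>t\<bar>) * Complex b t)) \<le> C * norm (Complex a t - Complex b t)"
    proof (rule field_differentiable_bound[where S = S])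
      fix z assume z: "z \<in> S"
      have "z \<notin> \<real>\<^sub>\<le>\<^sub>0" using z S t by (auto simp: complex_nonpos_Reals_iff)
      thus "((\<lambda>z. ln_Gamma z - of_real (ln \<bar>t\<bar>) * z) has_field_derivative
          (Digamma z - of_real (ln \<bar>t\<bar>))) (at z within S)"
        by (auto intro!: derivative_eq_intros)
      show "norm (Digamma z - of_real (ln \<bar>t\<bar>)) \<le> C"
        using C(2)[of z] z S t by auto
    qed (use ab in \<open>auto simp: S_def in_cbox_complex_iff\<close>)
    moreover have "Complex a t - Complex b t = of_real (a - b)"
      by (simp add: complex_eq_iff)
    moreover have "of_real (ln \<bar>t\<bar>) * Complex a t - of_real (ln \<bar>t\<bar>) * Complex b t = of_real ((a - b) * ln \<bar>t\<bar>)"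
      by (simp add: complex_eq_iff algebra_simps)
    ultimately show ?thesis
      by (simp add: algebra_simps del: of_real_diff of_real_mult)
  qed
  thus ?thesis using that C(1) by blast
qed

text \<open>The exponential decay in \<open>t\<close> is common to both values, so their ratio is a
  pure power. This replaces Stirling's formula, since the kernel has equally many Gamma factors in
  numerator and denominator.\<close>

lemma norm_Gamma_vertical_ratio:
  fixes M :: real
  obtains C where "C > 0"
    "\<And>a b t. \<lbrakk>\<bar>a\<bar> \<le> M; \<bar>b\<bar> \<le> M; \<bar>t\<bar> \<ge> 1\<rbrakk> \<Longrightarrow>
       norm (Gamma (Complex a t)) \<le> C * \<bar>t\<bar> powr (a - b) * norm (Gamma (Complex b t))"
proof -
  obtain C where C: "C > 0"
    "\<And>a b t. \<lbrakk>\<bar>a\<bar> \<le> M; \<bar>b\<bar> \<le> M; \<bar>t\<bar> \<ge> 1\<rbrakk> \<Longrightarrow>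
       norm (ln_Gamma (Complex a t) - ln_Gamma (Complex b t) - of_real ((a - b) * ln \<bar>t\<bar>)) \<le> C * \<bar>a - b\<bar>"
    using ln_Gamma_minus_linear_Lipschitz[of M] by blast
  have "norm (Gamma (Complex a t)) \<le> exp (C * (2 * \<bar>M\<bar>)) * \<bar>t\<bar> powr (a - b) * norm (Gamma (Complex b t))"
    if ab: "\<bar>a\<bar> \<le> M" "\<bar>b\<bar> \<le> M" and t: "\<bar>t\<bar> \<ge> 1" for a b t
  proof -
    have G: "norm (Gamma (Complex x t)) = exp (Re (ln_Gamma (Complex x t)))" for x
    proof -
      have "Complex x t \<notin> \<int>\<^sub>\<le>\<^sub>0" using t by (auto elim!: nonpos_Ints_cases simp: complex_eq_iff)
      thus ?thesis by (simp add: Gamma_complex_altdef)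
    qed
    have "Re (ln_Gamma (Complex a t) - ln_Gamma (Complex b t) - of_real ((a - b) * ln \<bar>t\<bar>)) \<le> C * \<bar>a - b\<bar>"
      using C(2)[OF ab t] complex_Re_le_cmod order_trans by blast
    also have "\<dots> \<le> C * (2 * \<bar>M\<bar>)"
      using C(1) ab by (intro mult_left_mono) auto
    finally have "Re (ln_Gamma (Complex a t)) \<le> C * (2 * \<bar>M\<bar>) + (a - b) * ln \<bar>t\<bar> + Re (ln_Gamma (Complex b t))"
      by simp
    hence "exp (Re (ln_Gamma (Complex a t))) \<le> exp (C * (2 * \<bar>M\<bar>) + (a - b) * ln \<bar>t\<bar> + Re (ln_Gamma (Complex b t)))"
      by simp
    also have "\<dots> = exp (C * (2 * \<bar>M\<bar>)) * \<bar>t\<bar> powr (a - b) * exp (Re (ln_Gamma (Complex b t)))"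
      using t by (simp add: exp_add powr_def)
    finally show ?thesis by (simp only: G)
  qed
  thus ?thesis using that[of "exp (C * (2 * \<bar>M\<bar>))"] by auto
qed

section \<open>Limits along vertical lines of a primitive of \<open>exp \<Lambda>\<close>\<close>

lemma exp_Re_linear_growth:
  fixes \<Lambda> \<Lambda>' :: "complex \<Rightarrow> complex"
  assumes \<Lambda>: "\<And>s. Im s > 0 \<Longrightarrow> (\<Lambda> has_field_derivative \<Lambda>' s) (at s)"
    and T: "T > 0" and ab: "a \<le> b"
    and d\<Lambda>: "\<And>\<sigma>. \<sigma> \<in> {a..b} \<Longrightarrow> Re (\<Lambda>' (Complex \<sigma> T)) \<ge> \<beta>"
  shows "norm (exp (\<Lambda> (Complex a T))) \<le> norm (exp (\<Lambda> (Complex b T))) * exp (- \<beta> * (b - a))"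
proof -
  have "Re (\<Lambda> (Complex a T)) - \<beta> * a \<le> Re (\<Lambda> (Complex b T)) - \<beta> * b"
  proof (rule DERIV_nonneg_imp_nondecreasing[OF ab])
    fix \<sigma> assume \<sigma>: "a \<le> \<sigma>" "\<sigma> \<le> b"
    have "((\<lambda>x. Complex x T) has_vector_derivative 1) (at \<sigma>)"
      unfolding Complex_eq by (auto intro!: derivative_eq_intros)
    hence "((\<Lambda> \<circ> (\<lambda>x. Complex x T)) has_vector_derivative (1 * \<Lambda>' (Complex \<sigma> T))) (at \<sigma>)"
      by (rule field_vector_diff_chain_at) (use \<Lambda> T in auto)
    hence "((\<lambda>x. \<Lambda> (Complex x T)) has_vector_derivative \<Lambda>' (Complex \<sigma> T)) (at \<sigma>)"
      by (simp add: o_def)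
    hence "((\<lambda>x. Re (\<Lambda> (Complex x T)) - \<beta> * x) has_real_derivative (Re (\<Lambda>' (Complex \<sigma> T)) - \<beta>)) (at \<sigma>)"
      by (auto intro!: derivative_eq_intros)
    thus "\<exists>y. ((\<lambda>x. Re (\<Lambda> (Complex x T)) - \<beta> * x) has_real_derivative y) (at \<sigma>) \<and> 0 \<le> y"
      using d\<Lambda>[of \<sigma>] \<sigma> by (intro exI conjI) auto
  qed
  hence "exp (Re (\<Lambda> (Complex a T))) \<le> exp (Re (\<Lambda> (Complex b T)) + - \<beta> * (b - a))"
    by (simp add: algebra_simps)
  thus ?thesis by (simp only: exp_add norm_exp_eq_Re)
qed

text \<open>The integrand grows to the right at least like \<open>exp (\<beta> * \<sigma>)\<close>,
  so its integral is dominated by the right end of the segment; the length \<open>b - a\<close> does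
  not enter.\<close>

lemma primitive_horizontal_bound:
  fixes P \<Lambda> \<Lambda>' :: "complex \<Rightarrow> complex"
  assumes P: "\<And>s. Im s > 0 \<Longrightarrow> (P has_field_derivative exp (\<Lambda> s)) (at s)"
    and \<Lambda>: "\<And>s. Im s > 0 \<Longrightarrow> (\<Lambda> has_field_derivative \<Lambda>' s) (at s)"
    and T: "T > 0" and ab: "a \<le> b" and \<beta>: "\<beta> > 0"
    and d\<Lambda>: "\<And>\<sigma>. \<sigma> \<in> {a..b} \<Longrightarrow> Re (\<Lambda>' (Complex \<sigma> T)) \<ge> \<beta>"
  shows "norm (P (Complex b T) - P (Complex a T)) \<le> norm (exp (\<Lambda> (Complex b T))) / \<beta>"
proof (cases "a = b")
  case False
  define N where "N = norm (exp (\<Lambda> (Complex b T)))"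
  define \<phi> where "\<phi> = (\<lambda>\<sigma>. N * exp (- \<beta> * (b - \<sigma>)) / \<beta>)"
  have dP: "((\<lambda>x. P (Complex x T)) has_vector_derivative exp (\<Lambda> (Complex \<sigma> T))) (at \<sigma>)" for \<sigma>
  proof -
    have "((\<lambda>x. Complex x T) has_vector_derivative 1) (at \<sigma>)"
      unfolding Complex_eq by (auto intro!: derivative_eq_intros)
    hence "((P \<circ> (\<lambda>x. Complex x T)) has_vector_derivative (1 * exp (\<Lambda> (Complex \<sigma> T)))) (at \<sigma>)"
      by (rule field_vector_diff_chain_at) (use P T in auto)
    thus ?thesis by (simp add: o_def)
  qed
  have d\<phi>: "(\<phi> has_vector_derivative N * exp (- \<beta> * (b - \<sigma>))) (at \<sigma>)" for \<sigma>
    unfolding \<phi>_def has_real_derivative_iff_has_vector_derivative [symmetric]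
    using \<beta> by (auto intro!: derivative_eq_intros)
  have "norm (P (Complex b T) - P (Complex a T)) \<le> \<phi> b - \<phi> a"
  proof (rule differentiable_bound_general)
    show "a < b" using ab False by simp
    show "continuous_on {a..b} (\<lambda>x. P (Complex x T))"
      using dP by (meson continuous_at_imp_continuous_on has_vector_derivative_continuous)
    show "continuous_on {a..b} \<phi>"
      using d\<phi> by (meson continuous_at_imp_continuous_on has_vector_derivative_continuous)
    fix \<sigma> assume \<sigma>: "a < \<sigma>" "\<sigma> < b"
    show "norm (exp (\<Lambda> (Complex \<sigma> T))) \<le> N * exp (- \<beta> * (b - \<sigma>))"
      unfolding N_def by (rule exp_Re_linear_growth[OF \<Lambda> T]) (use \<sigma> d\<Lambda> in auto)
  qed (use dP d\<phi> in auto)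
  also have "\<dots> \<le> \<phi> b" using \<beta> by (simp add: \<phi>_def N_def)
  finally show ?thesis by (simp add: \<phi>_def N_def)
qed (use \<beta> in auto)

text \<open>On a segment of length \<open>1 / (2 * A)\<close> the integrand stays within half of its maximal modulus of the
  value at the maximum, so there is no cancellation.\<close>

lemma integrand_le_primitive_increment:
  fixes P \<Lambda> \<Lambda>' :: "complex \<Rightarrow> complex"
  assumes P: "\<And>s. Im s > 0 \<Longrightarrow> (P has_field_derivative exp (\<Lambda> s)) (at s)"
    and \<Lambda>: "\<And>s. Im s > 0 \<Longrightarrow> (\<Lambda> has_field_derivative \<Lambda>' s) (at s)"
    and T: "T > 0" and A: "A > 0"
    and d\<Lambda>: "\<And>t. t \<in> {T..T + 1 / (2 * A)} \<Longrightarrow> norm (\<Lambda>' (Complex d t)) \<le> A"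
  shows "norm (exp (\<Lambda> (Complex d T)))
       \<le> 4 * A * norm (P (Complex d (T + 1 / (2 * A))) - P (Complex d T))"
proof -
  define \<delta> where "\<delta> = 1 / (2 * A)"
  have \<delta>: "\<delta> > 0" "A * \<delta> = 1 / 2" using A by (auto simp: \<delta>_def)
  define S where "S = cbox (Complex d T) (Complex d (T + \<delta>))"
  have S: "z \<in> S \<longleftrightarrow> Re z = d \<and> Im z \<in> {T..T + \<delta>}" for z
    by (auto simp: S_def in_cbox_complex_iff)
  have S0: "Im z > 0" if "z \<in> S" for z
    using that T by (auto simp: S)
  have cont: "continuous_on S (\<lambda>z. norm (exp (\<Lambda> z)))"
    by (intro continuous_intros continuous_at_imp_continuous_on ballI DERIV_isCont[OF \<Lambda>] S0)
  have ST: "Complex d T \<in> S" "Complex d (T + \<delta>) \<in> S"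
    using \<delta> by (auto simp: S)
  obtain m where m: "m \<in> S" "\<And>z. z \<in> S \<Longrightarrow> norm (exp (\<Lambda> z)) \<le> norm (exp (\<Lambda> m))"
    using continuous_attains_sup[OF _ _ cont] ST compact_cbox S_def by (metis empty_iff)
  define N where "N = norm (exp (\<Lambda> m))"
  have close: "norm (exp (\<Lambda> z) - exp (\<Lambda> m)) \<le> N / 2" if z: "z \<in> S" for z
  proof -
    have "norm (exp (\<Lambda> z) - exp (\<Lambda> m)) \<le> (A * N) * norm (z - m)"
    proof (rule field_differentiable_bound[where S = S])
      fix w assume w: "w \<in> S"
      show "((\<lambda>z. exp (\<Lambda> z)) has_field_derivative (exp (\<Lambda> w) * \<Lambda>' w)) (at w within S)"
        by (rule has_field_derivative_at_within[OF DERIV_chain2[OF DERIV_exp \<Lambda>[OF S0[OF w]]]])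
      have "norm (\<Lambda>' w) \<le> A"
        using d\<Lambda>[of "Im w"] w by (auto simp: S \<delta>_def complex_surj)
      hence "norm (exp (\<Lambda> w)) * norm (\<Lambda>' w) \<le> N * A"
        using m(2)[OF w] unfolding N_def by (intro mult_mono) auto
      thus "norm (exp (\<Lambda> w) * \<Lambda>' w) \<le> A * N"
        by (simp only: norm_mult mult.commute)
    qed (use z m in \<open>auto simp: S_def\<close>)
    also have "norm (z - m) \<le> \<delta>"
    proof -
      have "z - m = Complex 0 (Im z - Im m)" using z m(1) by (auto simp: S complex_eq_iff)
      hence "norm (z - m) = \<bar>Im z - Im m\<bar>" by (simp add: cmod_def)
      thus ?thesis using z m(1) by (auto simp: S)
    qed
    hence "(A * N) * norm (z - m) \<le> (A * N) * \<delta>"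
      using A by (intro mult_left_mono) (auto simp: N_def)
    also have "(A * N) * \<delta> = (A * \<delta>) * N" by simp
    finally show ?thesis unfolding \<delta>(2) by simp
  qed
  have "norm ((P (Complex d (T + \<delta>)) - exp (\<Lambda> m) * Complex d (T + \<delta>))
      - (P (Complex d T) - exp (\<Lambda> m) * Complex d T)) \<le> (N / 2) * norm (Complex d (T + \<delta>) - Complex d T)"
  proof (rule field_differentiable_bound[where S = S])
    fix w assume w: "w \<in> S"
    show "((\<lambda>z. P z - exp (\<Lambda> m) * z) has_field_derivative (exp (\<Lambda> w) - exp (\<Lambda> m))) (at w within S)"
      using DERIV_diff[OF has_field_derivative_at_within[OF P[OF S0[OF w]]]
          DERIV_cmult[OF DERIV_ident, of "exp (\<Lambda> m)"]] by simp
    show "norm (exp (\<Lambda> w) - exp (\<Lambda> m)) \<le> N / 2"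
      by (rule close[OF w])
  qed (use ST in \<open>auto simp: S_def\<close>)
  moreover have D: "Complex d (T + \<delta>) - Complex d T = \<i> * of_real \<delta>"
    by (simp add: complex_eq_iff)
  moreover have "(P (Complex d (T + \<delta>)) - exp (\<Lambda> m) * Complex d (T + \<delta>)) - (P (Complex d T) - exp (\<Lambda> m) * Complex d T)
      = (P (Complex d (T + \<delta>)) - P (Complex d T)) - exp (\<Lambda> m) * (\<i> * of_real \<delta>)"
    unfolding D [symmetric] by (simp add: algebra_simps)
  ultimately have "norm ((P (Complex d (T + \<delta>)) - P (Complex d T)) - exp (\<Lambda> m) * (\<i> * of_real \<delta>)) \<le> N / 2 * \<delta>"
    using \<delta>(1) by (simp add: norm_mult)
  hence "norm (exp (\<Lambda> m) * (\<i> * of_real \<delta>)) \<le> N / 2 * \<delta> + norm (P (Complex d (T + \<delta>)) - P (Complex d T))"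
    using norm_triangle_ineq3[of "P (Complex d (T + \<delta>)) - P (Complex d T)" "exp (\<Lambda> m) * (\<i> * of_real \<delta>)"]
    by linarith
  hence "N * \<delta> / 2 \<le> norm (P (Complex d (T + \<delta>)) - P (Complex d T))"
    using \<delta>(1) by (simp add: norm_mult N_def)
  hence "N \<le> 4 * A * norm (P (Complex d (T + \<delta>)) - P (Complex d T))"
    using A by (simp add: \<delta>_def field_simps)
  thus ?thesis
    using m(2)[OF ST(1)] unfolding N_def \<delta>_def by linarith
qed

text \<open>If \<open>c \<le> d\<close>, the increments of \<open>P\<close> along \<open>d\<close>
  over steps of length \<open>1 / (2 * A)\<close>, with \<open>A\<close> of order
  \<open>ln T\<close>, tend to 0. Hence the integrand at \<open>Complex d T\<close> is
  \<open>o(ln T)\<close>, and the horizontal bound divides it by a multiple of \<open>ln T\<close>: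
  the two logarithms cancel. If \<open>c > d\<close>, the right end of the segment lies on the line
  \<open>c\<close>, where decay is assumed.\<close>

lemma primitive_limit_transfer:
  fixes P \<Lambda> \<Lambda>' :: "complex \<Rightarrow> complex"
  assumes P: "\<And>s. Im s > 0 \<Longrightarrow> (P has_field_derivative exp (\<Lambda> s)) (at s)"
    and \<Lambda>: "\<And>s. Im s > 0 \<Longrightarrow> (\<Lambda> has_field_derivative \<Lambda>' s) (at s)"
    and \<kappa>: "\<kappa> > 0"
    and d\<Lambda>: "\<And>s. \<lbrakk>\<bar>Re s\<bar> \<le> M; Im s \<ge> 1\<rbrakk> \<Longrightarrow> norm (\<Lambda>' s - of_real (\<kappa> * ln (Im s))) \<le> C"
    and cd: "\<bar>c\<bar> \<le> M" "\<bar>d\<bar> \<le> M"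
    and lim: "((\<lambda>t. P (Complex d t)) \<longlongrightarrow> l) at_top"
    and decay: "((\<lambda>t. exp (\<Lambda> (Complex c t))) \<longlongrightarrow> 0) at_top"
  shows "((\<lambda>t. P (Complex c t)) \<longlongrightarrow> l) at_top"
proof -
  have C: "C \<ge> 0" by (rule order_trans[OF norm_ge_zero d\<Lambda>[of "Complex c 1"]]) (use cd in auto)
  \<comment> \<open>Beyond \<open>T0\<close> the error \<open>C\<close> is at most half of
    \<open>\<kappa> * ln T\<close>, and \<open>A = 4 * \<kappa> * ln T\<close> is at least 1/2, so
    that steps of length \<open>1 / (2 * A)\<close> stay inside \<open>{T..T + 1}\<close>.\<close>
  define T0 where "T0 = exp (max 1 (max (2 * C / \<kappa>) (1 / (8 * \<kappa>))))"
  have T0: "T0 \<ge> exp 1" by (simp add: T0_def)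
  have lnT: "ln T \<ge> 1" "\<kappa> * ln T \<ge> 2 * C" "4 * \<kappa> * ln T \<ge> 1 / 2" if "T \<ge> T0" for T
  proof -
    have "T > 0" using that T0 exp_gt_zero[of "1::real"] by linarith
    hence *: "ln T \<ge> max 1 (max (2 * C / \<kappa>) (1 / (8 * \<kappa>)))"
      using that unfolding T0_def by (subst ln_ge_iff)
    show "ln T \<ge> 1" using * by simp
    have "ln T \<ge> 2 * C / \<kappa>" "ln T \<ge> 1 / (8 * \<kappa>)" using * by simp_all
    thus "\<kappa> * ln T \<ge> 2 * C" "4 * \<kappa> * ln T \<ge> 1 / 2" using \<kappa> by (simp_all add: field_simps)
  qed
  have T0': "T0 \<ge> 2" using T0 exp_ge_add_one_self[of "1::real"] by linarith
  have re: "Re (\<Lambda>' (Complex \<sigma> T)) \<ge> \<kappa> * ln T / 2" if "\<bar>\<sigma>\<bar> \<le> M" "T \<ge> T0" for \<sigma> T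
  proof -
    have "\<bar>Re (\<Lambda>' (Complex \<sigma> T) - of_real (\<kappa> * ln T))\<bar> \<le> C"
      using order_trans[OF abs_Re_le_cmod d\<Lambda>[of "Complex \<sigma> T"]] that T0' by simp
    thus ?thesis using lnT(2)[OF that(2)] by (auto simp: abs_le_iff)
  qed
  have nrm: "norm (\<Lambda>' (Complex \<sigma> t)) \<le> 4 * \<kappa> * ln T" if "\<bar>\<sigma>\<bar> \<le> M" "T \<ge> T0" "t \<in> {T..T + 1}" for \<sigma> T t
  proof -
    have "norm (\<Lambda>' (Complex \<sigma> t) - of_real (\<kappa> * ln t)) \<le> C"
      using d\<Lambda>[of "Complex \<sigma> t"] that T0' by auto
    hence "norm (\<Lambda>' (Complex \<sigma> t)) \<le> C + norm (of_real (\<kappa> * ln t) :: complex)"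
      using norm_triangle_ineq2[of "\<Lambda>' (Complex \<sigma> t)" "of_real (\<kappa> * ln t)"] by linarith
    also have "norm (of_real (\<kappa> * ln t) :: complex) = \<kappa> * ln t"
      using \<kappa> that T0' by (simp add: norm_mult)
    also have "\<dots> \<le> \<kappa> * ln (T * T)"
    proof -
      have T: "2 \<le> T" "t \<le> T + 1" "0 < t" using that T0' by auto
      have "2 * T \<le> T * T" using T by (intro mult_right_mono) linarith+
      hence "t \<le> T * T" using T by linarith
      hence "ln t \<le> ln (T * T)" using T by (intro ln_mono) linarith+
      thus ?thesis using \<kappa> by (intro mult_left_mono) linarith+
    qed
    also have "\<kappa> * ln (T * T) = 2 * \<kappa> * ln T" using that T0' by (simp add: ln_mult)
    finally show ?thesis using lnT(2)[OF that(2)] C by (simp add: mult.assoc)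
  qed
  have "((\<lambda>t. P (Complex d t) - P (Complex c t)) \<longlongrightarrow> 0) at_top"
  proof (cases "c \<le> d")
    case True
    show ?thesis
    proof (rule tendstoI)
      fix e :: real assume e: "e > 0"
      \<comment> \<open>The increment bound has the factor
        \<open>4 * A = 16 * \<kappa> * ln T\<close>, the horizontal bound the factor
        \<open>2 / (\<kappa> * ln T)\<close>. Their product 32 turns an increment of
        \<open>e / 64\<close> into \<open>e / 2\<close>.\<close>
      have "\<forall>\<^sub>F t in at_top. dist (P (Complex d t)) l < e / 128"
        using tendstoD[OF lim, of "e / 128"] e by simp
      then obtain T1 where T1: "\<And>t. t \<ge> T1 \<Longrightarrow> dist (P (Complex d t)) l < e / 128"
        by (auto simp: eventually_at_top_linorder)
      show "\<forall>\<^sub>F t in at_top. dist (P (Complex d t) - P (Complex c t)) 0 < e"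
        using eventually_ge_at_top[of "max T0 T1"]
      proof eventually_elim
        case (elim T)
        hence T: "T \<ge> T0" "T \<ge> T1" "T > 0" using T0' by auto
        note ln = lnT[OF T(1)]
        define A where "A = 4 * \<kappa> * ln T"
        have A: "A > 0" "1 / (2 * A) \<le> 1" "1 / (2 * A) > 0"
          using ln(3) by (simp_all add: A_def [symmetric] divide_le_eq)
        have "dist (P (Complex d (T + 1 / (2 * A)))) l < e / 128" "dist (P (Complex d T)) l < e / 128"
          by (rule T1, use T A(3) in linarith)+
        hence dP: "norm (P (Complex d (T + 1 / (2 * A))) - P (Complex d T)) \<le> e / 64"
          using dist_triangle_half_l[of "P (Complex d (T + 1 / (2 * A)))" l "e / 64" "P (Complex d T)"]
          by (simp add: dist_norm norm_minus_commute)
        have "norm (exp (\<Lambda> (Complex d T)))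
            \<le> 4 * A * norm (P (Complex d (T + 1 / (2 * A))) - P (Complex d T))"
        proof (rule integrand_le_primitive_increment[OF P \<Lambda> T(3) A(1)])
          show "norm (\<Lambda>' (Complex d t)) \<le> A" if "t \<in> {T..T + 1 / (2 * A)}" for t
          proof -
            have "t \<in> {T..T + 1}"
              unfolding atLeastAtMost_iff using that A(2) by (intro conjI; simp only: atLeastAtMost_iff; linarith)
            thus ?thesis
              unfolding A_def by (intro nrm cd T)
          qed
        qed auto
        also have "\<dots> \<le> 4 * A * (e / 64)"
          using dP A(1) by (intro mult_left_mono) auto
        finally have F: "norm (exp (\<Lambda> (Complex d T))) \<le> 4 * A * (e / 64)" .
        have "norm (P (Complex d T) - P (Complex c T)) \<le> norm (exp (\<Lambda> (Complex d T))) / (\<kappa> * ln T / 2)"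
        proof (rule primitive_horizontal_bound[OF P \<Lambda> T(3) True])
          show "0 < \<kappa> * ln T / 2" using \<kappa> ln(1) by simp
          show "\<kappa> * ln T / 2 \<le> Re (\<Lambda>' (Complex \<sigma> T))" if "\<sigma> \<in> {c..d}" for \<sigma>
            using that cd T(1) by (intro re) auto
        qed auto
        also have "\<dots> \<le> 4 * A * (e / 64) / (\<kappa> * ln T / 2)"
          using F \<kappa> ln(1) by (intro divide_right_mono) auto
        also have "\<dots> = e / 2" using \<kappa> ln(1) by (simp add: A_def field_simps)
        finally show ?case using e by (simp add: dist_norm)
      qed
    qed
  next
    case False
    show ?thesis
    proof (rule Lim_null_comparison)
      show "\<forall>\<^sub>F T in at_top. norm (P (Complex d T) - P (Complex c T)) \<le> norm (exp (\<Lambda> (Complex c T))) * (2 / \<kappa>)"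
        using eventually_ge_at_top[of T0]
      proof eventually_elim
        case (elim T)
        have "norm (P (Complex c T) - P (Complex d T)) \<le> norm (exp (\<Lambda> (Complex c T))) / (\<kappa> / 2)"
        proof (rule primitive_horizontal_bound[OF P \<Lambda>])
          show "T > 0" "\<kappa> / 2 > 0" "d \<le> c" using elim T0' \<kappa> False by auto
          fix \<sigma> assume "\<sigma> \<in> {d..c}"
          hence "\<kappa> * ln T / 2 \<le> Re (\<Lambda>' (Complex \<sigma> T))"
            using cd elim by (intro re) auto
          moreover have "\<kappa> / 2 \<le> \<kappa> * ln T / 2" using lnT(1)[OF elim] \<kappa> by simp
          ultimately show "\<kappa> / 2 \<le> Re (\<Lambda>' (Complex \<sigma> T))" by simp
        qed auto
        thus ?case by (simp add: norm_minus_commute)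
      qed
      show "((\<lambda>T. norm (exp (\<Lambda> (Complex c T))) * (2 / \<kappa>)) \<longlongrightarrow> 0) at_top"
        using tendsto_mult_right[OF tendsto_norm[OF decay], of "2 / \<kappa>"] by simp
    qed
  qed
  from tendsto_diff[OF lim this] show ?thesis by simp
qed

section \<open>Integrals along vertical contours\<close>

text \<open>Bridges two parametrisations: \<open>has_contour_integral\<close> refers to paths on
  \<open>{0..1}\<close>, the Meijer integral to a curve over the real line. The finitely many
  corners form a spike set.\<close>

lemma has_integral_along_affine_reparam:
  fixes L :: "real \<Rightarrow> complex"
  assumes ab: "a < b" and L: "L piecewise_C1_differentiable_on {a..b}"
    and F: "(F has_contour_integral v) (L \<circ> (\<lambda>x. (b - a) *\<^sub>R x + a))"
  shows "((\<lambda>t. F (L t) * vector_derivative L (at t)) has_integral v) {a..b}"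
proof -
  define g where "g = L \<circ> (\<lambda>x. (b - a) *\<^sub>R x + a)"
  obtain S where S: "finite S" "L C1_differentiable_on ({a..b} - S)"
    using L by (auto simp: piecewise_C1_differentiable_on_def)
  obtain D where D: "\<And>t. t \<in> {a..b} - S \<Longrightarrow> (L has_vector_derivative D t) (at t)"
    using S(2) unfolding C1_differentiable_on_def by blast
  define S' where "S' = (\<lambda>t. (t - a) / (b - a)) ` S"
  have "((\<lambda>x. F (g x) * vector_derivative g (at x)) has_integral v) {0..1}"
    using F unfolding has_contour_integral_def g_def [symmetric]
    by (simp add: has_integral_localized_vector_derivative)
  hence "((\<lambda>x. (b - a) *\<^sub>R (F (L ((b - a) *\<^sub>R x + a)) * vector_derivative L (at ((b - a) *\<^sub>R x + a))))
      has_integral v) {0..1}"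
  proof (rule has_integral_spike_finite[rotated 2])
    show "finite S'" using S(1) by (simp add: S'_def)
    fix x assume x: "x \<in> {0..1} - S'"
    define t where "t = (b - a) *\<^sub>R x + a"
    have "x = (t - a) / (b - a)" using ab by (simp add: t_def)
    hence "t \<notin> S" using x by (auto simp: S'_def)
    moreover have "t \<in> {a..b}"
    proof -
      define p where "p = (b - a) * x"
      have "0 \<le> p" "p \<le> b - a"
        unfolding p_def using x ab by (auto intro!: mult_left_le)
      thus ?thesis by (simp add: t_def flip: p_def)
    qed
    ultimately have Dt: "(L has_vector_derivative D t) (at t)" using D by blast
    have "((\<lambda>x. (b - a) *\<^sub>R x + a) has_vector_derivative (b - a)) (at x)"
      by (auto intro!: derivative_eq_intros)
    hence "(g has_vector_derivative ((b - a) *\<^sub>R D t)) (at x)"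
      unfolding g_def by (rule vector_diff_chain_at) (use Dt in \<open>simp add: t_def\<close>)
    hence "vector_derivative g (at x) = (b - a) *\<^sub>R D t" by (rule vector_derivative_at)
    moreover have "vector_derivative L (at t) = D t" using Dt by (rule vector_derivative_at)
    ultimately show "(b - a) *\<^sub>R (F (L ((b - a) *\<^sub>R x + a)) * vector_derivative L (at ((b - a) *\<^sub>R x + a)))
        = F (g x) * vector_derivative g (at x)"
      unfolding g_def o_def t_def by simp
  qed
  hence "((\<lambda>x. F (L ((b - a) *\<^sub>R x + a)) * vector_derivative L (at ((b - a) *\<^sub>R x + a)))
      has_integral (v /\<^sub>R (b - a))) {0..1}"
    using ab by (subst (asm) has_integral_cmul_iff') auto
  thus ?thesis
    using has_integral_affinity_iff[of "b - a" "\<lambda>t. F (L t) * vector_derivative L (at t)" a v a b] ab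
    by simp
qed

text \<open>The slit plane is starlike about \<open>q + 1\<close>. The poles are hidden in the slit,
  so their residues are no obstruction to a single-valued primitive.\<close>

lemma slit_plane_primitive:
  fixes q :: real
  assumes "F holomorphic_on - {s. Im s = 0 \<and> Re s \<le> q}"
  obtains P where "\<And>s. \<not> (Im s = 0 \<and> Re s \<le> q) \<Longrightarrow> (P has_field_derivative F s) (at s)"
proof -
  define S where "S = - {s. Im s = 0 \<and> Re s \<le> q}"
  have "closed ({s. Im s = 0} \<inter> {s. Re s \<le> q})"
    by (intro closed_Int closed_Collect_eq closed_Collect_le continuous_intros)
  hence op: "open S" unfolding S_def Collect_conj_eq by (rule open_Compl)
  have "starlike S"
    unfolding starlike_def
  proof (intro bexI ballI)
    show "of_real (q + 1) \<in> S" by (simp add: S_def)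
    fix x assume x: "x \<in> S"
    show "closed_segment (of_real (q + 1)) x \<subseteq> S"
    proof
      fix z assume "z \<in> closed_segment (of_real (q + 1)) x"
      then obtain u where u: "0 \<le> u" "u \<le> 1" "z = (1 - u) *\<^sub>R of_real (q + 1) + u *\<^sub>R x"
        by (auto simp: in_segment)
      show "z \<in> S"
      proof (cases "u = 0 \<or> Im x \<noteq> 0")
        case True
        thus ?thesis using u by (auto simp: S_def)
      next
        case False
        hence "Re x > q" "u > 0" using x u by (auto simp: S_def)
        hence "u * q < u * Re x" by simp
        moreover have "(1 - u) * q \<le> (1 - u) * (q + 1)" using u by (intro mult_left_mono) auto
        ultimately have "q < (1 - u) * (q + 1) + u * Re x" by (simp add: algebra_simps)
        thus ?thesis using u(3) by (simp add: S_def)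
      qed
    qed
  qed
  hence "\<exists>g. \<forall>x\<in>S. (g has_field_derivative F x) (at x)"
    using assms op
    by (intro holomorphic_starlike_primitive[where k = "{}"])
       (auto simp: S_def intro: holomorphic_on_imp_continuous_on holomorphic_on_imp_differentiable_at)
  thus ?thesis using that by (auto simp: S_def)
qed

text \<open>\<open>L\<close> may cross the slit, so the increment of \<open>P\<close> cannot be read
  off along \<open>L\<close> itself. The closing path \<open>h\<close> meets the real axis to the
  right of \<open>q\<close> and stays in the slit plane, where \<open>P\<close> applies. Cauchy's
  theorem for the loop requires winding number 0 about every pole, and that is what
  \<open>left_of_contour\<close> provides.\<close>

lemma integral_along_vertical_contour:
  fixes q :: real and F P :: "complex \<Rightarrow> complex"
  defines "Z \<equiv> range (\<lambda>k. of_real (q - real k))"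
  assumes L: "vertical_contour L" and left: "Z \<subseteq> left_of_contour L"
    and hol: "F holomorphic_on - Z"
    and P: "\<And>s. \<not> (Im s = 0 \<and> Re s \<le> q) \<Longrightarrow> (P has_field_derivative F s) (at s)"
  obtains c d T where "T > 0" "\<And>t. t \<le> -T \<Longrightarrow> L t = Complex c t" "\<And>t. t \<ge> T \<Longrightarrow> L t = Complex d t"
    "\<And>a b. \<lbrakk>a \<le> -T; b \<ge> T\<rbrakk> \<Longrightarrow>
       ((\<lambda>t. F (L t) * vector_derivative L (at t)) has_integral (P (L b) - P (L a))) {a..b}"
proof -
  obtain T0 c d where T0: "\<And>t. t \<le> -T0 \<Longrightarrow> L t = Complex c t" "\<And>t. t \<ge> T0 \<Longrightarrow> L t = Complex d t"
    using L unfolding vertical_contour_def by blast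
  define T where "T = max 1 T0"
  have T: "T \<ge> 1" "\<And>t. t \<le> -T \<Longrightarrow> L t = Complex c t" "\<And>t. t \<ge> T \<Longrightarrow> L t = Complex d t"
    using T0 by (auto simp: T_def)
  have pw: "L piecewise_C1_differentiable_on {a..b}" for a b
    using L by (auto simp: vertical_contour_def)
  have "continuous_on {-T..T} L"
    using pw by (auto simp: piecewise_C1_differentiable_on_def)
  hence cpt: "compact (L ` {-T..T})" by (intro compact_continuous_image) auto
  then obtain B0 where B0: "\<And>t. t \<in> {-T..T} \<Longrightarrow> norm (L t) \<le> B0"
    using compact_imp_bounded bounded_iff by (metis imageI)
  define B where "B = B0 + \<bar>c\<bar> + \<bar>d\<bar>"
  have B: "\<bar>Re (L t)\<bar> \<le> B" for t
  proof (cases "t \<in> {-T..T}")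
    case True
    thus ?thesis using B0[OF True] abs_Re_le_cmod[of "L t"] by (simp add: B_def)
  next
    case False
    have "B0 \<ge> 0" using order_trans[OF norm_ge_zero B0[of 0]] T(1) by simp
    thus ?thesis using False T(2)[of t] T(3)[of t] by (auto simp: B_def)
  qed
  have "range L = L ` {-T..T} \<union> ({z. Re z = c} \<inter> {z. Im z \<le> -T}) \<union> ({z. Re z = d} \<inter> {z. Im z \<ge> T})"
    (is "_ = ?R")
  proof (intro equalityI subsetI)
    fix z assume "z \<in> range L"
    then obtain t where t: "z = L t" by auto
    show "z \<in> ?R"
      using T(2)[of t] T(3)[of t] t by (cases "t \<in> {-T..T}") auto
  next
    fix z assume z: "z \<in> ?R"
    have "z = L (Im z)" if "z \<notin> L ` {-T..T}"
      using z that T(2)[of "Im z"] T(3)[of "Im z"] by (auto simp: complex_eq_iff)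
    thus "z \<in> range L" by blast
  qed
  moreover have "closed ?R"
    by (intro closed_Un closed_Int compact_imp_closed[OF cpt] closed_Collect_eq closed_Collect_le continuous_intros)
  ultimately have op: "open (- range L)" unfolding open_closed by (simp only: double_compl)
  \<comment> \<open>The complement of \<open>range L\<close> is open, so a connecting set can be
    taken to be the image of a path. It is then bounded, and a sufficiently remote closing path
    misses it.\<close>
  have "\<exists>w E D. connected E \<and> p \<in> E \<and> w \<in> E \<and> E \<inter> range L = {} \<and> (\<forall>z\<in>E. norm z \<le> D) \<and> (\<forall>t. Re w < Re (L t))"
    if "p \<in> Z" for p
  proof -
    obtain w where w: "\<And>t. Re w < Re (L t)" "connected_component (- range L) p w"
      using left \<open>p \<in> Z\<close> by (auto simp: left_of_contour_def)
    hence "path_component (- range L) p w"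
      using op open_path_connected_component by metis
    then obtain g where g: "path g" "path_image g \<subseteq> - range L" "pathstart g = p" "pathfinish g = w"
      unfolding path_component_def by blast
    obtain D where "\<forall>z\<in>path_image g. norm z \<le> D"
      using bounded_path_image[OF g(1)] bounded_iff by blast
    with g w show ?thesis
      by (intro exI[of _ w] exI[of _ "path_image g"] exI[of _ D]) (auto intro: connected_path_image)
  qed
  then obtain w E D where wED: "\<And>p. p \<in> Z \<Longrightarrow> connected (E p) \<and> p \<in> E p \<and> w p \<in> E p \<and> E p \<inter> range L = {} \<and>
      (\<forall>z\<in>E p. norm z \<le> D p) \<and> (\<forall>t. Re (w p) < Re (L t))"
    by metis
  define Z' where "Z' = {p \<in> Z. Re p \<ge> - B}"
  have "Z' \<subseteq> (\<lambda>k. of_real (q - real k)) ` {k. real k \<le> q + B}"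
    by (auto simp: Z'_def Z_def)
  moreover have "finite {k. real k \<le> q + B}"
    by (rule finite_subset[of _ "{..nat \<lceil>q + B\<rceil>}"]) (auto, linarith)
  ultimately have fin: "finite Z'" using finite_surj by blast
  define D0 where "D0 = Max (insert 0 (D ` Z'))"
  have D0: "D p \<le> D0" if "p \<in> Z'" for p
    using fin that by (auto simp: D0_def intro!: Max_ge)
  define T1 where "T1 = max T (D0 + 1)"
  \<comment> \<open>\<open>B + 1\<close> places the closing side to the right of all of
    \<open>L\<close>, \<open>q + 1\<close> to the right of the slit.\<close>
  define X where "X = max (B + 1) (max (D0 + 1) (q + 1))"
  have main: "((\<lambda>t. F (L t) * vector_derivative L (at t)) has_integral (P (L b) - P (L a))) {a..b}"
    if ab: "a \<le> - T1" "b \<ge> T1" for a b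
  proof -
    have ab': "a \<le> - T" "b \<ge> T" "a < - D0" "b > D0" "a < b" "a < 0" "b > 0"
      using ab T(1) by (auto simp: T1_def)
    have La: "L a = Complex c a" and Lb: "L b = Complex d b" using T ab' by auto
    define g where "g = L \<circ> (\<lambda>x. (b - a) *\<^sub>R x + a)"
    define h where "h = linepath (L b) (Complex X b) +++ linepath (Complex X b) (Complex X a) +++
        linepath (Complex X a) (L a)"
    have img: "(\<lambda>x. (b - a) * x + a) ` {0..1} = {a..b}"
      using ab' by (subst image_affinity_atLeastAtMost) auto
    have vg: "valid_path g"
      unfolding valid_path_def g_def by (rule piecewise_C1_differentiable_affine) (unfold img, rule pw)
    have vh: "valid_path h" by (simp add: h_def)
    have ends: "pathstart g = L a" "pathfinish g = L b" "pathstart h = L b" "pathfinish h = L a"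
      by (auto simp: g_def h_def pathstart_def pathfinish_def pathstart_join pathfinish_join joinpaths_def linepath_def)
    have pg: "path_image g = L ` {a..b}"
      unfolding path_image_def g_def image_comp [symmetric] real_scaleR_def img ..
    have ph: "path_image h \<subseteq> {z. Im z = a \<or> Im z = b \<or> Re z = X}"
      unfolding h_def by (auto simp: path_image_join closed_segment_same_Im closed_segment_same_Re La Lb)
    have hRe: "\<bar>c\<bar> \<le> B" "\<bar>d\<bar> \<le> B" using B[of a] B[of b] La Lb by auto
    have phRe: "path_image h \<subseteq> {z. Re z \<ge> min c d}"
    proof -
      have cx: "convex {z. Re z \<ge> min c d}" using convex_halfspace_Re_ge[of "min c d"] by simp
      have X: "X \<ge> c" using hRe by (auto simp: X_def)
      show ?thesis
        unfolding h_def by (simp add: path_image_join) (intro conjI closed_segment_subset cx; use X in \<open>simp add: La Lb min_le_iff_disj\<close>)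
    qed
    define \<gamma> where "\<gamma> = g +++ h"
    have v\<gamma>: "valid_path \<gamma>" unfolding \<gamma>_def using vg vh ends by (intro valid_path_join) auto
    have p\<gamma>: "path_image \<gamma> = L ` {a..b} \<union> path_image h"
      unfolding \<gamma>_def using ends pg by (simp add: path_image_join)
    have loop: "pathfinish \<gamma> = pathstart \<gamma>" by (simp add: \<gamma>_def ends)
    have wind_left: "winding_number \<gamma> z = 0" if "\<And>t. Re z < Re (L t)" for z
    proof (rule winding_number_zero_outside[OF valid_path_imp_path[OF v\<gamma>] _ loop])
      show "convex {u. Re u > Re z}" by (rule convex_halfspace_Re_gt)
      have "Re z < min c d" using that[of a] that[of b] La Lb by simp
      thus "path_image \<gamma> \<subseteq> {u. Re u > Re z}"
        unfolding p\<gamma> using phRe that by (fastforce simp: subset_iff)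
    qed auto
    \<comment> \<open>Only finitely many poles are not to the left of all of \<open>L\<close>; the heights and \<open>X\<close> are so large that the
      added part of the loop avoids the sets joining these poles to the far left.\<close>
    have wind: "winding_number \<gamma> p = 0" if p: "p \<in> Z" for p
    proof (cases "p \<in> Z'")
      case False
      hence "Re p < - B" using p by (auto simp: Z'_def)
      thus ?thesis using B by (intro wind_left) (smt (verit))
    next
      case True
      have "E p \<inter> path_image \<gamma> = {}"
      proof -
        have "z \<notin> path_image h" if "z \<in> E p" for z
        proof -
          have "norm z \<le> D0" using wED[OF p] D0[OF True] that by fastforce
          hence "\<bar>Re z\<bar> \<le> D0" "\<bar>Im z\<bar> \<le> D0"
            using abs_Re_le_cmod[of z] abs_Im_le_cmod[of z] by linarith+
          hence "Re z < X" "Im z \<noteq> a" "Im z \<noteq> b" using ab' by (auto simp: X_def)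
          thus ?thesis using ph by auto
        qed
        thus ?thesis using wED[OF p] p\<gamma> by auto
      qed
      hence "winding_number \<gamma> p = winding_number \<gamma> (w p)"
        using wED[OF p] by (intro winding_number_eq[OF valid_path_imp_path[OF v\<gamma>] loop]) auto
      also have "\<dots> = 0" using wED[OF p] by (intro wind_left) auto
      finally show ?thesis .
    qed
    have hS: "\<not> (Im z = 0 \<and> Re z \<le> q)" if "z \<in> path_image h" for z
      using that ph ab' by (auto simp: X_def)
    have "closed Z"
    proof -
      have "Z = (\<lambda>z. of_real q - z) -` \<nat>"
      proof (intro equalityI subsetI)
        fix z :: complex assume "z \<in> (\<lambda>z. of_real q - z) -` \<nat>"
        then obtain k where "of_real q - z = of_nat k" by (auto elim: Nats_cases)
        hence "z = of_real (q - real k)" by (simp add: algebra_simps)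
        thus "z \<in> Z" by (auto simp: Z_def)
      qed (auto simp: Z_def)
      also have "closed \<dots>"
        by (intro closed_vimage closed_Nats continuous_intros)
      finally show ?thesis .
    qed
    have sub: "path_image \<gamma> \<subseteq> - Z"
    proof -
      have "L t \<notin> Z" for t using wED by fastforce
      moreover have "z \<notin> Z" if "z \<in> path_image h" for z using hS[OF that] by (auto simp: Z_def)
      ultimately show ?thesis using p\<gamma> by auto
    qed
    have "(F has_contour_integral 0) \<gamma>"
      by (rule Cauchy_theorem_global[OF _ hol v\<gamma> loop sub]) (use \<open>closed Z\<close> wind in \<open>auto simp: open_Compl\<close>)
    moreover have Fh: "(F has_contour_integral (P (L a) - P (L b))) h"
      using contour_integral_primitive[of "- {s. Im s = 0 \<and> Re s \<le> q}" P F h] vh ends hS P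
      by (auto intro: has_field_derivative_at_within)
    moreover have "F contour_integrable_on g"
    proof -
      have "F contour_integrable_on \<gamma>" using \<open>(F has_contour_integral 0) \<gamma>\<close> by (auto simp: contour_integrable_on_def)
      thus ?thesis using contour_integrable_joinD1 vg unfolding \<gamma>_def by blast
    qed
    then obtain v where Fg: "(F has_contour_integral v) g" by (auto simp: contour_integrable_on_def)
    have "(F has_contour_integral (v + (P (L a) - P (L b)))) \<gamma>"
      unfolding \<gamma>_def by (rule has_contour_integral_join[OF Fg Fh vg vh])
    ultimately have "v + (P (L a) - P (L b)) = 0" by (metis contour_integral_unique)
    hence "v = P (L b) - P (L a)" by (simp add: algebra_simps)
    thus ?thesis
      using has_integral_along_affine_reparam[OF ab'(5) pw] Fg unfolding g_def by blast
  qed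
  show ?thesis
    by (rule that[of T1 c d]) (use T main in \<open>auto simp: T1_def\<close>)
qed

section \<open>The Mellin-Barnes kernel\<close>

text \<open>\<open>k\<close> counts the integrations: \<open>k = 0\<close> belongs to the Bessel
  function, and each cosine step contributes one further quotient
  \<open>Gamma (1/2 + s) * rGamma (- s)\<close>. Its remaining factors go into the prefactor and
  into \<open>y\<close>.\<close>

definition MB_kernel :: "real \<Rightarrow> nat \<Rightarrow> complex \<Rightarrow> complex" where
  "MB_kernel \<rho> k s = Gamma (1/2 + s) ^ (k + 1) * rGamma (of_real \<rho> + 1 - s) * rGamma (- s) ^ k"

text \<open>Built from \<open>ln_Gamma\<close>, this logarithm is holomorphic off the real axis,
  whereas \<open>Ln\<close> of the kernel could jump there.\<close>

definition ln_MB_kernel :: "real \<Rightarrow> nat \<Rightarrow> complex \<Rightarrow> complex" where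
  "ln_MB_kernel \<rho> k s =
     of_nat (k + 1) * ln_Gamma (1/2 + s) - ln_Gamma (of_real \<rho> + 1 - s) - of_nat k * ln_Gamma (- s)"

lemma meijer_integrand_eq_MB_kernel:
  fixes \<rho> :: real and r :: nat
  defines "as \<equiv> replicate (r + 1) (1/2) @ [of_real \<rho> + 1] @ replicate r 0"
  shows "meijer_integrand 0 (r + 1) as [] y s = MB_kernel \<rho> r s * y powr s"
proof -
  have "(\<Prod>j<r + 1. Gamma (1 - as ! j + s)) = (\<Prod>j<r + 1. Gamma (1/2 + s))"
    by (intro prod.cong) (auto simp: as_def nth_append simp del: replicate_Suc)
  hence 1: "(\<Prod>j<r + 1. Gamma (1 - as ! j + s)) = Gamma (1/2 + s) ^ (r + 1)" by simp
  have len: "length as = Suc (r + 1 + r)" by (simp add: as_def)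
  have "(\<Prod>j=r+1..<length as. rGamma (as ! j - s))
      = rGamma (as ! (r + 1) - s) * (\<Prod>j=Suc (r + 1)..<length as. rGamma (as ! j - s))"
    by (rule prod.atLeast_Suc_lessThan) (simp add: len)
  also have "as ! (r + 1) = of_real \<rho> + 1" by (simp add: as_def nth_append del: replicate_Suc)
  also have "(\<Prod>j=Suc (r + 1)..<length as. rGamma (as ! j - s)) = (\<Prod>j=Suc (r + 1)..<length as. rGamma (- s))"
    by (intro prod.cong) (auto simp: as_def nth_append nth_Cons' simp del: replicate_Suc)
  also have "\<dots> = rGamma (- s) ^ r" by (simp add: len)
  finally have 2: "(\<Prod>j=r+1..<length as. rGamma (as ! j - s)) = rGamma (of_real \<rho> + 1 - s) * rGamma (- s) ^ r" .
  show ?thesis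
    unfolding meijer_integrand_def 1 2 MB_kernel_def by simp
qed

lemma separates_poles_iff:
  fixes \<rho> :: real and r :: nat
  defines "as \<equiv> replicate (r + 1) (1/2) @ [of_real \<rho> + 1] @ replicate r 0"
  shows "separates_poles 0 (r + 1) as [] L \<longleftrightarrow> range (\<lambda>k. of_real (-1/2 - real k)) \<subseteq> left_of_contour L"
proof -
  have "{s. \<exists>j<r + 1. 1 - as ! j + s \<in> \<int>\<^sub>\<le>\<^sub>0} = range (\<lambda>k. of_real (-1/2 - real k) :: complex)"
  proof (intro equalityI subsetI)
    fix s assume "s \<in> {s. \<exists>j<r + 1. 1 - as ! j + s \<in> \<int>\<^sub>\<le>\<^sub>0}"
    hence "1/2 + s \<in> \<int>\<^sub>\<le>\<^sub>0" by (auto simp: as_def nth_append simp del: replicate_Suc)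
    then obtain n where "1/2 + s = - of_nat n" by (elim nonpos_Ints_cases')
    hence "s = of_real (-1/2 - real n)" by (simp add: algebra_simps eq_neg_iff_add_eq_0)
    thus "s \<in> range (\<lambda>k. of_real (-1/2 - real k))" by blast
  next
    fix s :: complex assume "s \<in> range (\<lambda>k. of_real (-1/2 - real k))"
    then obtain n where "s = of_real (-1/2 - real n)" by blast
    hence "1 - as ! 0 + s = - of_nat n" by (simp add: as_def nth_append)
    thus "s \<in> {s. \<exists>j<r + 1. 1 - as ! j + s \<in> \<int>\<^sub>\<le>\<^sub>0}" by (intro CollectI exI[of _ 0]) simp
  qed
  thus ?thesis by (simp add: separates_poles_def)
qed

lemma not_nonpos_Reals_if_Im: "Im z \<noteq> 0 \<Longrightarrow> z \<notin> \<real>\<^sub>\<le>\<^sub>0"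
  by (auto simp: complex_nonpos_Reals_iff)

lemma MB_kernel_eq_exp:
  assumes "Im s \<noteq> 0"
  shows "MB_kernel \<rho> k s = exp (ln_MB_kernel \<rho> k s)"
proof -
  have G: "Gamma z = exp (ln_Gamma z)" if "Im z \<noteq> 0" for z :: complex
    using that by (auto simp: Gamma_complex_altdef elim!: nonpos_Ints_cases)
  have "Gamma (1/2 + s) = exp (ln_Gamma (1/2 + s))" "Gamma (of_real \<rho> + 1 - s) = exp (ln_Gamma (of_real \<rho> + 1 - s))"
    "Gamma (- s) = exp (ln_Gamma (- s))"
    using assms by (intro G; simp)+
  thus ?thesis
    unfolding MB_kernel_def ln_MB_kernel_def rGamma_inverse_Gamma exp_diff exp_of_nat_mult
    by (simp only: divide_inverse power_inverse)
qed

lemma has_field_derivative_ln_MB_kernel: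
  assumes "Im s \<noteq> 0"
  shows "(ln_MB_kernel \<rho> k has_field_derivative
    (of_nat (k + 1) * Digamma (1/2 + s) + Digamma (of_real \<rho> + 1 - s) + of_nat k * Digamma (- s))) (at s)"
  unfolding ln_MB_kernel_def
  using assms by (auto intro!: derivative_eq_intros not_nonpos_Reals_if_Im simp del: of_nat_Suc)

text \<open>The Gamma factors in \<open>- s\<close> stand in the denominator, so the two signs
  cancel and all \<open>2 * k + 2\<close> Digamma terms add up, each contributing
  \<open>ln \<bar>Im s\<bar>\<close> up to a bounded error.\<close>

lemma ln_MB_kernel_derivative_bound:
  fixes \<rho> M :: real
  obtains C where "C > 0"
    "\<And>s. \<lbrakk>\<bar>Re s\<bar> \<le> M; \<bar>Im s\<bar> \<ge> 1\<rbrakk> \<Longrightarrow>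
       norm (of_nat (k + 1) * Digamma (1/2 + s) + Digamma (of_real \<rho> + 1 - s) + of_nat k * Digamma (- s)
             - of_real ((2 * real k + 2) * ln \<bar>Im s\<bar>)) \<le> C"
proof -
  define M' where "M' = \<bar>M\<bar> + \<bar>\<rho>\<bar> + 1"
  obtain C where C: "C > 0"
    "\<And>z. \<lbrakk>\<bar>Re z\<bar> \<le> M'; \<bar>Im z\<bar> \<ge> 1\<rbrakk> \<Longrightarrow> norm (Digamma z - of_real (ln \<bar>Im z\<bar>)) \<le> C"
    using Digamma_approx_ln[of M'] by blast
  have "norm (of_nat (k + 1) * Digamma (1/2 + s) + Digamma (of_real \<rho> + 1 - s) + of_nat k * Digamma (- s)
             - of_real ((2 * real k + 2) * ln \<bar>Im s\<bar>)) \<le> real (k + 1) * C + C + real k * C"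
    if s: "\<bar>Re s\<bar> \<le> M" "\<bar>Im s\<bar> \<ge> 1" for s
  proof -
    define l where "l = complex_of_real (ln \<bar>Im s\<bar>)"
    have eq: "of_nat (k + 1) * Digamma (1/2 + s) + Digamma (of_real \<rho> + 1 - s) + of_nat k * Digamma (- s)
          - of_real ((2 * real k + 2) * ln \<bar>Im s\<bar>)
        = of_nat (k + 1) * (Digamma (1/2 + s) - l) + (Digamma (of_real \<rho> + 1 - s) - l) + of_nat k * (Digamma (- s) - l)"
      by (simp add: l_def algebra_simps)
    have "norm (Digamma (1/2 + s) - l) \<le> C" "norm (Digamma (of_real \<rho> + 1 - s) - l) \<le> C" "norm (Digamma (- s) - l) \<le> C"
      using C(2)[of "1/2 + s"] C(2)[of "of_real \<rho> + 1 - s"] C(2)[of "- s"] s by (auto simp: l_def M'_def)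
    thus ?thesis
      unfolding eq by (intro order.trans[OF norm_triangle_ineq] add_mono) (auto simp: norm_mult simp del: of_nat_Suc intro!: mult_left_mono)
  qed
  moreover have "real (k + 1) * C + C + real k * C > 0"
    using C(1) by (intro add_pos_nonneg add_pos_pos) auto
  ultimately show ?thesis using that by blast
qed

text \<open>This symmetry lets the lower ends of contours be treated in the upper
  half-plane.\<close>

lemma MB_kernel_cnj: "MB_kernel \<rho> k (cnj s) = cnj (MB_kernel \<rho> k s)"
  by (simp add: MB_kernel_def cnj_Gamma cnj_rGamma)

lemma MB_kernel_holomorphic: "MB_kernel \<rho> k holomorphic_on - range (\<lambda>k. of_real (-1/2 - real k))"
  unfolding MB_kernel_def
proof (intro holomorphic_intros)
  fix s :: complex assume s: "s \<in> - range (\<lambda>k. of_real (-1/2 - real k))"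
  show "1/2 + s \<notin> \<int>\<^sub>\<le>\<^sub>0"
  proof
    assume "1/2 + s \<in> \<int>\<^sub>\<le>\<^sub>0"
    then obtain n where "1/2 + s = - of_nat n" by (elim nonpos_Ints_cases')
    hence "s = of_real (-1/2 - real n)" by (simp add: algebra_simps eq_neg_iff_add_eq_0)
    thus False using s by blast
  qed
qed

text \<open>Each numerator Gamma is paired with one reciprocal Gamma at height \<open>- t\<close>,
  whose modulus is that at height \<open>t\<close>. The pair containing \<open>\<rho>\<close>
  contributes the exponent \<open>2 * \<sigma> - 1/2 - \<rho>\<close>, each of the other
  \<open>k\<close> pairs \<open>2 * \<sigma> + 1/2\<close>.\<close>

lemma norm_MB_kernel_bound:
  fixes \<rho> M :: real
  obtains C where "C > 0"
    "\<And>\<sigma> t. \<lbrakk>\<bar>\<sigma>\<bar> \<le> M; \<bar>t\<bar> \<ge> 1\<rbrakk> \<Longrightarrow>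
       norm (MB_kernel \<rho> k (Complex \<sigma> t)) \<le> C * \<bar>t\<bar> powr ((2 * real k + 2) * \<sigma> + (real k - 1) / 2 - \<rho>)"
proof -
  define M' where "M' = \<bar>M\<bar> + \<bar>\<rho>\<bar> + 1"
  obtain C where C: "C > 0"
    "\<And>a b t. \<lbrakk>\<bar>a\<bar> \<le> M'; \<bar>b\<bar> \<le> M'; \<bar>t\<bar> \<ge> 1\<rbrakk> \<Longrightarrow>
       norm (Gamma (Complex a t)) \<le> C * \<bar>t\<bar> powr (a - b) * norm (Gamma (Complex b t))"
    using norm_Gamma_vertical_ratio[of M'] by blast
  have "norm (MB_kernel \<rho> k (Complex \<sigma> t)) \<le> C ^ (k + 1) * \<bar>t\<bar> powr ((2 * real k + 2) * \<sigma> + (real k - 1) / 2 - \<rho>)"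
    if \<sigma>: "\<bar>\<sigma>\<bar> \<le> M" and t: "\<bar>t\<bar> \<ge> 1" for \<sigma> t
  proof -
    define G where "G = norm (Gamma (Complex (1/2 + \<sigma>) t))"
    have ratio: "G * norm (rGamma (Complex b (- t))) \<le> C * \<bar>t\<bar> powr (1/2 + \<sigma> - b)" if "\<bar>b\<bar> \<le> M'" for b
    proof -
      have "Complex b t \<notin> \<int>\<^sub>\<le>\<^sub>0"
        using t by (auto elim!: nonpos_Ints_cases simp: complex_eq_iff)
      hence "Gamma (Complex b t) \<noteq> 0" by (simp add: Gamma_eq_zero_iff)
      moreover have "rGamma (Complex b (- t)) = cnj (rGamma (Complex b t))"
        by (simp add: cnj_rGamma flip: complex_cnj)
      ultimately have "norm (rGamma (Complex b (- t))) * norm (Gamma (Complex b t)) = 1"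
        by (simp add: rGamma_inverse_Gamma norm_inverse)
      moreover have "G \<le> C * \<bar>t\<bar> powr (1/2 + \<sigma> - b) * norm (Gamma (Complex b t))"
        unfolding G_def using \<sigma> t that by (intro C(2)) (auto simp: M'_def)
      hence "G * norm (rGamma (Complex b (- t))) \<le> C * \<bar>t\<bar> powr (1/2 + \<sigma> - b) * norm (Gamma (Complex b t)) * norm (rGamma (Complex b (- t)))"
        by (intro mult_right_mono) auto
      ultimately show ?thesis by (simp add: mult.assoc mult.commute[of "norm (Gamma (Complex b t))"])
    qed
    have "1/2 + Complex \<sigma> t = Complex (1/2 + \<sigma>) t" "of_real \<rho> + 1 - Complex \<sigma> t = Complex (\<rho> + 1 - \<sigma>) (- t)"
      "- Complex \<sigma> t = Complex (- \<sigma>) (- t)"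
      by (simp_all add: complex_eq_iff)
    hence "norm (MB_kernel \<rho> k (Complex \<sigma> t)) =
        (G * norm (rGamma (Complex (\<rho> + 1 - \<sigma>) (- t)))) * (G * norm (rGamma (Complex (- \<sigma>) (- t)))) ^ k"
      by (simp add: MB_kernel_def norm_mult norm_power G_def power_mult_distrib)
    also have "\<dots> \<le> (C * \<bar>t\<bar> powr (1/2 + \<sigma> - (\<rho> + 1 - \<sigma>))) * (C * \<bar>t\<bar> powr (1/2 + \<sigma> - (- \<sigma>))) ^ k"
      using \<sigma> C(1) by (intro mult_mono power_mono ratio) (auto simp: M'_def G_def)
    also have "\<dots> = C ^ (k + 1) * (\<bar>t\<bar> powr (2 * \<sigma> - 1/2 - \<rho>) * \<bar>t\<bar> powr (real k * (2 * \<sigma> + 1/2)))"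
      using t by (simp add: power_mult_distrib powr_realpow [symmetric] powr_powr algebra_simps)
    also have "\<bar>t\<bar> powr (2 * \<sigma> - 1/2 - \<rho>) * \<bar>t\<bar> powr (real k * (2 * \<sigma> + 1/2))
        = \<bar>t\<bar> powr ((2 * real k + 2) * \<sigma> + (real k - 1) / 2 - \<rho>)"
      unfolding powr_add [symmetric] by (rule arg_cong) (simp add: algebra_simps diff_divide_distrib)
    finally show ?thesis .
  qed
  thus ?thesis using that[of "C ^ (k + 1)"] C(1) by auto
qed

section \<open>Independence of the contour\<close>

lemma Cauchy_at_top_convergent:
  fixes p :: "real \<Rightarrow> 'a :: banach"
  assumes "\<And>e. e > 0 \<Longrightarrow> \<exists>N. \<forall>s\<ge>N. \<forall>t\<ge>N. norm (p s - p t) < e"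
  shows "\<exists>l. (p \<longlongrightarrow> l) at_top"
proof -
  have "Cauchy (\<lambda>n. p (real n))"
  proof (rule CauchyI)
    fix e :: real assume "e > 0"
    then obtain N where N: "\<And>s t. \<lbrakk>s \<ge> N; t \<ge> N\<rbrakk> \<Longrightarrow> norm (p s - p t) < e"
      using assms by blast
    show "\<exists>M. \<forall>m\<ge>M. \<forall>n\<ge>M. norm (p (real m) - p (real n)) < e"
      by (rule exI[of _ "nat \<lceil>N\<rceil>"]) (auto intro!: N; linarith)
  qed
  then obtain l where l: "(\<lambda>n. p (real n)) \<longlonglongrightarrow> l"
    using Cauchy_convergent convergent_def by blast
  have "(p \<longlongrightarrow> l) at_top"
  proof (rule tendstoI)
    fix e :: real assume e: "e > 0"
    then obtain N where N: "\<And>s t. \<lbrakk>s \<ge> N; t \<ge> N\<rbrakk> \<Longrightarrow> norm (p s - p t) < e / 2"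
      using assms[of "e / 2"] by auto
    have "\<forall>\<^sub>F n in sequentially. dist (p (real n)) l < e / 2 \<and> n \<ge> nat \<lceil>N\<rceil>"
      using tendstoD[OF l, of "e / 2"] e eventually_ge_at_top[of "nat \<lceil>N\<rceil>"] by (simp add: eventually_conj)
    then obtain n where n: "dist (p (real n)) l < e / 2" "n \<ge> nat \<lceil>N\<rceil>"
      by (auto simp: eventually_at_top_linorder)
    show "\<forall>\<^sub>F t in at_top. dist (p t) l < e"
      using eventually_ge_at_top[of N]
    proof eventually_elim
      case (elim t)
      have "dist (p t) (p (real n)) < e / 2"
        using N[of t "real n"] elim n(2) by (simp add: dist_norm)
      thus ?case using n(1) dist_triangle[of "p t" l "p (real n)"] by linarith
    qed
  qed
  thus ?thesis by blast
qed

text \<open>The ends of an interval containing a large ball can be moved independently. Closeness of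
  all these integrals to \<open>I\<close> is therefore a Cauchy condition for each end separately,
  not just for the symmetric difference.\<close>

lemma has_integral_UNIV_limits:
  fixes f p m :: "real \<Rightarrow> complex"
  assumes f: "(f has_integral I) UNIV"
    and pm: "\<And>a b. \<lbrakk>a \<le> - T; b \<ge> T\<rbrakk> \<Longrightarrow> (f has_integral (p b - m a)) {a..b}"
  obtains l1 l2 where "(p \<longlongrightarrow> l1) at_top" "((\<lambda>t. m (- t)) \<longlongrightarrow> l2) at_top" "I = l1 - l2"
proof -
  have close: "\<exists>N. \<forall>s\<ge>N. \<forall>t\<ge>N. norm (p s - m (- t) - I) < e" if e: "e > 0" for e
  proof -
    obtain B where B: "B > 0" "\<And>a b. ball 0 B \<subseteq> cbox a b \<Longrightarrow> norm (integral (cbox a b) f - I) < e"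
      using f e unfolding has_integral_alt'[of f I UNIV] by auto
    have "norm (p s - m (- t) - I) < e" if "s \<ge> max B T" "t \<ge> max B T" for s t
    proof -
      have "integral {- t..s} f = p s - m (- t)"
        using pm[of "- t" s] that by (intro integral_unique) auto
      moreover have "ball 0 B \<subseteq> cbox (- t) s" using that by (auto simp: dist_real_def)
      ultimately show ?thesis using B(2)[of "- t" s] by simp
    qed
    thus ?thesis by blast
  qed
  have half: "\<exists>N. \<forall>s\<ge>N. \<forall>t\<ge>N. norm (p s - m (- t) - I) < e / 2" if "e > 0" for e
    using close[of "e / 2"] that by simp
  have "\<exists>l. (p \<longlongrightarrow> l) at_top"
  proof (rule Cauchy_at_top_convergent)
    fix e :: real assume "e > 0"
    then obtain N where N: "\<And>s t. \<lbrakk>s \<ge> N; t \<ge> N\<rbrakk> \<Longrightarrow> norm (p s - m (- t) - I) < e / 2" using half by blast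
    have "norm (p s - p t) < e" if "s \<ge> N" "t \<ge> N" for s t
    proof -
      have "norm ((p s - m (- N) - I) - (p t - m (- N) - I)) < e / 2 + e / 2"
        by (rule order.strict_trans1[OF norm_triangle_ineq4 add_strict_mono]) (use N that in auto)
      thus ?thesis by simp
    qed
    thus "\<exists>N. \<forall>s\<ge>N. \<forall>t\<ge>N. norm (p s - p t) < e" by blast
  qed
  then obtain l1 where l1: "(p \<longlongrightarrow> l1) at_top" by blast
  have "\<exists>l. ((\<lambda>t. m (- t)) \<longlongrightarrow> l) at_top"
  proof (rule Cauchy_at_top_convergent)
    fix e :: real assume "e > 0"
    then obtain N where N: "\<And>s t. \<lbrakk>s \<ge> N; t \<ge> N\<rbrakk> \<Longrightarrow> norm (p s - m (- t) - I) < e / 2" using half by blast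
    have "norm (m (- s) - m (- t)) < e" if "s \<ge> N" "t \<ge> N" for s t
    proof -
      have "norm ((p N - m (- t) - I) - (p N - m (- s) - I)) < e / 2 + e / 2"
        by (rule order.strict_trans1[OF norm_triangle_ineq4 add_strict_mono]) (use N that in auto)
      thus ?thesis by (simp add: norm_minus_commute)
    qed
    thus "\<exists>N. \<forall>s\<ge>N. \<forall>t\<ge>N. norm (m (- s) - m (- t)) < e" by blast
  qed
  then obtain l2 where l2: "((\<lambda>t. m (- t)) \<longlongrightarrow> l2) at_top" by blast
  have "((\<lambda>t. p t - m (- t)) \<longlongrightarrow> I) at_top"
  proof (rule tendstoI)
    fix e :: real assume "e > 0"
    then obtain N where N: "\<And>s t. \<lbrakk>s \<ge> N; t \<ge> N\<rbrakk> \<Longrightarrow> norm (p s - m (- t) - I) < e" using close by blast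
    show "\<forall>\<^sub>F t in at_top. dist (p t - m (- t)) I < e"
      using eventually_ge_at_top[of N] by eventually_elim (use N in \<open>simp add: dist_norm\<close>)
  qed
  moreover have "((\<lambda>t. p t - m (- t)) \<longlongrightarrow> l1 - l2) at_top" by (intro tendsto_intros l1 l2)
  ultimately have "I = l1 - l2" using tendsto_unique trivial_limit_at_top_linorder by blast
  with l1 l2 show ?thesis using that by blast
qed

lemma integrable_one_plus_abs_powr:
  fixes e :: real
  assumes "e < -1"
  shows "integrable lborel (\<lambda>t. (1 + \<bar>t\<bar>) powr e)"
proof -
  define g where "g = (\<lambda>t. indicator {0..} t * (1 + t) powr e)"
  have "integrable lborel g"
  proof (rule integrableI_nonneg)
    show "g \<in> borel_measurable lborel" unfolding g_def by measurable
    show "AE t in lborel. 0 \<le> g t" by (simp add: g_def)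
    have "(\<integral>\<^sup>+ t. ennreal (g t) \<partial>lborel) = (\<integral>\<^sup>+ t. ennreal ((1 + t) powr e) * indicator {0..} t \<partial>lborel)"
      by (intro nn_integral_cong) (auto simp: g_def indicator_def)
    also have "\<dots> = ennreal (0 - (1 + 0) powr (e + 1) / (e + 1))"
    proof (rule nn_integral_FTC_atLeast)
      show "(\<lambda>t. (1 + t) powr e) \<in> borel_measurable borel" by measurable
      fix t :: real assume t: "0 \<le> t"
      show "((\<lambda>t. (1 + t) powr (e + 1) / (e + 1)) has_real_derivative (1 + t) powr e) (at t)"
      proof -
        have "((\<lambda>t. 1 + t) has_real_derivative 1) (at t)" by (auto intro!: derivative_eq_intros)
        from DERIV_cdivide[OF DERIV_fun_powr[OF this, of "e + 1"], of "e + 1"] show ?thesis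
          using t assms by simp
      qed
      show "0 \<le> (1 + t) powr e" by simp
    next
      have "filterlim (\<lambda>t::real. 1 + t) at_top at_top"
        by (intro filterlim_tendsto_add_at_top[OF tendsto_const] filterlim_ident)
      hence "((\<lambda>t. (1 + t) powr (e + 1) / (e + 1)) \<longlongrightarrow> 0 / (e + 1)) at_top"
        using assms by (intro tendsto_divide tendsto_neg_powr tendsto_const) auto
      thus "((\<lambda>t. (1 + t) powr (e + 1) / (e + 1)) \<longlongrightarrow> 0) at_top" by simp
    qed
    finally show "(\<integral>\<^sup>+ t. ennreal (g t) \<partial>lborel) < \<infinity>" by simp
  qed
  hence "integrable lborel (\<lambda>t. g t + g (0 + (-1) * t))"
    by (intro Bochner_Integration.integrable_add lborel_integrable_real_affine) auto
  thus ?thesis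
    by (rule Bochner_Integration.integrable_bound) (auto simp: g_def indicator_def)
qed

text \<open>Compactness covers \<open>\<bar>t\<bar> \<le> 1\<close>. Beyond it
  \<open>1 + \<bar>t\<bar> \<le> 2 * \<bar>t\<bar>\<close>, and as \<open>e\<close> is not positive
  the change of base costs only \<open>2 powr (- e)\<close>.\<close>

lemma norm_MB_kernel_line_bound:
  fixes \<rho> \<sigma> :: real and k :: nat
  defines "e \<equiv> (2 * real k + 2) * \<sigma> + (real k - 1) / 2 - \<rho>"
  assumes \<sigma>: "\<sigma> > -1/2" and e: "e \<le> 0"
  obtains C where "C > 0" "\<And>t. norm (MB_kernel \<rho> k (Complex \<sigma> t)) \<le> C * (1 + \<bar>t\<bar>) powr e"
proof -
  obtain C where C: "C > 0"
    "\<And>\<sigma>' t. \<lbrakk>\<bar>\<sigma>'\<bar> \<le> \<bar>\<sigma>\<bar>; \<bar>t\<bar> \<ge> 1\<rbrakk> \<Longrightarrow>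
       norm (MB_kernel \<rho> k (Complex \<sigma>' t)) \<le> C * \<bar>t\<bar> powr ((2 * real k + 2) * \<sigma>' + (real k - 1) / 2 - \<rho>)"
    using norm_MB_kernel_bound by blast
  have "continuous_on {-1..1} (\<lambda>t. MB_kernel \<rho> k (Complex \<sigma> t))"
    unfolding Complex_eq
    by (intro continuous_on_compose2[OF holomorphic_on_imp_continuous_on[OF MB_kernel_holomorphic]] continuous_intros)
       (use \<sigma> in \<open>auto simp: complex_eq_iff\<close>)
  hence "compact ((\<lambda>t. MB_kernel \<rho> k (Complex \<sigma> t)) ` {-1..1})" by (intro compact_continuous_image) auto
  then obtain K where K: "\<And>t. t \<in> {-1..1} \<Longrightarrow> norm (MB_kernel \<rho> k (Complex \<sigma> t)) \<le> K"
    using compact_imp_bounded bounded_iff by (metis imageI)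
  have "norm (MB_kernel \<rho> k (Complex \<sigma> t)) \<le> ((C + \<bar>K\<bar>) * 2 powr (- e)) * (1 + \<bar>t\<bar>) powr e" for t
  proof (cases "\<bar>t\<bar> \<ge> 1")
    case True
    have "norm (MB_kernel \<rho> k (Complex \<sigma> t)) \<le> C * \<bar>t\<bar> powr e"
      using C(2)[of \<sigma> t] True by (simp add: e_def)
    also have "\<bar>t\<bar> powr e \<le> ((1 + \<bar>t\<bar>) / 2) powr e"
      using True e by (intro powr_mono2') auto
    also have "((1 + \<bar>t\<bar>) / 2) powr e = 2 powr (- e) * (1 + \<bar>t\<bar>) powr e"
      by (simp add: powr_divide powr_minus field_simps)
    finally have "norm (MB_kernel \<rho> k (Complex \<sigma> t)) \<le> C * (2 powr (- e) * (1 + \<bar>t\<bar>) powr e)"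
      using C(1) by simp
    also have "\<dots> \<le> (C + \<bar>K\<bar>) * (2 powr (- e) * (1 + \<bar>t\<bar>) powr e)"
      by (intro mult_right_mono) auto
    finally show ?thesis by (simp add: mult.assoc)
  next
    case False
    have "2 powr e \<le> (1 + \<bar>t\<bar>) powr e" using False e by (intro powr_mono2') auto
    hence "1 \<le> 2 powr (- e) * (1 + \<bar>t\<bar>) powr e"
      by (simp add: powr_minus field_simps)
    hence "(C + \<bar>K\<bar>) * 1 \<le> (C + \<bar>K\<bar>) * (2 powr (- e) * (1 + \<bar>t\<bar>) powr e)"
      using C(1) by (intro mult_left_mono) auto
    moreover have "norm (MB_kernel \<rho> k (Complex \<sigma> t)) \<le> K" using False by (intro K) auto
    ultimately show ?thesis using C(1) by (simp add: mult.assoc)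
  qed
  moreover have "(C + \<bar>K\<bar>) * 2 powr (- e) > 0" using C(1) by simp
  ultimately show ?thesis using that by blast
qed

text \<open>Both ends of \<open>L\<close> are moved to the abscissa \<open>c0\<close>, where the
  integrand tends to 0. This expresses \<open>I\<close> through \<open>P\<close> and
  \<open>c0\<close> alone, with no trace of \<open>L\<close>.\<close>

lemma MB_contour_integral_eq_limit:
  fixes \<rho> y c0 :: real and k :: nat and F P :: "complex \<Rightarrow> complex"
  defines "F \<equiv> \<lambda>s. MB_kernel \<rho> k s * of_real y powr s"
  assumes y: "y > 0" and c0: "c0 > -1/2" "(2 * real k + 2) * c0 + (real k - 1) / 2 - \<rho> < 0"
    and P: "\<And>s. \<not> (Im s = 0 \<and> Re s \<le> -1/2) \<Longrightarrow> (P has_field_derivative F s) (at s)"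
    and L: "vertical_contour L" and left: "range (\<lambda>k. of_real (-1/2 - real k)) \<subseteq> left_of_contour L"
    and I: "((\<lambda>t. F (L t) * vector_derivative L (at t)) has_integral I) UNIV"
  shows "((\<lambda>t. P (Complex c0 t) - P (Complex c0 (- t))) \<longlongrightarrow> I) at_top"
proof -
  define \<Lambda> where "\<Lambda> = (\<lambda>s::complex. ln_MB_kernel \<rho> k s + s * of_real (ln y))"
  define \<Lambda>' where "\<Lambda>' = (\<lambda>s::complex. of_nat (k + 1) * Digamma (1/2 + s) + Digamma (of_real \<rho> + 1 - s) + of_nat k * Digamma (- s)
      + of_real (ln y))"
  have F_exp: "F s = exp (\<Lambda> s)" if "Im s \<noteq> 0" for s
    using y that by (simp add: F_def \<Lambda>_def MB_kernel_eq_exp powr_def exp_add Ln_of_real)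
  have d\<Lambda>: "(\<Lambda> has_field_derivative \<Lambda>' s) (at s)" if "Im s > 0" for s
  proof -
    have "((\<lambda>s. s * of_real (ln y)) has_field_derivative of_real (ln y)) (at s)"
      by (auto intro!: derivative_eq_intros)
    from DERIV_add[OF has_field_derivative_ln_MB_kernel this, of \<rho> k] that
    show ?thesis unfolding \<Lambda>_def \<Lambda>'_def by auto
  qed
  have hol: "F holomorphic_on - range (\<lambda>k. of_real (-1/2 - real k))"
    unfolding F_def using y by (intro holomorphic_on_mult MB_kernel_holomorphic holomorphic_intros) auto
  obtain c d T where T: "T > 0" "\<And>t. t \<le> -T \<Longrightarrow> L t = Complex c t" "\<And>t. t \<ge> T \<Longrightarrow> L t = Complex d t"
    "\<And>a b. \<lbrakk>a \<le> -T; b \<ge> T\<rbrakk> \<Longrightarrow>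
       ((\<lambda>t. F (L t) * vector_derivative L (at t)) has_integral (P (L b) - P (L a))) {a..b}"
    by (rule integral_along_vertical_contour[OF L left hol P]) auto
  obtain l1 l2 where l: "((\<lambda>t. P (L t)) \<longlongrightarrow> l1) at_top" "((\<lambda>t. P (L (- t))) \<longlongrightarrow> l2) at_top" "I = l1 - l2"
    using has_integral_UNIV_limits[OF I T(4)] by blast
  have l1: "((\<lambda>t. P (Complex d t)) \<longlongrightarrow> l1) at_top"
    by (rule Lim_transform_eventually[OF l(1) eventually_at_top_linorderI[of T]]) (use T(3) in auto)
  have l2: "((\<lambda>t. P (Complex c (- t))) \<longlongrightarrow> l2) at_top"
    by (rule Lim_transform_eventually[OF l(2) eventually_at_top_linorderI[of T]]) (use T(2) in auto)
  define M where "M = \<bar>c\<bar> + \<bar>d\<bar> + \<bar>c0\<bar>"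
  have M: "\<bar>c\<bar> \<le> M" "\<bar>d\<bar> \<le> M" "\<bar>c0\<bar> \<le> M" by (auto simp: M_def)
  obtain C where C:
    "\<And>s. \<lbrakk>\<bar>Re s\<bar> \<le> M; \<bar>Im s\<bar> \<ge> 1\<rbrakk> \<Longrightarrow>
       norm (of_nat (k + 1) * Digamma (1/2 + s) + Digamma (of_real \<rho> + 1 - s) + of_nat k * Digamma (- s)
             - of_real ((2 * real k + 2) * ln \<bar>Im s\<bar>)) \<le> C"
    using ln_MB_kernel_derivative_bound[of M k \<rho>] by blast
  have bnd: "norm (\<Lambda>' s - of_real ((2 * real k + 2) * ln (Im s))) \<le> C + \<bar>ln y\<bar>" if s: "\<bar>Re s\<bar> \<le> M" "Im s \<ge> 1" for s
  proof -
    have "norm ((of_nat (k + 1) * Digamma (1/2 + s) + Digamma (of_real \<rho> + 1 - s) + of_nat k * Digamma (- s)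
             - of_real ((2 * real k + 2) * ln \<bar>Im s\<bar>)) + of_real (ln y)) \<le> C + norm (complex_of_real (ln y))"
      by (rule norm_triangle_mono[OF C order.refl]) (use s in auto)
    thus ?thesis using s by (simp add: \<Lambda>'_def algebra_simps)
  qed
  obtain K where K: "K > 0" "\<And>t. norm (MB_kernel \<rho> k (Complex c0 t)) \<le> K * (1 + \<bar>t\<bar>) powr ((2 * real k + 2) * c0 + (real k - 1) / 2 - \<rho>)"
    using norm_MB_kernel_line_bound[of c0 k \<rho>] c0 by auto
  have decay: "((\<lambda>t. exp (\<Lambda> (Complex c0 t))) \<longlongrightarrow> 0) at_top"
  proof (rule Lim_null_comparison)
    show "\<forall>\<^sub>F t in at_top. norm (exp (\<Lambda> (Complex c0 t))) \<le> K * y powr c0 * (1 + t) powr ((2 * real k + 2) * c0 + (real k - 1) / 2 - \<rho>)"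
      using eventually_gt_at_top[of 0]
    proof eventually_elim
      case (elim t)
      have "norm (exp (\<Lambda> (Complex c0 t))) = norm (MB_kernel \<rho> k (Complex c0 t)) * y powr c0"
        using elim y by (simp add: F_exp [symmetric] F_def norm_mult norm_powr_real_powr del: norm_exp_eq_Re)
      also have "\<dots> \<le> (K * (1 + \<bar>t\<bar>) powr ((2 * real k + 2) * c0 + (real k - 1) / 2 - \<rho>)) * y powr c0"
        by (intro mult_right_mono K) auto
      finally show ?case using elim by (simp add: mult_ac)
    qed
    have "filterlim (\<lambda>t::real. 1 + t) at_top at_top"
      by (intro filterlim_tendsto_add_at_top[OF tendsto_const] filterlim_ident)
    from tendsto_mult_right_zero[OF tendsto_neg_powr[OF c0(2) this]]
    show "((\<lambda>t. K * y powr c0 * (1 + t) powr ((2 * real k + 2) * c0 + (real k - 1) / 2 - \<rho>)) \<longlongrightarrow> 0) at_top" .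
  qed
  have P1: "(P has_field_derivative exp (\<Lambda> s)) (at s)" if "Im s > 0" for s
    using P[of s] that F_exp[of s] by auto
  \<comment> \<open>Since \<open>F (cnj s) = cnj (F s)\<close>, the reflected \<open>P\<close> is a
    primitive of the same integrand in the upper half-plane, and the lower end falls under the same
    transfer lemma.\<close>
  have P2: "(cnj \<circ> P \<circ> cnj has_field_derivative exp (\<Lambda> s)) (at s)" if "Im s > 0" for s
  proof -
    have "(P has_field_derivative F (cnj s)) (at (cnj s))" using P[of "cnj s"] that by auto
    hence "(cnj \<circ> P \<circ> cnj has_field_derivative cnj (F (cnj s))) (at s)"
      by (rule has_field_derivative_cnj_cnj)
    also have "cnj (F (cnj s)) = F s"
      using y by (simp add: F_def MB_kernel_cnj cnj_powr)
    finally show ?thesis using F_exp[of s] that by (simp add: o_def)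
  qed
  have \<kappa>: "2 * real k + 2 > 0" by simp
  have r1: "((\<lambda>t. P (Complex c0 t)) \<longlongrightarrow> l1) at_top"
    by (rule primitive_limit_transfer[OF P1 d\<Lambda> \<kappa> bnd M(3) M(2) l1 decay])
  have l2': "((\<lambda>t. (cnj \<circ> P \<circ> cnj) (Complex c t)) \<longlongrightarrow> cnj l2) at_top"
    using tendsto_cnj[OF l2] by (simp add: o_def complex_cnj)
  have "((\<lambda>t. (cnj \<circ> P \<circ> cnj) (Complex c0 t)) \<longlongrightarrow> cnj l2) at_top"
    by (rule primitive_limit_transfer[OF P2 d\<Lambda> \<kappa> bnd M(3) M(1) l2' decay])
  from tendsto_cnj[OF this] have r2: "((\<lambda>t. P (Complex c0 (- t))) \<longlongrightarrow> l2) at_top"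
    by (simp add: o_def complex_cnj)
  show ?thesis unfolding l(3) by (intro tendsto_diff r1 r2)
qed

text \<open>\<open>P\<close> is fixed before the contours are considered, so both integrals are the
  same limit along \<open>c0\<close>.\<close>

lemma MB_contour_integral_unique:
  fixes \<rho> y c0 :: real and k :: nat
  defines "F \<equiv> \<lambda>s. MB_kernel \<rho> k s * of_real y powr s"
  assumes y: "y > 0" and c0: "c0 > -1/2" "(2 * real k + 2) * c0 + (real k - 1) / 2 - \<rho> < 0"
    and L1: "vertical_contour L1" "range (\<lambda>k. of_real (-1/2 - real k)) \<subseteq> left_of_contour L1"
      "((\<lambda>t. F (L1 t) * vector_derivative L1 (at t)) has_integral I1) UNIV"
    and L2: "vertical_contour L2" "range (\<lambda>k. of_real (-1/2 - real k)) \<subseteq> left_of_contour L2"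
      "((\<lambda>t. F (L2 t) * vector_derivative L2 (at t)) has_integral I2) UNIV"
  shows "I1 = I2"
proof -
  have "- {s. Im s = 0 \<and> Re s \<le> -1/2} \<subseteq> - range (\<lambda>k. complex_of_real (-1/2 - real k))"
    by auto
  hence "F holomorphic_on - {s. Im s = 0 \<and> Re s \<le> -1/2}"
    unfolding F_def using y
    by (intro holomorphic_on_mult holomorphic_on_subset[OF MB_kernel_holomorphic] holomorphic_intros) auto
  then obtain P where P: "\<And>s. \<not> (Im s = 0 \<and> Re s \<le> -1/2) \<Longrightarrow> (P has_field_derivative F s) (at s)"
    using slit_plane_primitive by blast
  have "((\<lambda>t. P (Complex c0 t) - P (Complex c0 (- t))) \<longlongrightarrow> I) at_top"
    if "vertical_contour L" "range (\<lambda>k. of_real (-1/2 - real k)) \<subseteq> left_of_contour L"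
      "((\<lambda>t. F (L t) * vector_derivative L (at t)) has_integral I) UNIV" for L I
    using MB_contour_integral_eq_limit[OF y c0 _ that[unfolded F_def], of P] P by (simp add: F_def)
  from tendsto_unique[OF trivial_limit_at_top_linorder this[OF L1] this[OF L2]] show ?thesis .
qed

lemma vertical_line_vertical_contour: "vertical_contour (Complex c)"
proof -
  have "Complex c C1_differentiable_on {a..b}" for a b
    unfolding C1_differentiable_on_def
    by (rule exI[of _ "\<lambda>_. \<i>"]) (auto simp: Complex_eq [abs_def] intro!: derivative_eq_intros)
  hence "Complex c piecewise_C1_differentiable_on {a..b}" for a b
    by (rule C1_differentiable_imp_piecewise)
  thus ?thesis by (auto simp: vertical_contour_def inj_def)
qed

lemma vertical_line_left: "Re z < c \<Longrightarrow> z \<in> left_of_contour (Complex c)"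
  unfolding left_of_contour_def by (auto intro!: exI[of _ z])

lemma vector_derivative_vertical_line: "vector_derivative (Complex c) (at t) = \<i>"
  by (rule vector_derivative_at) (auto simp: Complex_eq [abs_def] intro!: derivative_eq_intros)

text \<open>The weight leaves room for the growth in \<open>t\<close> of the truncated cosine
  integrals, which is the case \<open>a = 2 * \<sigma> + 1\<close>; with \<open>a = 0\<close> it is
  plain integrability.\<close>

lemma MB_kernel_line_integrable:
  fixes \<rho> \<sigma> :: real and k :: nat
  defines "e \<equiv> (2 * real k + 2) * \<sigma> + (real k - 1) / 2 - \<rho>"
  assumes \<sigma>: "\<sigma> > -1/2" and a: "a \<ge> 0" "e + a < -1"
  shows "integrable lborel (\<lambda>t. (1 + \<bar>t\<bar>) powr a * norm (MB_kernel \<rho> k (Complex \<sigma> t)))"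
    and MB_kernel_line_measurable: "(\<lambda>t. MB_kernel \<rho> k (Complex \<sigma> t)) \<in> borel_measurable borel"
proof -
  have "continuous_on UNIV (\<lambda>t. MB_kernel \<rho> k (Complex \<sigma> t))"
    unfolding Complex_eq
    by (intro continuous_on_compose2[OF holomorphic_on_imp_continuous_on[OF MB_kernel_holomorphic]] continuous_intros)
       (use \<sigma> in \<open>auto simp: complex_eq_iff\<close>)
  thus meas [measurable]: "(\<lambda>t. MB_kernel \<rho> k (Complex \<sigma> t)) \<in> borel_measurable borel"
    by (rule borel_measurable_continuous_onI)
  obtain C where C: "C > 0" "\<And>t. norm (MB_kernel \<rho> k (Complex \<sigma> t)) \<le> C * (1 + \<bar>t\<bar>) powr e"
    using norm_MB_kernel_line_bound[of \<sigma> k \<rho>] \<sigma> a by (auto simp: e_def)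
  have "integrable lborel (\<lambda>t. C * (1 + \<bar>t\<bar>) powr (e + a))"
    using a by (intro integrable_mult_right integrable_one_plus_abs_powr)
  thus "integrable lborel (\<lambda>t. (1 + \<bar>t\<bar>) powr a * norm (MB_kernel \<rho> k (Complex \<sigma> t)))"
  proof (rule Bochner_Integration.integrable_bound)
    show "AE t in lborel. norm ((1 + \<bar>t\<bar>) powr a * norm (MB_kernel \<rho> k (Complex \<sigma> t))) \<le> norm (C * (1 + \<bar>t\<bar>) powr (e + a))"
    proof (rule AE_I2)
      fix t :: real
      have "(1 + \<bar>t\<bar>) powr a * norm (MB_kernel \<rho> k (Complex \<sigma> t)) \<le> (1 + \<bar>t\<bar>) powr a * (C * (1 + \<bar>t\<bar>) powr e)"
        by (intro mult_left_mono C) auto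
      also have "\<dots> = C * (1 + \<bar>t\<bar>) powr (e + a)" by (simp add: powr_add)
      finally show "norm ((1 + \<bar>t\<bar>) powr a * norm (MB_kernel \<rho> k (Complex \<sigma> t))) \<le> norm (C * (1 + \<bar>t\<bar>) powr (e + a))"
        using C(1) by simp
    qed
  qed measurable
qed

section \<open>The Mellin transform of the cosine\<close>

lemma set_integrable_powr_from_0:
  fixes a R :: real
  assumes "a > 0"
  shows "set_integrable lborel {0..R} (\<lambda>u. u powr (a - 1))"
proof (cases "R \<ge> 0")
  case True
  have "(\<lambda>u. u powr (a - 1)) absolutely_integrable_on {0..R}"
    using has_integral_powr_from_0[of "a - 1" R] assms True
    by (intro nonnegative_absolutely_integrable_1) (auto simp: integrable_on_def)
  thus ?thesis
    unfolding set_integrable_def by (subst (asm) integrable_completion) auto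
qed (simp add: set_integrable_def)

lemma norm_of_real_powr: "u \<ge> 0 \<Longrightarrow> norm (complex_of_real u powr z) = u powr Re z"
  by (simp add: norm_powr_real_powr)

lemma set_integrable_powr_mult:
  fixes h :: "real \<Rightarrow> complex"
  assumes w: "Re w > 0" and [measurable]: "h \<in> borel_measurable borel"
    and h: "\<And>u. u \<ge> 0 \<Longrightarrow> norm (h u) \<le> 1"
  shows "set_integrable lborel {0..R} (\<lambda>u. of_real u powr (w - 1) * h u)"
  unfolding set_integrable_def
proof (rule Bochner_Integration.integrable_bound)
  show "integrable lborel (\<lambda>u. indicat_real {0..R} u *\<^sub>R u powr (Re w - 1))"
    using set_integrable_powr_from_0[OF w, of R] by (simp add: set_integrable_def)
  show "AE u in lborel. norm (indicat_real {0..R} u *\<^sub>R (of_real u powr (w - 1) * h u))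
      \<le> norm (indicat_real {0..R} u *\<^sub>R u powr (Re w - 1))"
  proof (rule AE_I2)
    fix u :: real
    show "norm (indicat_real {0..R} u *\<^sub>R (of_real u powr (w - 1) * h u))
      \<le> norm (indicat_real {0..R} u *\<^sub>R u powr (Re w - 1))"
      using h[of u] by (auto simp: indicator_def norm_mult norm_of_real_powr intro!: mult_left_le)
  qed
qed measurable

lemma integrable_powr_mult:
  fixes h :: "real \<Rightarrow> complex"
  assumes "Re w > 0" "h \<in> borel_measurable borel" "\<And>u. u \<ge> 0 \<Longrightarrow> norm (h u) \<le> 1"
  shows "(\<lambda>u. of_real u powr (w - 1) * h u) integrable_on {0..R}"
  using set_borel_integral_eq_integral(1)[OF set_integrable_powr_mult[OF assms]] .

lemma norm_integral_powr_mult_le: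
  fixes h :: "real \<Rightarrow> complex"
  assumes w: "Re w > 0" and h: "h \<in> borel_measurable borel" "\<And>u. u \<ge> 0 \<Longrightarrow> norm (h u) \<le> 1" and R: "R \<ge> 0"
  shows "norm (integral {0..R} (\<lambda>u. of_real u powr (w - 1) * h u)) \<le> R powr Re w / Re w"
proof -
  have pow: "((\<lambda>u. u powr (Re w - 1)) has_integral (R powr (Re w - 1 + 1) / (Re w - 1 + 1))) {0..R}"
    using w R by (intro has_integral_powr_from_0) auto
  have "norm (integral {0..R} (\<lambda>u. of_real u powr (w - 1) * h u)) \<le> integral {0..R} (\<lambda>u. u powr (Re w - 1))"
    using integrable_powr_mult[OF w h] pow
    by (intro integral_norm_bound_integral)
       (auto simp: norm_mult norm_of_real_powr integrable_on_def intro!: mult_left_le h)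
  thus ?thesis using integral_unique[OF pow] by simp
qed

lemma norm_powr_le_exp_pi:
  fixes z w :: complex
  assumes "z \<noteq> 0"
  shows "norm (z powr w) \<le> norm z powr Re w * exp (pi * \<bar>Im w\<bar>)"
proof -
  have "- (Im w * Im (Ln z)) \<le> \<bar>Im w\<bar> * \<bar>Im (Ln z)\<bar>"
    by (simp add: abs_le_iff flip: abs_mult)
  also have "\<dots> \<le> \<bar>Im w\<bar> * pi"
    using mpi_less_Im_Ln[OF assms] Im_Ln_le_pi[OF assms] by (intro mult_left_mono) auto
  finally have "exp (Re w * ln (norm z) + - (Im w * Im (Ln z))) \<le> exp (Re w * ln (norm z) + pi * \<bar>Im w\<bar>)"
    by (simp add: mult.commute)
  thus ?thesis
    using assms by (simp add: powr_def exp_add exp_diff)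
qed

lemma has_integral_atLeast_limit:
  fixes f :: "real \<Rightarrow> 'a :: banach"
  assumes "(f has_integral I) {0..}"
  shows "((\<lambda>R. integral {0..R} f) \<longlongrightarrow> I) at_top"
proof (rule tendstoI)
  fix e :: real assume "e > 0"
  then obtain B where B: "B > 0" "\<And>a b. ball 0 B \<subseteq> cbox a b \<Longrightarrow>
      norm (integral (cbox a b) (\<lambda>x. if x \<in> {0..} then f x else 0) - I) < e"
    using assms unfolding has_integral_alt'[of f I] by blast
  show "\<forall>\<^sub>F R in at_top. dist (integral {0..R} f) I < e"
    using eventually_ge_at_top[of B]
  proof eventually_elim
    case (elim R)
    have "ball 0 B \<subseteq> cbox (- R) R" using elim by (auto simp: dist_real_def)
    moreover have "integral (cbox (- R) R) (\<lambda>x. if x \<in> {0..} then f x else 0) = integral {0..R} f"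
    proof -
      have "max 0 (- R) = 0" using elim B(1) by auto
      thus ?thesis using integral_restrict_Int[of "{- R..R}" "{0..}" f] by simp
    qed
    ultimately show ?case using B(2)[of "- R" R] by (simp add: dist_norm)
  qed
qed

text \<open>Euler's integral is rotated from the positive real to the positive imaginary axis, with
  segments from \<open>R\<close> to \<open>\<i> * R\<close> in place of arcs. The increment of a
  primitive across such a segment is \<open>O(R powr a)\<close> for small \<open>R\<close> and
  \<open>O(R powr (a - 1))\<close> for large \<open>R\<close>; both vanish because
  \<open>0 < Re w < 1\<close>.\<close>

lemma Gamma_rotation_integral:
  fixes w :: complex
  assumes w: "0 < Re w" "Re w < 1"
  shows "((\<lambda>R. integral {0..R} (\<lambda>u. of_real u powr (w - 1) * exp (- (\<i> * of_real u)))) \<longlongrightarrow>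
    exp (- (\<i> * of_real pi * w / 2)) * Gamma w) at_top"
proof -
  define a where "a = Re w"
  \<comment> \<open>The segment from \<open>R\<close> to \<open>\<i> * R\<close> lies on the line
    \<open>Re z + Im z = R\<close>. This half-plane contains all such segments, is convex and avoids
    the branch cut.\<close>
  define H where "H = {z::complex. Re z + Im z > 0}"
  define f where "f = (\<lambda>z. z powr (w - 1) * exp (- z))"
  define K where "K = exp (pi * \<bar>Im w\<bar>)"
  define G1 where "G1 = (\<lambda>u::real. of_real u powr (w - 1) * exp (- complex_of_real u))"
  define G2 where "G2 = (\<lambda>u::real. of_real u powr (w - 1) * exp (- (\<i> * of_real u)))"
  have H_eq: "H = {z. inner (Complex 1 1) z > 0}" by (auto simp: H_def inner_complex_def)
  have H: "open H" "convex H" unfolding H_eq by (rule open_halfspace_gt convex_halfspace_gt)+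
  have Hn: "z \<notin> \<real>\<^sub>\<le>\<^sub>0" if "z \<in> H" for z
    using that by (auto simp: H_def complex_nonpos_Reals_iff)
  have "f holomorphic_on H" unfolding f_def by (intro holomorphic_intros) (use Hn in auto)
  then obtain Q where Q: "\<And>z. z \<in> H \<Longrightarrow> (Q has_field_derivative f z) (at z)"
    using holomorphic_convex_primitive'[OF H(2) H(1)] H(1) by (metis at_within_open)
  \<comment> \<open>On the segment the coordinates are nonnegative with sum \<open>R\<close>, so
    \<open>norm z \<ge> R / 2\<close>, and the exponent \<open>a - 1\<close> is negative.
    \<open>K\<close> bounds the effect of the argument of \<open>z\<close> on the complex
    power.\<close>
  have segm: "of_real R * (1 + of_real v * (\<i> - 1)) \<in> H \<and>
      norm (f (of_real R * (1 + of_real v * (\<i> - 1)))) \<le> (R / 2) powr (a - 1) * K * exp (- (R * (1 - v)))"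
    if R: "R > 0" and v: "v \<in> {0..1}" for R v
  proof -
    define z where "z = of_real R * (1 + of_real v * (\<i> - 1))"
    have z: "Re z = R * (1 - v)" "Im z = R * v" by (auto simp: z_def)
    have sum: "Re z + Im z = R" by (simp add: z algebra_simps)
    have zH: "z \<in> H" using R by (simp add: H_def sum)
    have "Re z \<ge> 0" "Im z \<ge> 0" using R v by (auto simp: z)
    hence "R / 2 \<le> max \<bar>Re z\<bar> \<bar>Im z\<bar>" using sum by (auto simp: max_def)
    also have "\<dots> \<le> norm z" using abs_Re_le_cmod[of z] abs_Im_le_cmod[of z] by simp
    finally have nz: "R / 2 \<le> norm z" .
    have "norm (z powr (w - 1)) \<le> norm z powr (a - 1) * K"
    proof -
      have "z \<noteq> 0" using zH by (auto simp: H_def)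
      from norm_powr_le_exp_pi[OF this, of "w - 1"] show ?thesis by (simp add: a_def K_def)
    qed
    also have "\<dots> \<le> (R / 2) powr (a - 1) * K"
      using nz R w by (intro mult_right_mono powr_mono2') (auto simp: K_def a_def)
    finally have "norm (z powr (w - 1)) * exp (- Re z) \<le> (R / 2) powr (a - 1) * K * exp (- Re z)"
      by (intro mult_right_mono) auto
    thus ?thesis using zH unfolding z_def [symmetric] f_def by (simp add: norm_mult z)
  qed
  have dQ: "((\<lambda>v. Q (of_real R * (1 + of_real v * (\<i> - 1)))) has_vector_derivative
      (of_real R * (\<i> - 1)) * f (of_real R * (1 + of_real v * (\<i> - 1)))) (at v)"
    if R: "R > 0" and v: "v \<in> {0..1}" for R v
  proof -
    have "((\<lambda>v. of_real R * (1 + of_real v * (\<i> - 1))) has_vector_derivative (of_real R * (\<i> - 1))) (at v)"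
      by (auto intro!: derivative_eq_intros)
    from field_vector_diff_chain_at[OF this Q] segm[OF R v] show ?thesis by (simp add: o_def)
  qed
  have n2: "norm (\<i> - 1 :: complex) \<le> 2" using norm_triangle_ineq4[of \<i> 1] by simp
  have der_bound: "norm ((of_real R * (\<i> - 1)) * f (of_real R * (1 + of_real v * (\<i> - 1))))
      \<le> 2 * (R / 2) powr (a - 1) * K * (R * exp (- (R * (1 - v))))"
    if R: "R > 0" and v: "v \<in> {0..1}" for R v
  proof -
    have "norm ((of_real R * (\<i> - 1)) * f (of_real R * (1 + of_real v * (\<i> - 1))))
        \<le> (R * 2) * ((R / 2) powr (a - 1) * K * exp (- (R * (1 - v))))"
      unfolding norm_mult using R n2 segm[OF R v] by (intro mult_mono) (auto simp: K_def)
    thus ?thesis by (simp add: mult_ac)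
  qed
  have Q_ends: "Q (\<i> * of_real R) = Q (of_real R * (1 + of_real 1 * (\<i> - 1)))" "Q (of_real R) = Q (of_real R * (1 + of_real 0 * (\<i> - 1)))" for R
    by (simp_all add: mult.commute)
  have Q_bound: "norm (Q (\<i> * of_real R) - Q (of_real R)) \<le> \<phi> 1 - \<phi> 0"
    if R: "R > 0" and d\<phi>: "\<And>v. v \<in> {0..1} \<Longrightarrow> (\<phi> has_vector_derivative \<phi>' v) (at v)"
      and le: "\<And>v. v \<in> {0..1} \<Longrightarrow> 2 * (R / 2) powr (a - 1) * K * (R * exp (- (R * (1 - v)))) \<le> \<phi>' v" for R \<phi> \<phi>'
  proof -
    have "norm (Q (of_real R * (1 + of_real 1 * (\<i> - 1))) - Q (of_real R * (1 + of_real 0 * (\<i> - 1)))) \<le> \<phi> 1 - \<phi> 0"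
    proof (rule differentiable_bound_general)
      show "continuous_on {0..1} (\<lambda>v. Q (of_real R * (1 + of_real v * (\<i> - 1))))"
        using dQ[OF R] has_vector_derivative_continuous by (blast intro: continuous_at_imp_continuous_on)
      show "continuous_on {0..1} \<phi>"
        using d\<phi> has_vector_derivative_continuous by (blast intro: continuous_at_imp_continuous_on)
      fix v :: real assume v: "0 < v" "v < 1"
      thus "((\<lambda>v. Q (of_real R * (1 + of_real v * (\<i> - 1)))) has_vector_derivative
          (of_real R * (\<i> - 1)) * f (of_real R * (1 + of_real v * (\<i> - 1)))) (at v)"
        by (intro dQ R) auto
      show "norm ((of_real R * (\<i> - 1)) * f (of_real R * (1 + of_real v * (\<i> - 1)))) \<le> \<phi>' v"
        using v by (intro order.trans[OF der_bound[OF R] le]) auto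
      show "(\<phi> has_vector_derivative \<phi>' v) (at v)" using v by (intro d\<phi>) auto
    qed auto
    thus ?thesis unfolding Q_ends[of R] .
  qed
  \<comment> \<open>As in Jordan's lemma, \<open>R * exp (- (R * (1 - v)))\<close> has integral at
    most 1 over \<open>{0..1}\<close>, which absorbs the length of the segment.\<close>
  have Q_large: "norm (Q (\<i> * of_real R) - Q (of_real R)) \<le> 2 * (R / 2) powr (a - 1) * K" if R: "R > 0" for R
  proof -
    define \<phi> where "\<phi> = (\<lambda>v. 2 * (R / 2) powr (a - 1) * K * exp (- (R * (1 - v))))"
    have "norm (Q (\<i> * of_real R) - Q (of_real R)) \<le> \<phi> 1 - \<phi> 0"
    proof (rule Q_bound[OF R])
      show "(\<phi> has_vector_derivative (2 * (R / 2) powr (a - 1) * K * (R * exp (- (R * (1 - v)))))) (at v)" for v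
        unfolding \<phi>_def has_real_derivative_iff_has_vector_derivative [symmetric]
        by (auto intro!: derivative_eq_intros)
    qed auto
    also have "\<dots> \<le> \<phi> 1" by (simp add: \<phi>_def K_def)
    finally show ?thesis by (simp add: \<phi>_def)
  qed
  \<comment> \<open>For small \<open>R\<close> the exponential gains nothing and is bounded by 1;
    here the length of the segment supplies the missing power of \<open>R\<close>.\<close>
  have Q_small: "norm (Q (\<i> * of_real R) - Q (of_real R)) \<le> 4 * K * (R / 2) powr a" if R: "R > 0" for R
  proof -
    define B where "B = 2 * (R / 2) powr (a - 1) * K * R"
    have "norm (Q (\<i> * of_real R) - Q (of_real R)) \<le> B * 1 - B * 0"
    proof (rule Q_bound[OF R])
      show "((\<lambda>v. B * v) has_vector_derivative B) (at v)" for v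
        unfolding has_real_derivative_iff_has_vector_derivative [symmetric]
        by (auto intro!: derivative_eq_intros)
      fix v :: real assume v: "v \<in> {0..1}"
      have "R * exp (- (R * (1 - v))) \<le> R * 1"
        using R v by (intro mult_left_mono) auto
      hence "2 * (R / 2) powr (a - 1) * K * (R * exp (- (R * (1 - v)))) \<le> 2 * (R / 2) powr (a - 1) * K * (R * 1)"
        by (rule mult_left_mono) (auto simp: K_def)
      thus "2 * (R / 2) powr (a - 1) * K * (R * exp (- (R * (1 - v)))) \<le> B" by (simp add: B_def)
    qed
    also have "B * 1 - B * 0 = 4 * K * (R / 2) powr a"
      using R by (simp add: B_def powr_diff field_simps)
    finally show ?thesis .
  qed
  \<comment> \<open>\<open>c\<close> is \<open>\<i> powr w\<close>, the product of
    \<open>\<i>\<close> from the differential and \<open>\<i> powr (w - 1)\<close> from the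
    integrand under the substitution \<open>z = \<i> * u\<close>.\<close>
  define c where "c = exp (\<i> * of_real pi * w / 2)"
  have meas [measurable]: "(\<lambda>u::real. exp (- complex_of_real u)) \<in> borel_measurable borel"
    "(\<lambda>u::real. exp (- (\<i> * complex_of_real u))) \<in> borel_measurable borel" by measurable
  have int: "G1 integrable_on {0..R}" "G2 integrable_on {0..R}" for R
    unfolding G1_def G2_def using w by (intro integrable_powr_mult meas; simp)+
  have rot: "c * integral {0..R} G2 - integral {0..R} G1 = Q (\<i> * of_real R) - Q (of_real R)" if R: "R > 0" for R
  proof -
    \<comment> \<open>\<open>0\<close> lies on the boundary of \<open>H\<close>, so the primitive is
      used on \<open>{\<epsilon>..R}\<close> first and \<open>\<epsilon>\<close> tends to 0
      afterwards.\<close>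
    have FTC: "c * integral {\<epsilon>..R} G2 - integral {\<epsilon>..R} G1
        = (Q (\<i> * of_real R) - Q (of_real R)) - (Q (\<i> * of_real \<epsilon>) - Q (of_real \<epsilon>))" if \<epsilon>: "0 < \<epsilon>" "\<epsilon> < R" for \<epsilon>
    proof -
      have "(G1 has_integral (Q (of_real R) - Q (of_real \<epsilon>))) {\<epsilon>..R}"
      proof (rule fundamental_theorem_of_calculus)
        fix u assume u: "u \<in> {\<epsilon>..R}"
        have "((\<lambda>u. of_real u) has_vector_derivative (1::complex)) (at u)" by (auto intro!: derivative_eq_intros)
        from field_vector_diff_chain_at[OF this Q[of "of_real u"]] u \<epsilon>
        have "((\<lambda>u. Q (of_real u)) has_vector_derivative G1 u) (at u)"
          by (simp add: o_def H_def f_def G1_def)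
        thus "((\<lambda>u. Q (of_real u)) has_vector_derivative G1 u) (at u within {\<epsilon>..R})"
          by (rule has_vector_derivative_at_within)
      qed (use \<epsilon> in auto)
      hence 1: "integral {\<epsilon>..R} G1 = Q (of_real R) - Q (of_real \<epsilon>)" by (rule integral_unique)
      have "((\<lambda>u. c * G2 u) has_integral (Q (\<i> * of_real R) - Q (\<i> * of_real \<epsilon>))) {\<epsilon>..R}"
      proof (rule fundamental_theorem_of_calculus)
        fix u assume u: "u \<in> {\<epsilon>..R}"
        have "((\<lambda>u. \<i> * of_real u) has_vector_derivative \<i>) (at u)" by (auto intro!: derivative_eq_intros)
        from field_vector_diff_chain_at[OF this Q[of "\<i> * of_real u"]] u \<epsilon>
        have "((\<lambda>u. Q (\<i> * of_real u)) has_vector_derivative (\<i> * f (\<i> * of_real u))) (at u)"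
          by (simp add: o_def H_def)
        also have "\<i> * f (\<i> * of_real u) = c * G2 u"
        proof -
          have "(of_real u * \<i>) powr (w - 1) = of_real u powr (w - 1) * \<i> powr (w - 1)"
            using u \<epsilon> by (intro powr_times_real_left) auto
          moreover have "\<i> * \<i> powr (w - 1) = c"
          proof -
            have "\<i> * \<i> powr (w - 1) = exp (\<i> * pi / 2) * exp ((w - 1) * (\<i> * pi / 2))"
              using exp_Ln[of \<i>] by (simp add: powr_def)
            also have "\<dots> = c" unfolding exp_add [symmetric] c_def by (simp add: algebra_simps diff_divide_distrib)
            finally show ?thesis .
          qed
          ultimately show ?thesis
            unfolding f_def G2_def by (simp add: mult_ac)
        qed
        finally show "((\<lambda>u. Q (\<i> * of_real u)) has_vector_derivative c * G2 u) (at u within {\<epsilon>..R})"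
          by (rule has_vector_derivative_at_within)
      qed (use \<epsilon> in auto)
      hence "integral {\<epsilon>..R} (\<lambda>u. c * G2 u) = Q (\<i> * of_real R) - Q (\<i> * of_real \<epsilon>)" by (rule integral_unique)
      hence 2: "c * integral {\<epsilon>..R} G2 = Q (\<i> * of_real R) - Q (\<i> * of_real \<epsilon>)" by simp
      show ?thesis unfolding 1 2 by simp
    qed
    have "((\<lambda>\<epsilon>. c * integral {\<epsilon>..R} G2 - integral {\<epsilon>..R} G1) \<longlongrightarrow> c * integral {0..R} G2 - integral {0..R} G1) (at_right 0)"
      using R by (intro tendsto_intros continuous_on_Icc_at_rightD[OF indefinite_integral_continuous_1'[OF int(1)]]
          continuous_on_Icc_at_rightD[OF indefinite_integral_continuous_1'[OF int(2)]])
    moreover have "((\<lambda>\<epsilon>. c * integral {\<epsilon>..R} G2 - integral {\<epsilon>..R} G1) \<longlongrightarrow> (Q (\<i> * of_real R) - Q (of_real R)) - 0) (at_right 0)"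
    proof (rule Lim_transform_eventually)
      show "\<forall>\<^sub>F \<epsilon> in at_right 0. (Q (\<i> * of_real R) - Q (of_real R)) - (Q (\<i> * of_real \<epsilon>) - Q (of_real \<epsilon>))
          = c * integral {\<epsilon>..R} G2 - integral {\<epsilon>..R} G1"
        using eventually_at_right_real[OF R] by eventually_elim (use FTC in auto)
      show "((\<lambda>\<epsilon>. (Q (\<i> * of_real R) - Q (of_real R)) - (Q (\<i> * of_real \<epsilon>) - Q (of_real \<epsilon>)))
          \<longlongrightarrow> (Q (\<i> * of_real R) - Q (of_real R)) - 0) (at_right 0)"
      proof (rule tendsto_diff[OF tendsto_const Lim_null_comparison])
        show "\<forall>\<^sub>F \<epsilon> in at_right 0. norm (Q (\<i> * of_real \<epsilon>) - Q (of_real \<epsilon>)) \<le> 4 * K * (\<epsilon> / 2) powr a"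
          using eventually_at_right_real[OF R] by eventually_elim (use Q_small in auto)
        have "((\<lambda>\<epsilon>::real. \<epsilon> / 2) \<longlongrightarrow> 0 / 2) (at_right 0)" by (intro tendsto_intros) auto
        hence "((\<lambda>\<epsilon>. (\<epsilon> / 2) powr a) \<longlongrightarrow> 0) (at_right 0)"
          by (intro tendsto_zero_powrI[where b = a]) (use w in \<open>auto simp: a_def eventually_at_filter\<close>)
        thus "((\<lambda>\<epsilon>. 4 * K * (\<epsilon> / 2) powr a) \<longlongrightarrow> 0) (at_right 0)" by (rule tendsto_mult_right_zero)
      qed
    qed
    ultimately show ?thesis using tendsto_unique[OF trivial_limit_at_right_real] by fastforce
  qed
  have Gam: "(G1 has_integral Gamma w) {0..}"
    using Gamma_integral_complex[OF w(1)] by (simp add: G1_def exp_minus divide_inverse exp_of_real)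
  have lim1: "((\<lambda>R. integral {0..R} G1) \<longlongrightarrow> Gamma w) at_top"
    by (rule has_integral_atLeast_limit[OF Gam])
  have lim0: "((\<lambda>R. Q (\<i> * of_real R) - Q (of_real R)) \<longlongrightarrow> 0) at_top"
  proof (rule Lim_null_comparison)
    show "\<forall>\<^sub>F R in at_top. norm (Q (\<i> * of_real R) - Q (of_real R)) \<le> 2 * K * (R / 2) powr (a - 1)"
      using eventually_gt_at_top[of 0] by eventually_elim (use Q_large in \<open>auto simp: mult_ac\<close>)
    have "filterlim (\<lambda>R::real. R * (1 / 2)) at_top at_top"
      by (intro filterlim_at_top_mult_tendsto_pos[OF tendsto_const] filterlim_ident) auto
    hence "filterlim (\<lambda>R::real. R / 2) at_top at_top" by simp
    thus "((\<lambda>R. 2 * K * (R / 2) powr (a - 1)) \<longlongrightarrow> 0) at_top"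
      by (intro tendsto_mult_right_zero tendsto_neg_powr) (use w in \<open>auto simp: a_def\<close>)
  qed
  have "((\<lambda>R. inverse c * ((Q (\<i> * of_real R) - Q (of_real R)) + integral {0..R} G1)) \<longlongrightarrow> inverse c * (0 + Gamma w)) at_top"
    by (intro tendsto_intros lim0 lim1)
  moreover have "\<forall>\<^sub>F R in at_top. inverse c * ((Q (\<i> * of_real R) - Q (of_real R)) + integral {0..R} G1) = integral {0..R} G2"
    using eventually_gt_at_top[of 0]
  proof eventually_elim
    case (elim R)
    show ?case unfolding rot[OF elim, symmetric] by (simp add: c_def)
  qed
  ultimately have "((\<lambda>R. integral {0..R} G2) \<longlongrightarrow> inverse c * (0 + Gamma w)) at_top"
    by (rule Lim_transform_eventually)
  thus ?thesis by (simp add: G2_def c_def exp_minus)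
qed

text \<open>Duplication splits \<open>Gamma (2 * s + 1)\<close> into
  \<open>Gamma (s + 1/2) * Gamma (s + 1)\<close>. The cosine is \<open>- sin (pi * s)\<close>, by
  reflection \<open>pi * rGamma (- s) * rGamma (s + 1)\<close>, and the factor at
  \<open>s + 1\<close> cancels.\<close>

lemma Gamma_cos_eq_Gamma_quotient:
  assumes s: "Re s > -1/2"
  shows "Gamma (2 * s + 1) * cos (of_real pi * (2 * s + 1) / 2)
    = of_real (sqrt pi) * 4 powr s * Gamma (1/2 + s) * rGamma (- s)"
proof -
  have G: "s + 1/2 \<notin> \<int>\<^sub>\<le>\<^sub>0" "s + 1 \<notin> \<int>\<^sub>\<le>\<^sub>0"
    using s by (auto elim!: nonpos_Ints_cases simp: complex_eq_iff)
  have "Gamma (s + 1/2) * Gamma (s + 1/2 + 1/2) =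
      exp ((1 - 2 * (s + 1/2)) * of_real (ln 2)) * of_real (sqrt pi) * Gamma (2 * (s + 1/2))"
    using G by (intro Gamma_legendre_duplication) (auto simp: add.assoc)
  moreover have "(1 - 2 * (s + 1/2)) * of_real (ln 2) = - (s * of_real (ln 4))"
  proof -
    have "ln 4 = 2 * ln (2::real)" using ln_mult[of 2 "2::real"] by simp
    thus ?thesis by (simp add: algebra_simps)
  qed
  moreover have "2 * (s + 1/2) = 2 * s + 1" "s + 1/2 + 1/2 = s + 1" by (simp_all add: algebra_simps)
  ultimately have "Gamma (s + 1/2) * Gamma (s + 1) = exp (- (s * of_real (ln 4))) * of_real (sqrt pi) * Gamma (2 * s + 1)"
    by (simp only:)
  moreover have "4 powr s = exp (s * of_real (ln 4))"
    using Ln_of_real[of 4] by (simp add: powr_def)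
  ultimately have dup: "Gamma (s + 1/2) * Gamma (s + 1) * 4 powr s = of_real (sqrt pi) * Gamma (2 * s + 1)"
    by (simp add: exp_minus)
  have "cos (of_real pi * (2 * s + 1) / 2) = cos (of_real pi * s + of_real pi / 2)"
    by (simp add: algebra_simps add_divide_distrib)
  also have "\<dots> = - sin (of_real pi * s)" by (simp add: cos_add cos_of_real_pi_half sin_of_real_pi_half)
  finally have cos: "cos (of_real pi * (2 * s + 1) / 2) = - sin (of_real pi * s)" .
  have "rGamma (- s) * rGamma (1 - (- s)) = sin (of_real pi * (- s)) / of_real pi"
    by (rule rGamma_reflection_complex)
  hence "of_real pi * rGamma (- s) * rGamma (s + 1) = - sin (of_real pi * s)" by (simp add: add.commute field_simps)
  hence refl: "of_real pi * rGamma (- s) = - sin (of_real pi * s) * Gamma (s + 1)"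
  proof -
    have "rGamma (s + 1) * Gamma (s + 1) = 1"
      using G(2) by (simp add: rGamma_inverse_Gamma Gamma_eq_zero_iff)
    hence "of_real pi * rGamma (- s) = (of_real pi * rGamma (- s) * rGamma (s + 1)) * Gamma (s + 1)"
      by (simp add: mult.assoc)
    thus ?thesis by (simp only: \<open>of_real pi * rGamma (- s) * rGamma (s + 1) = _\<close>)
  qed
  have "of_real (sqrt pi) * (Gamma (2 * s + 1) * cos (of_real pi * (2 * s + 1) / 2))
      = Gamma (s + 1/2) * 4 powr s * (- sin (of_real pi * s) * Gamma (s + 1))"
    unfolding cos mult.assoc [symmetric] dup [symmetric] by (simp add: mult_ac)
  also have "\<dots> = of_real pi * (Gamma (s + 1/2) * 4 powr s * rGamma (- s))"
    unfolding refl [symmetric] by (simp add: mult_ac)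
  also have "\<dots> = of_real (sqrt pi) * (of_real (sqrt pi) * (Gamma (s + 1/2) * 4 powr s * rGamma (- s)))"
  proof -
    have "complex_of_real (sqrt pi) * of_real (sqrt pi) = of_real pi" by (simp flip: of_real_mult)
    thus ?thesis by (simp add: mult.assoc [symmetric])
  qed
  finally have "of_real (sqrt pi) * (Gamma (2 * s + 1) * cos (of_real pi * (2 * s + 1) / 2))
      = of_real (sqrt pi) * (of_real (sqrt pi) * 4 powr s * Gamma (1/2 + s) * rGamma (- s))"
    by (simp add: mult_ac add.commute)
  thus ?thesis by simp
qed

text \<open>\<open>cos u\<close> is the mean of \<open>exp (- (\<i> * u))\<close> and its conjugate;
  using \<open>cnj w\<close> in the second term moves the conjugation outside the integral.\<close>

lemma cos_Mellin_limit:
  fixes w :: complex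
  assumes w: "0 < Re w" "Re w < 1"
  shows "((\<lambda>R. integral {0..R} (\<lambda>u. of_real u powr (w - 1) * of_real (cos u))) \<longlongrightarrow>
    Gamma w * cos (of_real pi * w / 2)) at_top"
proof -
  define E where "E = (\<lambda>w (u::real). of_real u powr (w - 1) * exp (- (\<i> * of_real u)))"
  have intE: "E v integrable_on {0..R}" if "Re v > 0" for v R
    unfolding E_def using that by (intro integrable_powr_mult) auto
  have eq: "of_real u powr (w - 1) * of_real (cos u) = (E w u + cnj (E (cnj w) u)) / 2" if "u \<in> {0..R}" for u R
  proof -
    have "cnj (E (cnj w) u) = of_real u powr (w - 1) * exp (\<i> * of_real u)"
      using that by (simp add: E_def cnj_powr exp_cnj)
    moreover have "complex_of_real (cos u) = (exp (\<i> * of_real u) + exp (- (\<i> * of_real u))) / 2"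
      by (simp add: cos_exp_eq flip: cos_of_real)
    ultimately show ?thesis by (simp add: E_def algebra_simps add_divide_distrib)
  qed
  have J: "integral {0..R} (\<lambda>u. of_real u powr (w - 1) * of_real (cos u))
      = (integral {0..R} (E w) + cnj (integral {0..R} (E (cnj w)))) / 2" for R
  proof -
    have "integral {0..R} (\<lambda>u. of_real u powr (w - 1) * of_real (cos u))
        = integral {0..R} (\<lambda>u. (E w u + cnj (E (cnj w) u)) / 2)"
      by (rule integral_cong) (rule eq)
    also have "\<dots> = (integral {0..R} (E w) + integral {0..R} (\<lambda>u. cnj (E (cnj w) u))) / 2"
      using w intE by (simp add: integral_add integrable_on_cnj_iff)
    finally show ?thesis by (simp add: integral_cnj)
  qed
  have "((\<lambda>R. (integral {0..R} (E w) + cnj (integral {0..R} (E (cnj w)))) / 2) \<longlongrightarrow>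
      (exp (- (\<i> * of_real pi * w / 2)) * Gamma w + cnj (exp (- (\<i> * of_real pi * cnj w / 2)) * Gamma (cnj w))) / 2) at_top"
    unfolding E_def using w by (intro tendsto_intros Gamma_rotation_integral) auto
  also have "(exp (- (\<i> * of_real pi * w / 2)) * Gamma w + cnj (exp (- (\<i> * of_real pi * cnj w / 2)) * Gamma (cnj w))) / 2
      = Gamma w * cos (of_real pi * w / 2)"
    by (simp add: cos_exp_eq exp_cnj cnj_Gamma field_simps)
  finally show ?thesis unfolding J .
qed

text \<open>Integration by parts: \<open>S\<close> has derivative \<open>D + C\<close>, so the
  integral of \<open>C\<close> is a boundary term, giving the constant 2, minus the integral of
  \<open>D\<close>. The latter is absolutely convergent at infinity and contributes
  \<open>norm (w - 1) / (1 - Re w)\<close>.\<close>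

lemma cos_Mellin_increment_bound:
  fixes w :: complex
  assumes w: "0 < Re w" "Re w < 1" and R: "0 < R" "R \<le> R'"
  shows "norm (integral {0..R'} (\<lambda>u. of_real u powr (w - 1) * of_real (cos u))
      - integral {0..R} (\<lambda>u. of_real u powr (w - 1) * of_real (cos u)))
    \<le> (2 + norm (w - 1) / (1 - Re w)) * R powr (Re w - 1)"
proof (cases "R = R'")
  case True
  thus ?thesis using w by simp
next
  case False
  define a where "a = Re w"
  have a: "0 < a" "a < 1" using w by (auto simp: a_def)
  define C where "C = (\<lambda>u::real. complex_of_real u powr (w - 1) * of_real (cos u))"
  define S where "S = (\<lambda>u::real. complex_of_real u powr (w - 1) * of_real (sin u))"
  define D where "D = (\<lambda>u::real. (w - 1) * complex_of_real u powr (w - 2) * of_real (sin u))"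
  define \<phi> where "\<phi> = (\<lambda>u. - (norm (w - 1) / (1 - a) * u powr (a - 1)))"
  have S: "(S has_vector_derivative (D u + C u)) (at u)" if "u > 0" for u
  proof -
    have "((\<lambda>z. z powr (w - 1) * sin z) has_field_derivative
        ((w - 1) * of_real u powr (w - 1 - 1) * sin (of_real u) + of_real u powr (w - 1) * cos (of_real u))) (at (complex_of_real u))"
      using that by (auto intro!: derivative_eq_intros simp: complex_nonpos_Reals_iff)
    from has_vector_derivative_real_field[OF this] show ?thesis
      by (simp add: S_def D_def C_def sin_of_real cos_of_real)
  qed
  have \<phi>: "(\<phi> has_vector_derivative norm (w - 1) * u powr (a - 2)) (at u)" if "u > 0" for u
  proof -
    have "((\<lambda>u. u powr (a - 1)) has_real_derivative ((a - 1) * u powr (a - 1 - 1))) (at u)"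
      using that by (rule has_real_derivative_powr)
    from DERIV_minus[OF DERIV_cmult[OF this, of "norm (w - 1) / (1 - a)"]]
    have "(\<phi> has_real_derivative - (norm (w - 1) / (1 - a) * ((a - 1) * u powr (a - 1 - 1)))) (at u)"
      by (simp only: \<phi>_def)
    also have "- (norm (w - 1) / (1 - a) * ((a - 1) * u powr (a - 1 - 1))) = norm (w - 1) * u powr (a - 2)"
      using a by (simp add: divide_simps) (simp add: algebra_simps)
    finally show ?thesis by (simp only: has_real_derivative_iff_has_vector_derivative)
  qed
  have Cint: "C integrable_on {0..R'}" unfolding C_def using w by (intro integrable_powr_mult) auto
  have contC: "continuous_on {R..R'} C"
    unfolding C_def using R by (intro continuous_intros) (auto simp: complex_nonpos_Reals_iff)
  have "norm ((integral {R..R'} C - S R') - (integral {R..R} C - S R)) \<le> \<phi> R' - \<phi> R"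
  proof (rule differentiable_bound_general)
    show "R < R'" using False R by simp
    have "continuous_on {R..R'} S" "continuous_on {R..R'} \<phi>"
      by (intro continuous_at_imp_continuous_on ballI has_vector_derivative_continuous[OF S]
          has_vector_derivative_continuous[OF \<phi>]; use R in auto)+
    thus "continuous_on {R..R'} (\<lambda>x. integral {R..x} C - S x)" "continuous_on {R..R'} \<phi>"
      by (auto intro!: continuous_intros indefinite_integral_continuous_1 integrable_continuous_real contC)
    fix u assume u: "R < u" "u < R'"
    have "((\<lambda>x. integral {R..x} C) has_vector_derivative C u) (at u within {R..R'})"
      using u by (intro integral_has_vector_derivative contC) auto
    hence "((\<lambda>x. integral {R..x} C) has_vector_derivative C u) (at u)"
      using u by (simp add: at_within_Icc_at)
    from has_vector_derivative_diff[OF this S] u R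
    show "((\<lambda>x. integral {R..x} C - S x) has_vector_derivative (- D u)) (at u)" by simp
    show "(\<phi> has_vector_derivative norm (w - 1) * u powr (a - 2)) (at u)" using u R by (intro \<phi>) auto
    show "norm (- D u) \<le> norm (w - 1) * u powr (a - 2)"
      using u R by (auto simp: D_def norm_mult norm_of_real_powr a_def intro!: mult_left_le)
  qed
  also have "\<dots> \<le> norm (w - 1) / (1 - a) * R powr (a - 1)"
    using a by (simp add: \<phi>_def)
  finally have "norm (integral {R..R'} C - S R' + S R) \<le> norm (w - 1) / (1 - a) * R powr (a - 1)" by simp
  moreover have "norm (S u) \<le> R powr (a - 1)" if "u \<ge> R" for u
  proof -
    have "norm (S u) \<le> u powr (a - 1)"
      using that R by (auto simp: S_def norm_mult norm_of_real_powr a_def intro!: mult_left_le)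
    also have "\<dots> \<le> R powr (a - 1)" using that R a by (intro powr_mono2') auto
    finally show ?thesis .
  qed
  hence "norm (S R' - S R) \<le> R powr (a - 1) + R powr (a - 1)"
    using R by (intro norm_triangle_le_diff add_mono) auto
  ultimately have "norm ((integral {R..R'} C - S R' + S R) + (S R' - S R))
      \<le> norm (w - 1) / (1 - a) * R powr (a - 1) + (R powr (a - 1) + R powr (a - 1))"
    by (intro norm_triangle_mono)
  moreover have "integral {0..R'} C = integral {0..R} C + integral {R..R'} C"
    using R Cint by (intro Henstock_Kurzweil_Integration.integral_combine [symmetric]) auto
  ultimately show ?thesis
    unfolding C_def [symmetric] a_def [symmetric] by (simp add: algebra_simps)
qed

text \<open>The range is split at \<open>N = 1 + norm (w - 1)\<close>: up to \<open>N\<close> the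
  trivial bound \<open>R powr a / a\<close> serves, beyond it the increment bound. There the factor
  \<open>norm (w - 1)\<close> times \<open>N powr (a - 1)\<close> is at most
  \<open>N powr a\<close>, so both parts have the same order.\<close>

lemma cos_Mellin_uniform_bound:
  fixes w :: complex
  assumes w: "0 < Re w" "Re w < 1" and R: "0 \<le> R"
  shows "norm (integral {0..R} (\<lambda>u. of_real u powr (w - 1) * of_real (cos u)))
    \<le> (1 / Re w + 2 + 1 / (1 - Re w)) * (1 + norm (w - 1)) powr Re w"
proof -
  define a where "a = Re w"
  have a: "0 < a" "a < 1" using w by (auto simp: a_def)
  define N where "N = 1 + norm (w - 1)"
  have N: "N \<ge> 1" by (simp add: N_def)
  define J where "J = (\<lambda>R. integral {0..R} (\<lambda>u. of_real u powr (w - 1) * complex_of_real (cos u)))"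
  have triv: "norm (J R) \<le> R powr a / a" if "R \<ge> 0" for R
    unfolding J_def a_def using w that by (intro norm_integral_powr_mult_le) auto
  have first: "norm (J R) \<le> 1 / a * N powr a" if "R \<ge> 0" "R \<le> N" for R
  proof -
    have "R powr a \<le> N powr a" using that a by (intro powr_mono2) auto
    thus ?thesis using triv[OF that(1)] a by (simp add: field_simps)
  qed
  have "norm (J R) \<le> (1 / a + 2 + 1 / (1 - a)) * N powr a"
  proof (cases "R \<le> N")
    case True
    have "1 / a * N powr a \<le> (1 / a + 2 + 1 / (1 - a)) * N powr a"
      using a by (intro mult_right_mono) auto
    thus ?thesis using first[OF R True] by linarith
  next
    case False
    have "norm (J R - J N) \<le> (2 + norm (w - 1) / (1 - a)) * N powr (a - 1)"
      unfolding J_def a_def using cos_Mellin_increment_bound[OF w, of N R] N False by auto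
    also have "\<dots> \<le> ((2 + 1 / (1 - a)) * N) * N powr (a - 1)"
    proof (intro mult_right_mono)
      have "norm (w - 1) / (1 - a) \<le> N / (1 - a)" using a by (intro divide_right_mono) (auto simp: N_def)
      thus "2 + norm (w - 1) / (1 - a) \<le> (2 + 1 / (1 - a)) * N" using N by (simp add: algebra_simps)
    qed auto
    also have "\<dots> = (2 + 1 / (1 - a)) * N powr a" using N by (simp add: powr_diff)
    finally have "norm (J R) \<le> norm (J N) + (2 + 1 / (1 - a)) * N powr a"
      using norm_triangle_ineq2[of "J R" "J N"] by linarith
    also have "norm (J N) \<le> 1 / a * N powr a" using first[of N] N by simp
    finally show ?thesis by (simp add: algebra_simps)
  qed
  thus ?thesis by (simp add: J_def a_def N_def)
qed

section \<open>Bessel functions\<close>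

text \<open>Supplies the factorials \<open>fact (2 * k)\<close> that turn the Bessel series of order
  \<open>-1/2\<close> into the cosine series.\<close>

lemma rGamma_half_plus_nat: "rGamma (real k + 1/2) = 4 ^ k * fact k / (fact (2 * k) * sqrt pi)"
proof (induction k)
  case 0
  show ?case by (simp add: rGamma_inverse_Gamma Gamma_one_half_real field_simps)
next
  case (Suc k)
  have "(real k + 1/2) * rGamma (real k + 1/2 + 1) = rGamma (real k + 1/2)" by (rule rGamma_plus1)
  hence "rGamma (real k + 1/2 + 1) = rGamma (real k + 1/2) / (real k + 1/2)"
    by (simp add: field_simps)
  also have "\<dots> = (4 ^ k * fact k / (fact (2 * k) * sqrt pi)) / (real k + 1/2)"
    by (simp only: Suc.IH)
  also have "\<dots> = 4 ^ Suc k * fact (Suc k) / (fact (2 * Suc k) * sqrt pi)"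
    by (simp add: divide_simps) (simp add: algebra_simps)
  finally show ?case by (simp add: add_ac)
qed

lemma bessel_J_minus_half:
  assumes u: "u > 0"
  shows "bessel_J (-1/2) u = sqrt (2 / (pi * u)) * cos u"
proof -
  have "(\<lambda>n. sqrt (2 / (pi * u)) * ((- 1) ^ n / fact (2 * n) * u ^ (2 * n))) sums (sqrt (2 / (pi * u)) * cos u)"
    by (intro sums_mult cos_paired)
  moreover have "(-1) ^ k / fact k * rGamma (-1/2 + real k + 1) * (u / 2) powr (2 * real k + -1/2)
      = sqrt (2 / (pi * u)) * ((- 1) ^ k / fact (2 * k) * u ^ (2 * k))" for k
  proof -
    have "(u / 2) powr (2 * real k + -1/2) = (u / 2) powr real (2 * k) * (u / 2) powr (- (1/2))"
      by (simp add: powr_add [symmetric])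
    also have "(u / 2) powr real (2 * k) = u ^ (2 * k) / 4 ^ k"
      using u by (subst powr_realpow) (auto simp: power_divide power_mult)
    also have "(u / 2) powr (- (1/2)) = sqrt (2 / u)"
      using u by (simp add: powr_minus powr_half_sqrt real_sqrt_divide field_simps)
    finally have 1: "(u / 2) powr (2 * real k + -1/2) = u ^ (2 * k) / 4 ^ k * sqrt (2 / u)" .
    have 2: "rGamma (-1/2 + real k + 1) = 4 ^ k * fact k / (fact (2 * k) * sqrt pi)"
      using rGamma_half_plus_nat[of k] by (simp add: algebra_simps)
    have 3: "sqrt (2 / (pi * u)) = sqrt (2 / u) / sqrt pi"
      using u by (simp add: real_sqrt_divide real_sqrt_mult field_simps)
    show ?thesis unfolding 1 2 3 by (simp add: field_simps)
  qed
  ultimately show ?thesis unfolding bessel_J_def by (simp add: sums_iff)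
qed

section \<open>The Bessel function as a sum of residues\<close>

lemma contour_integral_vertical_segment:
  assumes ab: "a < b" and F: "(F has_contour_integral v) (linepath (Complex c a) (Complex c b))"
  shows "((\<lambda>t. F (Complex c t)) has_integral (v / \<i>)) {a..b}"
proof -
  have "linepath (Complex c a) (Complex c b) = Complex c \<circ> (\<lambda>x. (b - a) *\<^sub>R x + a)"
    by (auto simp: linepath_def fun_eq_iff complex_eq_iff algebra_simps)
  moreover have "Complex c piecewise_C1_differentiable_on {a..b}"
    using vertical_line_vertical_contour[of c] by (simp add: vertical_contour_def)
  ultimately have "((\<lambda>t. F (Complex c t) * \<i>) has_integral v) {a..b}"
    using has_integral_along_affine_reparam[OF ab, of "Complex c" F v] F
    by (simp add: vector_derivative_vertical_line)
  from has_integral_mult_left[OF this, of "1 / \<i>"] show ?thesis by (simp add: mult.assoc mult.commute[of v])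
qed

lemma has_integral_symmetric_limit:
  fixes f :: "real \<Rightarrow> complex"
  assumes "(f has_integral I) UNIV"
  shows "((\<lambda>T. integral {-T..T} f) \<longlongrightarrow> I) at_top"
proof (rule tendstoI)
  fix e :: real assume "e > 0"
  then obtain B where B: "B > 0" "\<And>a b. ball 0 B \<subseteq> cbox a b \<Longrightarrow> norm (integral (cbox a b) f - I) < e"
    using assms unfolding has_integral_alt'[of f I UNIV] by auto
  show "\<forall>\<^sub>F T in at_top. dist (integral {-T..T} f) I < e"
    using eventually_ge_at_top[of B]
  proof eventually_elim
    case (elim T)
    have "ball 0 B \<subseteq> cbox (- T) T" using elim by (auto simp: dist_real_def)
    thus ?case using B(2)[of "- T" T] by (simp add: dist_norm)
  qed
qed

text \<open>The residue theorem is applied to rectangles of height \<open>2 * T\<close>, whose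
  horizontal sides vanish by the bound \<open>B\<close>. The factor is \<open>2 * pi\<close> without
  \<open>\<i>\<close> because the integrals are taken in \<open>t\<close>, where
  \<open>ds = \<i> dt\<close>.\<close>

lemma vertical_line_shift_residue:
  fixes F :: "complex \<Rightarrow> complex"
  assumes c: "\<alpha> < c1" "c1 < p" "p < c2" "c2 < \<beta>"
    and hol: "F holomorphic_on {s. \<alpha> < Re s \<and> Re s < \<beta>} - {of_real p}"
    and bound: "\<And>x t. \<lbrakk>x \<in> {c1..c2}; \<bar>t\<bar> \<ge> 1\<rbrakk> \<Longrightarrow> norm (F (Complex x t)) \<le> B \<bar>t\<bar>"
    and B: "(B \<longlongrightarrow> 0) at_top"
    and I1: "((\<lambda>t. F (Complex c1 t)) has_integral I1) UNIV"
    and I2: "((\<lambda>t. F (Complex c2 t)) has_integral I2) UNIV"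
  shows "I2 - I1 = 2 * of_real pi * residue F (of_real p)"
proof -
  define S where "S = {s. \<alpha> < Re s \<and> Re s < \<beta>}"
  have "S = {s. \<alpha> < Re s} \<inter> {s. Re s < \<beta>}" by (auto simp: S_def)
  hence S: "open S" "convex S"
    by (auto intro!: open_Int convex_Int open_halfspace_Re_gt open_halfspace_Re_lt convex_halfspace_Re_gt convex_halfspace_Re_lt)
  have cont: "continuous_on (S - {of_real p}) F"
    using hol by (auto simp: S_def intro: holomorphic_on_imp_continuous_on)
  have horiz: "F contour_integrable_on linepath (Complex a T) (Complex b T) \<and>
      norm (contour_integral (linepath (Complex a T) (Complex b T)) F) \<le> B \<bar>T\<bar> * \<bar>b - a\<bar>"
    if T: "\<bar>T\<bar> \<ge> 1" and ab: "{a, b} = {c1, c2}" for T a b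
  proof -
    have seg: "Re z \<in> {c1..c2} \<and> Im z = T" if "z \<in> closed_segment (Complex a T) (Complex b T)" for z
      using that ab c by (auto simp: closed_segment_same_Im closed_segment_eq_real_ivl doubleton_eq_iff split: if_splits)
    have "closed_segment (Complex a T) (Complex b T) \<subseteq> S - {of_real p}"
      using seg T c by (auto simp: S_def; fastforce)
    hence int: "F contour_integrable_on linepath (Complex a T) (Complex b T)"
      by (intro contour_integrable_continuous_linepath continuous_on_subset[OF cont])
    have bnd: "norm (F z) \<le> B \<bar>T\<bar>" if "z \<in> closed_segment (Complex a T) (Complex b T)" for z
      using bound[of "Re z" T] seg[OF that] T by (metis complex_surj)
    have "0 \<le> B \<bar>T\<bar>" by (rule order.trans[OF norm_ge_zero bnd[of "Complex a T"]]) auto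
    moreover have "norm (Complex b T - Complex a T) = \<bar>b - a\<bar>"
      by (simp add: cmod_def)
    ultimately have "norm (contour_integral (linepath (Complex a T) (Complex b T)) F) \<le> B \<bar>T\<bar> * \<bar>b - a\<bar>"
      using has_contour_integral_bound_linepath[OF has_contour_integral_integral[OF int] _ bnd] by simp
    with int show ?thesis by simp
  qed
  have vert: "F contour_integrable_on linepath (Complex x (- T)) (Complex x T) \<and>
      contour_integral (linepath (Complex x (- T)) (Complex x T)) F = \<i> * integral {-T..T} (\<lambda>t. F (Complex x t))"
    if "T \<ge> 1" "x \<in> {c1, c2}" for T x
  proof -
    have "closed_segment (Complex x (- T)) (Complex x T) \<subseteq> S - {of_real p}"
      using that c by (auto simp: S_def closed_segment_same_Re)
    hence int: "F contour_integrable_on linepath (Complex x (- T)) (Complex x T)"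
      by (intro contour_integrable_continuous_linepath continuous_on_subset[OF cont])
    have "((\<lambda>t. F (Complex x t)) has_integral (contour_integral (linepath (Complex x (- T)) (Complex x T)) F / \<i>)) {-T..T}"
      using that by (intro contour_integral_vertical_segment has_contour_integral_integral int) auto
    from integral_unique[OF this] int show ?thesis by simp
  qed
  have rect: "\<i> * (integral {-T..T} (\<lambda>t. F (Complex c2 t)) - integral {-T..T} (\<lambda>t. F (Complex c1 t)))
      + (contour_integral (linepath (Complex c1 (- T)) (Complex c2 (- T))) F
      + contour_integral (linepath (Complex c2 T) (Complex c1 T)) F)
      = 2 * of_real pi * \<i> * residue F (of_real p)" if T: "T \<ge> 1" for T
  proof -
    let ?g = "rectpath (Complex c1 (- T)) (Complex c2 T)"
    have img: "path_image ?g \<subseteq> S - {of_real p}"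
      using T c by (subst path_image_rectpath) (auto simp: S_def)
    have "contour_integral ?g F = 2 * pi * \<i> * (\<Sum>q\<in>{of_real p}. winding_number ?g q * residue F q)"
    proof (rule Residue_theorem)
      show "connected S" by (rule convex_connected[OF S(2)])
      show "\<forall>z. z \<notin> S \<longrightarrow> winding_number ?g z = 0"
        using T c by (auto intro!: winding_number_rectpath_outside simp: S_def in_cbox_complex_iff)
    qed (use S img hol in \<open>auto simp: S_def\<close>)
    also have "winding_number ?g (of_real p) = 1"
      using T c by (intro winding_number_rectpath) (auto simp: in_box_complex_iff)
    hence "(\<Sum>q\<in>{of_real p}. winding_number ?g q * residue F q) = residue F (of_real p)" by simp
    also have "contour_integral ?g F =
        contour_integral (linepath (Complex c1 (- T)) (Complex c2 (- T))) F
        + (contour_integral (linepath (Complex c2 (- T)) (Complex c2 T)) F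
        + (contour_integral (linepath (Complex c2 T) (Complex c1 T)) F
        + contour_integral (linepath (Complex c1 T) (Complex c1 (- T))) F))"
    proof -
      have "F contour_integrable_on reversepath (linepath (Complex c1 (- T)) (Complex c1 T))"
        using vert[OF T, of c1] by (intro contour_integrable_reversepath) auto
      hence "F contour_integrable_on linepath (Complex c1 T) (Complex c1 (- T))" by simp
      thus ?thesis
        using horiz[of "- T" c1 c2] horiz[of T c2 c1] vert[OF T, of c2] T
        unfolding rectpath_def Let_def by (simp add: contour_integrable_join insert_commute)
    qed
    also have "contour_integral (linepath (Complex c1 T) (Complex c1 (- T))) F
        = - contour_integral (linepath (Complex c1 (- T)) (Complex c1 T)) F"
      using contour_integral_reversepath[of "linepath (Complex c1 (- T)) (Complex c1 T)" F] by simp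
    finally show ?thesis
      using vert[OF T, of c1] vert[OF T, of c2] by (simp add: algebra_simps)
  qed
  have hz: "((\<lambda>T. contour_integral (linepath (Complex c1 (- T)) (Complex c2 (- T))) F
      + contour_integral (linepath (Complex c2 T) (Complex c1 T)) F) \<longlongrightarrow> 0) at_top"
  proof (rule Lim_null_comparison)
    show "\<forall>\<^sub>F T in at_top. norm (contour_integral (linepath (Complex c1 (- T)) (Complex c2 (- T))) F
      + contour_integral (linepath (Complex c2 T) (Complex c1 T)) F) \<le> B T * (2 * \<bar>c2 - c1\<bar>)"
      using eventually_ge_at_top[of 1]
    proof eventually_elim
      case (elim T)
      show ?case
        using norm_triangle_mono[of "contour_integral (linepath (Complex c1 (- T)) (Complex c2 (- T))) F"
            "B T * \<bar>c2 - c1\<bar>" "contour_integral (linepath (Complex c2 T) (Complex c1 T)) F" "B T * \<bar>c1 - c2\<bar>"]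
          horiz[of "- T" c1 c2] horiz[of T c2 c1] elim
        by (simp add: insert_commute abs_minus_commute)
    qed
    show "((\<lambda>T. B T * (2 * \<bar>c2 - c1\<bar>)) \<longlongrightarrow> 0) at_top"
      by (rule tendsto_mult_left_zero[OF B])
  qed
  have "((\<lambda>T. \<i> * (integral {-T..T} (\<lambda>t. F (Complex c2 t)) - integral {-T..T} (\<lambda>t. F (Complex c1 t)))
      + (contour_integral (linepath (Complex c1 (- T)) (Complex c2 (- T))) F
      + contour_integral (linepath (Complex c2 T) (Complex c1 T)) F)) \<longlongrightarrow> \<i> * (I2 - I1) + 0) at_top"
    by (intro tendsto_intros has_integral_symmetric_limit I1 I2 hz)
  moreover have "\<forall>\<^sub>F T in at_top. \<i> * (integral {-T..T} (\<lambda>t. F (Complex c2 t)) - integral {-T..T} (\<lambda>t. F (Complex c1 t)))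
      + (contour_integral (linepath (Complex c1 (- T)) (Complex c2 (- T))) F
      + contour_integral (linepath (Complex c2 T) (Complex c1 T)) F) = 2 * of_real pi * \<i> * residue F (of_real p)"
    using eventually_ge_at_top[of 1] by eventually_elim (rule rect)
  ultimately have "((\<lambda>T::real. 2 * of_real pi * \<i> * residue F (of_real p)) \<longlongrightarrow> \<i> * (I2 - I1) + 0) at_top"
    by (rule Lim_transform_eventually)
  hence "\<i> * (I2 - I1) = 2 * of_real pi * \<i> * residue F (of_real p)"
    using tendsto_unique[OF trivial_limit_at_top_linorder _ tendsto_const] by fastforce
  thus ?thesis by (simp add: mult_ac)
qed

text \<open>The line is moved to the left in unit steps, each crossing one pole. By the functional
  equation of Gamma a step divides the integrand by
  \<open>y * ((s - 1/2) * (\<rho> + 1 - s))\<close>, which on the line \<open>\<sigma> - N\<close>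
  has modulus at least \<open>1 / r N\<close>. So integrability passes from the first line to all
  others, and the remainder \<open>I N\<close> is at most a constant times the product
  \<open>q N\<close>.\<close>

lemma bessel_J_MB_integral:
  fixes \<rho> \<sigma> z :: real
  defines "y \<equiv> 4 / z\<^sup>2"
  assumes z: "z > 0" and \<rho>: "\<rho> > -1/2" and \<sigma>: "-1/2 < \<sigma>" "\<sigma> < 0" "2 * \<sigma> - 1/2 - \<rho> < -1"
  shows "complex_of_real (bessel_J (\<rho> + 1/2) z) = of_real (2 powr (1/2 - \<rho>) * z powr (\<rho> - 1/2)) / (2 * of_real pi) *
    (LINT t|lborel. MB_kernel \<rho> 0 (Complex \<sigma> t) * of_real y powr Complex \<sigma> t)"
proof -
  have y: "y > 0" using z by (simp add: y_def)
  define F where "F = (\<lambda>s. MB_kernel \<rho> 0 s * of_real y powr s)"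
  define r where "r = (\<lambda>N::nat. 1 / (y * ((1/2 - \<sigma> + real N) * (\<rho> + 1 - \<sigma> + real N))))"
  define q where "q = (\<lambda>N. \<Prod>j<N. r j)"
  define I where "I = (\<lambda>N::nat. LINT t|lborel. F (Complex (\<sigma> - real N) t))"
  define res where "res = (\<lambda>N::nat. (-1) ^ N / fact N * rGamma (complex_of_real \<rho> + 1 - of_real (-1/2 - real N)) * of_real y powr of_real (-1/2 - real N))"
  \<comment> \<open>\<open>\<sigma> + 1/2\<close> lies strictly between 0 and 1, so no shifted line
    meets a pole.\<close>
  have not_int: "\<sigma> - real N + 1/2 \<noteq> - real k" for N k
  proof
    assume "\<sigma> - real N + 1/2 = - real k"
    hence "of_int (int N - int k) = \<sigma> + 1/2" by simp
    hence "0 < (of_int (int N - int k) :: real)" "(of_int (int N - int k) :: real) < 1" using \<sigma> by linarith+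
    thus False unfolding of_int_0_less_iff of_int_less_1_iff by linarith
  qed
  have shift: "F (s - 1) * (of_real y * ((s - 1/2) * (of_real \<rho> + 1 - s))) = F s" if "s - 1/2 \<notin> \<int>\<^sub>\<le>\<^sub>0" for s
  proof -
    have "Gamma (s - 1/2 + 1) = (s - 1/2) * Gamma (s - 1/2)" by (rule Gamma_plus1[OF that])
    hence G: "Gamma (1/2 + s) = (s - 1/2) * Gamma (1/2 + (s - 1))" by (simp add: algebra_simps)
    have "(of_real \<rho> + 1 - s) * rGamma (of_real \<rho> + 1 - s + 1) = rGamma (of_real \<rho> + 1 - s)" by (rule rGamma_plus1)
    hence R: "rGamma (of_real \<rho> + 1 - s) = (of_real \<rho> + 1 - s) * rGamma (of_real \<rho> + 1 - (s - 1))"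
      by (simp add: algebra_simps)
    have Y: "of_real y powr s = of_real y * of_real y powr (s - 1)"
      using y by (simp add: powr_diff)
    show ?thesis unfolding F_def MB_kernel_def G R Y by simp
  qed
  have step: "norm (F (Complex (\<sigma> - real (Suc N)) t)) \<le> r N * norm (F (Complex (\<sigma> - real N) t))" for N t
  proof -
    define s where "s = Complex (\<sigma> - real N) t"
    have "s - 1/2 \<notin> \<int>\<^sub>\<le>\<^sub>0"
    proof
      assume "s - 1/2 \<in> \<int>\<^sub>\<le>\<^sub>0"
      then obtain n where "s - 1/2 = - of_nat n" by (elim nonpos_Ints_cases')
      hence "\<sigma> - real (Suc N) + 1/2 = - real n" by (simp add: s_def complex_eq_iff algebra_simps)
      thus False using not_int by blast
    qed
    from shift[OF this] have eq: "norm (F (s - 1)) * (y * (norm (s - 1/2) * norm (of_real \<rho> + 1 - s))) = norm (F s)"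
      using y by (metis norm_mult norm_of_real abs_of_pos)
    have 1: "1/2 - \<sigma> + real N \<le> norm (s - 1/2)"
      using abs_Re_le_cmod[of "s - 1/2"] by (simp add: s_def)
    have 2: "\<rho> + 1 - \<sigma> + real N \<le> norm (of_real \<rho> + 1 - s)"
      using abs_Re_le_cmod[of "of_real \<rho> + 1 - s"] by (simp add: s_def)
    have pos: "0 < 1/2 - \<sigma> + real N" "0 < \<rho> + 1 - \<sigma> + real N" using \<sigma> \<rho> by auto
    have "norm (F (s - 1)) * (y * ((1/2 - \<sigma> + real N) * (\<rho> + 1 - \<sigma> + real N))) \<le> norm (F s)"
      unfolding eq [symmetric] using 1 2 pos y by (intro mult_left_mono mult_mono) auto
    moreover have "y * ((1/2 - \<sigma> + real N) * (\<rho> + 1 - \<sigma> + real N)) > 0" using pos y by simp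
    ultimately have "norm (F (s - 1)) \<le> r N * norm (F s)" by (simp add: r_def pos_le_divide_eq)
    moreover have "s - 1 = Complex (\<sigma> - real (Suc N)) t" by (simp add: s_def complex_eq_iff)
    ultimately show ?thesis by (simp add: s_def)
  qed
  have r_pos: "r N > 0" for N unfolding r_def using \<sigma> \<rho> y by (intro divide_pos_pos mult_pos_pos) auto
  have q_bound: "norm (F (Complex (\<sigma> - real N) t)) \<le> q N * norm (F (Complex \<sigma> t))" for N t
  proof (induction N)
    case (Suc N)
    have "norm (F (Complex (\<sigma> - real (Suc N)) t)) \<le> r N * norm (F (Complex (\<sigma> - real N) t))" by (rule step)
    also have "\<dots> \<le> r N * (q N * norm (F (Complex \<sigma> t)))"
      using r_pos[of N] by (intro mult_left_mono Suc.IH) auto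
    finally show ?case by (simp add: q_def mult_ac)
  qed (simp add: q_def)
  have F_hol: "F holomorphic_on - range (\<lambda>k. of_real (-1/2 - real k))"
    unfolding F_def using y by (intro holomorphic_on_mult MB_kernel_holomorphic holomorphic_intros) auto
  have F_meas [measurable]: "(\<lambda>t. F (Complex (\<sigma> - real N) t)) \<in> borel_measurable borel" for N
  proof (rule borel_measurable_continuous_onI)
    have "Complex (\<sigma> - real N) t \<noteq> of_real (-1/2 - real k)" for t k
    proof
      assume "Complex (\<sigma> - real N) t = of_real (-1/2 - real k)"
      hence "\<sigma> - real N + 1/2 = - real k" by (simp add: complex_eq_iff)
      thus False using not_int by blast
    qed
    hence "range (Complex (\<sigma> - real N)) \<subseteq> - range (\<lambda>k. of_real (-1/2 - real k))"
      by (auto simp del: of_real_diff of_real_minus of_real_divide)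
    thus "continuous_on UNIV (\<lambda>t. F (Complex (\<sigma> - real N) t))"
      by (intro continuous_on_compose2[OF holomorphic_on_imp_continuous_on[OF F_hol]])
         (auto simp: Complex_eq [abs_def] intro!: continuous_intros)
  qed
  have "integrable lborel (\<lambda>t. (1 + \<bar>t\<bar>) powr 0 * norm (MB_kernel \<rho> 0 (Complex \<sigma> t)))"
    using \<sigma> by (intro MB_kernel_line_integrable) auto
  moreover have "(1 + \<bar>t\<bar>) powr 0 = 1" for t :: real
  proof -
    have "1 + \<bar>t\<bar> > 0" by linarith
    thus ?thesis by simp
  qed
  ultimately have "integrable lborel (\<lambda>t. y powr \<sigma> * norm (MB_kernel \<rho> 0 (Complex \<sigma> t)))"
    by (simp only: mult_1 integrable_mult_right)
  hence F0_int: "integrable lborel (\<lambda>t. norm (F (Complex \<sigma> t)))"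
    using y by (simp add: F_def norm_mult norm_powr_real_powr mult.commute)
  have F_int: "integrable lborel (\<lambda>t. F (Complex (\<sigma> - real N) t))" for N
  proof (rule Bochner_Integration.integrable_bound)
    show "integrable lborel (\<lambda>t. q N * norm (F (Complex \<sigma> t)))" using F0_int by simp
    show "AE t in lborel. norm (F (Complex (\<sigma> - real N) t)) \<le> norm (q N * norm (F (Complex \<sigma> t)))"
      by (rule AE_I2, rule order.trans[OF q_bound]) simp
  qed measurable
  have I_lim: "I \<longlonglongrightarrow> 0"
  proof (rule Lim_null_comparison)
    show "\<forall>\<^sub>F N in sequentially. norm (I N) \<le> q N * (LINT t|lborel. norm (F (Complex \<sigma> t)))"
    proof (rule always_eventually, rule allI)
      fix N
      have "norm (I N) \<le> (LINT t|lborel. norm (F (Complex (\<sigma> - real N) t)))"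
        unfolding I_def by (rule integral_norm_bound)
      also have "\<dots> \<le> (LINT t|lborel. q N * norm (F (Complex \<sigma> t)))"
        using F_int F0_int by (intro integral_mono q_bound) auto
      finally show "norm (I N) \<le> q N * (LINT t|lborel. norm (F (Complex \<sigma> t)))" by simp
    qed
    \<comment> \<open>The ratio test is a short way to \<open>q \<longlonglongrightarrow> 0\<close>:
      the factors \<open>r N\<close> drop below 1/2 once \<open>y * real N \<ge> 4\<close>, the
      second bracket being at least 1/2.\<close>
    have "summable q"
    proof (rule summable_ratio_test)
      fix N assume N: "nat \<lceil>4 / y\<rceil> \<le> N"
      hence "4 / y \<le> real N" by linarith
      hence "4 \<le> y * real N" using y by (simp add: field_simps)
      hence "2 \<le> y * (real N * (1/2))" by simp
      also have "\<dots> \<le> y * ((1/2 - \<sigma> + real N) * (\<rho> + 1 - \<sigma> + real N))"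
        using y \<sigma> \<rho> by (intro mult_left_mono mult_mono) auto
      finally have "r N \<le> 1 / 2" unfolding r_def by (intro divide_left_mono) auto
      moreover have "q N > 0" using r_pos by (auto simp: q_def intro: prod_pos)
      ultimately show "norm (q (Suc N)) \<le> 1 / 2 * norm (q N)"
        using r_pos[of N] by (simp add: q_def abs_mult prod_pos less_imp_le)
    qed auto
    hence "q \<longlonglongrightarrow> 0" by (rule summable_LIMSEQ_zero)
    thus "(\<lambda>N. q N * (LINT t|lborel. norm (F (Complex \<sigma> t)))) \<longlonglongrightarrow> 0" by (rule tendsto_mult_left_zero)
  qed
  have F_strip: "F holomorphic_on {s. -3/2 - real N < Re s \<and> Re s < 1/2 - real N} - {of_real (-1/2 - real N)}" for N
  proof (rule holomorphic_on_subset[OF F_hol], safe)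
    fix k assume k: "-3/2 - real N < Re (complex_of_real (-1/2 - real k))" "Re (complex_of_real (-1/2 - real k)) < 1/2 - real N"
      and ne: "complex_of_real (-1/2 - real k) \<notin> {}" "complex_of_real (-1/2 - real k) \<noteq> complex_of_real (-1/2 - real N)"
    hence "real k < real N + 1" "real N < real k + 1" by auto
    hence "k = N" by linarith
    thus False using ne by simp
  qed
  have residue: "residue F (of_real (-1/2 - real N)) = res N" for N
  proof (rule residue_simple')
    have "{s. -3/2 - real N < Re s \<and> Re s < 1/2 - real N} = {s. -3/2 - real N < Re s} \<inter> {s. Re s < 1/2 - real N}" by auto
    thus "open {s. -3/2 - real N < Re s \<and> Re s < 1/2 - real N}"
      by (auto intro!: open_Int open_halfspace_Re_gt open_halfspace_Re_lt)
    show "F holomorphic_on {s. -3/2 - real N < Re s \<and> Re s < 1/2 - real N} - {of_real (-1/2 - real N)}" by (rule F_strip)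
    define p where "p = complex_of_real (-1/2 - real N)"
    have "(\<lambda>w::complex. Gamma (w + 1/2) * (w + 1/2 + of_nat N)) \<midarrow>(- of_nat N - 1/2)\<rightarrow> (-1) ^ N / fact N"
      using LIM_offset[OF Gamma_residues[of N, where 'a = complex], of "1/2"] by simp
    moreover have "- of_nat N - 1/2 = p" by (simp add: p_def)
    ultimately have G: "((\<lambda>w. Gamma (w + 1/2) * (w + 1/2 + of_nat N)) \<longlongrightarrow> (-1) ^ N / fact N) (at p)" by simp
    have "isCont (\<lambda>w. rGamma (of_real \<rho> + 1 - w) * of_real y powr w) p"
      using y by (intro continuous_intros) auto
    hence "((\<lambda>w. rGamma (of_real \<rho> + 1 - w) * of_real y powr w) \<longlongrightarrow> rGamma (of_real \<rho> + 1 - p) * of_real y powr p) (at p)"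
      by (rule isContD)
    from tendsto_mult[OF G this]
    show "((\<lambda>w. F w * (w - of_real (-1/2 - real N))) \<longlongrightarrow> res N) (at (of_real (-1/2 - real N)))"
      unfolding p_def [symmetric]
      by (simp add: F_def MB_kernel_def res_def p_def algebra_simps)
  qed auto
  have I_step: "I N - I (Suc N) = 2 * of_real pi * res N" for N
  proof -
    define M where "M = \<bar>\<sigma>\<bar> + real N + 2"
    obtain C where C: "C > 0" "\<And>x t. \<lbrakk>\<bar>x\<bar> \<le> M; \<bar>t\<bar> \<ge> 1\<rbrakk> \<Longrightarrow>
       norm (MB_kernel \<rho> 0 (Complex x t)) \<le> C * \<bar>t\<bar> powr ((2 * real 0 + 2) * x + (real 0 - 1) / 2 - \<rho>)"
      using norm_MB_kernel_bound[of M \<rho> 0] by blast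
    define c1 where "c1 = \<sigma> - real (Suc N)"
    define c2 where "c2 = \<sigma> - real N"
    \<comment> \<open>Between \<open>c1\<close> and \<open>c2\<close> the power
      \<open>y powr x\<close> is largest at one of the two ends, depending on whether
      \<open>y \<ge> 1\<close>; the sum covers both cases.\<close>
    define Y where "Y = y powr c1 + y powr c2"
    have "I N - I (Suc N) = 2 * of_real pi * residue F (of_real (-1/2 - real N))"
    proof (rule vertical_line_shift_residue[OF _ _ _ _ F_strip, where B = "\<lambda>t. C * Y * t powr (2 * \<sigma> - 1/2 - \<rho>)"])
      show "((\<lambda>t. F (Complex c1 t)) has_integral I (Suc N)) UNIV" "((\<lambda>t. F (Complex c2 t)) has_integral I N) UNIV"
        unfolding I_def c1_def c2_def by (rule has_integral_integral_lborel[OF F_int])+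
      show "((\<lambda>t. C * Y * t powr (2 * \<sigma> - 1/2 - \<rho>)) \<longlongrightarrow> 0) at_top"
        using \<sigma> by (intro tendsto_mult_right_zero tendsto_neg_powr filterlim_ident) auto
      fix x t :: real assume x: "x \<in> {c1..c2}" and t: "\<bar>t\<bar> \<ge> 1"
      have "y powr x \<le> Y"
      proof (cases "y \<ge> 1")
        case True
        hence "y powr x \<le> y powr c2" using x by (intro powr_mono) auto
        thus ?thesis by (simp add: Y_def add_increasing)
      next
        case False
        hence "y powr x \<le> y powr c1" using x y by (intro powr_mono') auto
        thus ?thesis by (simp add: Y_def add_increasing2)
      qed
      have k1: "norm (MB_kernel \<rho> 0 (Complex x t)) \<le> C * \<bar>t\<bar> powr (2 * x - 1/2 - \<rho>)"
      proof -
        have "\<bar>x\<bar> \<le> M" using x by (auto simp: M_def c1_def c2_def abs_le_iff)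
        from C(2)[OF this t] show ?thesis by simp
      qed
      have "\<bar>t\<bar> powr (2 * x - 1/2 - \<rho>) \<le> \<bar>t\<bar> powr (2 * \<sigma> - 1/2 - \<rho>)"
        using x t by (intro powr_mono) (auto simp: c2_def)
      hence "C * \<bar>t\<bar> powr (2 * x - 1/2 - \<rho>) \<le> C * \<bar>t\<bar> powr (2 * \<sigma> - 1/2 - \<rho>)"
        using C(1) by (intro mult_left_mono) auto
      with k1 have "norm (MB_kernel \<rho> 0 (Complex x t)) \<le> C * \<bar>t\<bar> powr (2 * \<sigma> - 1/2 - \<rho>)" by (rule order.trans)
      with \<open>y powr x \<le> Y\<close> have "norm (MB_kernel \<rho> 0 (Complex x t)) * y powr x \<le> (C * \<bar>t\<bar> powr (2 * \<sigma> - 1/2 - \<rho>)) * Y"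
        using C(1) by (intro mult_mono) auto
      thus "norm (F (Complex x t)) \<le> C * Y * \<bar>t\<bar> powr (2 * \<sigma> - 1/2 - \<rho>)"
        using y by (simp add: F_def norm_mult norm_powr_real_powr mult_ac)
    qed (use \<sigma> in \<open>auto simp: c1_def c2_def\<close>)
    thus ?thesis by (simp only: residue)
  qed
  have "(\<Sum>k<N. 2 * of_real pi * res k) = I 0 - I N" for N
    by (induction N) (simp_all add: I_step [symmetric])
  hence "(\<lambda>N. \<Sum>k<N. 2 * of_real pi * res k) \<longlonglongrightarrow> I 0 - 0"
    by (simp only:) (intro tendsto_intros I_lim)
  hence "(\<lambda>k. 2 * of_real pi * res k) sums I 0" by (simp add: sums_def)
  \<comment> \<open>The real prefactor is \<open>(z / 2) powr (\<rho> - 1/2)\<close>, and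
    \<open>y powr (-1/2 - k)\<close> is \<open>(z / 2) powr (2 * k + 1)\<close>; together they form
    the power of the Bessel series.\<close>
  define A where "A = complex_of_real (2 powr (1/2 - \<rho>) * z powr (\<rho> - 1/2))"
  define b where "b = (\<lambda>k. (-1) ^ k / fact k * rGamma (\<rho> + 1/2 + real k + 1) * (z / 2) powr (2 * real k + (\<rho> + 1/2)))"
  from sums_mult[OF \<open>(\<lambda>k. 2 * of_real pi * res k) sums I 0\<close>, of "A / (2 * of_real pi)"]
  have "(\<lambda>k. A * res k) sums (A / (2 * of_real pi) * I 0)" by simp
  moreover have "A * res k = of_real (b k)" for k
  proof -
    have 1: "of_real y powr complex_of_real (-1/2 - real k) = of_real (y powr (-1/2 - real k))"
      using y by (intro powr_of_real) auto
    have 2: "rGamma (of_real \<rho> + 1 - of_real (-1/2 - real k)) = complex_of_real (rGamma (\<rho> + 1/2 + real k + 1))"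
    proof -
      have "of_real \<rho> + 1 - of_real (-1/2 - real k) = complex_of_real (\<rho> + 1/2 + real k + 1)" by simp
      thus ?thesis by (simp only: rGamma_complex_of_real)
    qed
    have 3: "2 powr (1/2 - \<rho>) * z powr (\<rho> - 1/2) = (z / 2) powr (\<rho> - 1/2)"
    proof -
      have "2 powr (1/2 - \<rho>) = inverse (2 powr (\<rho> - 1/2))" by (simp flip: powr_minus)
      hence "2 powr (1/2 - \<rho>) * z powr (\<rho> - 1/2) = z powr (\<rho> - 1/2) / 2 powr (\<rho> - 1/2)"
        by (simp only: divide_inverse mult.commute)
      also have "\<dots> = (z / 2) powr (\<rho> - 1/2)"
        by (rule powr_divide [symmetric])
      finally show ?thesis .
    qed
    have 4: "y powr (-1/2 - real k) = (z / 2) powr (2 * real k + 1)"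
    proof -
      have "y = (z / 2) powr (-2)" using z by (simp add: y_def powr_minus powr_numeral power_divide)
      hence "y powr (-1/2 - real k) = (z / 2) powr (-2 * (-1/2 - real k))" by (simp only: powr_powr)
      thus ?thesis by (simp add: algebra_simps)
    qed
    have 5: "(z / 2) powr (2 * real k + (\<rho> + 1/2)) = (z / 2) powr (\<rho> - 1/2) * (z / 2) powr (2 * real k + 1)"
      unfolding powr_add [symmetric] by (rule arg_cong) simp
    show ?thesis
      unfolding A_def res_def b_def 1 2 3 4 5 by (simp add: mult_ac)
  qed
  ultimately have "(\<lambda>k. complex_of_real (b k)) sums (A / (2 * of_real pi) * I 0)" by simp
  moreover from this have "summable b" by (auto simp: sums_iff summable_of_real_iff)
  ultimately have "complex_of_real (suminf b) = A / (2 * of_real pi) * I 0"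
    by (simp add: sums_iff suminf_of_real)
  thus ?thesis by (simp add: bessel_J_def b_def A_def I_def F_def)
qed

section \<open>Interchanging the two integrations\<close>

text \<open>A form of Hake's theorem: an improper integral at infinity is a Henstock-Kurzweil
  integral, even if it converges only conditionally.\<close>

lemma has_integral_atLeast_0I:
  fixes h :: "real \<Rightarrow> 'a :: banach"
  assumes h: "\<And>R. h integrable_on {0..R}" and lim: "((\<lambda>R. integral {0..R} h) \<longlongrightarrow> V) at_top"
  shows "(h has_integral V) {0..}"
  unfolding has_integral_alt'[of h V]
proof (intro conjI allI impI)
  fix a b :: real
  have "h integrable_on {max 0 a..b}" by (rule integrable_subinterval_real[OF h[of b]]) auto
  moreover have "{0..} \<inter> {a..b} = {max 0 a..b}" by auto
  ultimately show "(\<lambda>x. if x \<in> {0..} then h x else 0) integrable_on cbox a b"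
    by (simp only: integrable_restrict_Int cbox_interval)
next
  fix e :: real assume "e > 0"
  then obtain N where N: "\<And>R. R \<ge> N \<Longrightarrow> dist (integral {0..R} h) V < e"
    using tendstoD[OF lim] by (auto simp: eventually_at_top_linorder)
  show "\<exists>B>0. \<forall>a b. ball 0 B \<subseteq> cbox a b \<longrightarrow> norm (integral (cbox a b) (\<lambda>x. if x \<in> {0..} then h x else 0) - V) < e"
  proof (intro exI[of _ "max 1 N + 1"] conjI allI impI)
    fix a b :: real assume sub: "ball 0 (max 1 N + 1) \<subseteq> cbox a b"
    have "0 \<in> ball 0 (max 1 N + 1)" "max 1 N \<in> ball 0 (max 1 N + 1)" by (auto simp: dist_real_def)
    hence "0 \<in> cbox a b" "max 1 N \<in> cbox a b" using sub by blast+
    hence ab: "a \<le> 0" "b \<ge> max 1 N" by auto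
    have "{0..} \<inter> {a..b} = {0..b}" using ab by auto
    hence "integral (cbox a b) (\<lambda>x. if x \<in> {0..} then h x else 0) = integral {0..b} h"
      by (simp only: integral_restrict_Int cbox_interval)
    thus "norm (integral (cbox a b) (\<lambda>x. if x \<in> {0..} then h x else 0) - V) < e"
      using N[of b] ab by (simp add: dist_norm)
  qed auto
qed

text \<open>The double integral is not absolutely convergent, so Fubini is applied on \<open>{0..R}\<close> and
  \<open>R \<rightarrow> \<infinity>\<close> is taken by dominated convergence in \<open>t\<close>.\<close>

lemma cos_Mellin_interchange:
  fixes g :: "real \<Rightarrow> complex" and \<sigma> a :: real
  defines "a \<equiv> 2 * \<sigma> + 1"
  assumes \<sigma>: "-1/2 < \<sigma>" "\<sigma> < 0" and g [measurable]: "g \<in> borel_measurable borel"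
    and int: "integrable lborel (\<lambda>t. (1 + \<bar>t\<bar>) powr a * norm (g t))"
  shows "((\<lambda>u. LINT t|lborel. g t * (of_real u powr (2 * Complex \<sigma> t) * of_real (cos u))) has_integral
    (LINT t|lborel. g t * (of_real (sqrt pi) * 4 powr Complex \<sigma> t * Gamma (1/2 + Complex \<sigma> t) * rGamma (- Complex \<sigma> t)))) {0..}"
proof -
  have a: "0 < a" "a < 1" using \<sigma> by (auto simp: a_def)
  \<comment> \<open>With \<open>w = 2 * s + 1\<close> the factor \<open>u powr (2 * s)\<close> is
    the Mellin power \<open>u powr (w - 1)\<close>, and \<open>a = Re w\<close> lies strictly
    between 0 and 1.\<close>
  define w where "w = (\<lambda>t. 2 * Complex \<sigma> t + 1)"
  have w: "Re (w t) = a" "w t - 1 = 2 * Complex \<sigma> t" for t by (simp_all add: w_def a_def)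
  have [measurable]: "Complex \<sigma> \<in> borel_measurable borel"
    unfolding Complex_eq [abs_def] by measurable
  define f where "f = (\<lambda>u t. g t * (of_real u powr (2 * Complex \<sigma> t) * of_real (cos u)))"
  define G where "G = (\<lambda>t. Gamma (w t) * cos (of_real pi * w t / 2))"
  define J where "J = (\<lambda>R t. integral {0..R} (\<lambda>u. of_real u powr (2 * Complex \<sigma> t) * complex_of_real (cos u)))"
  have cosint: "set_integrable lborel {0..R} (\<lambda>u. of_real u powr (2 * Complex \<sigma> t) * complex_of_real (cos u))" for R t
    using set_integrable_powr_mult[of "w t" "\<lambda>u. of_real (cos u)" R] a unfolding w by simp
  have J_eq: "J R t = (LINT u|lborel. indicator {0..R} u *\<^sub>R (of_real u powr (2 * Complex \<sigma> t) * complex_of_real (cos u)))" for R t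
    using set_borel_integral_eq_integral(2)[OF cosint] by (simp add: J_def set_lebesgue_integral_def)
  have ng: "integrable lborel (\<lambda>t. norm (g t))"
  proof (rule Bochner_Integration.integrable_bound[OF int])
    have "norm (g t) \<le> (1 + \<bar>t\<bar>) powr a * norm (g t)" for t
    proof -
      have "1 \<le> (1 + \<bar>t\<bar>) powr a" using a by (intro ge_one_powr_ge_zero) auto
      thus ?thesis using mult_right_mono[of 1 "(1 + \<bar>t\<bar>) powr a" "norm (g t)"] by simp
    qed
    thus "AE t in lborel. norm (norm (g t)) \<le> norm ((1 + \<bar>t\<bar>) powr a * norm (g t))" by auto
  qed measurable
  have fnorm: "norm (f u t) \<le> u powr (a - 1) * norm (g t)" if "u \<ge> 0" for u t
  proof -
    have "norm (f u t) = norm (g t) * (u powr (a - 1) * \<bar>cos u\<bar>)"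
      using that by (simp add: f_def norm_mult norm_of_real_powr a_def)
    also have "\<dots> \<le> norm (g t) * (u powr (a - 1) * 1)"
      by (intro mult_left_mono) auto
    finally show ?thesis by (simp add: mult.commute)
  qed
  have f_int: "integrable lborel (f u)" if "u \<ge> 0" for u
  proof (rule Bochner_Integration.integrable_bound)
    show "integrable lborel (\<lambda>t. u powr (a - 1) * norm (g t))" using ng by simp
    show "AE t in lborel. norm (f u t) \<le> norm (u powr (a - 1) * norm (g t))"
      using fnorm[OF that] by auto
  qed (unfold f_def, measurable)
  \<comment> \<open>On a bounded range absolute integrability holds: the majorant splits into
    \<open>u powr (a - 1)\<close>, integrable at 0, and \<open>norm (g t)\<close>.\<close>
  have prod_int: "integrable (lborel \<Otimes>\<^sub>M lborel) (\<lambda>(u, t). indicator {0..R} u *\<^sub>R f u t)" for R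
  proof (rule lborel_pair.Fubini_integrable)
    show "(\<lambda>(u, t). indicat_real {0..R} u *\<^sub>R f u t) \<in> borel_measurable (lborel \<Otimes>\<^sub>M lborel)"
      unfolding f_def by measurable
    show "integrable lborel (\<lambda>u. LINT t|lborel. norm (case (u, t) of (u, t) \<Rightarrow> indicat_real {0..R} u *\<^sub>R f u t))"
    proof (rule Bochner_Integration.integrable_bound)
      show "integrable lborel (\<lambda>u. (indicat_real {0..R} u *\<^sub>R u powr (a - 1)) * (LINT t|lborel. norm (g t)))"
        using set_integrable_powr_from_0[OF a(1), of R] by (simp add: set_integrable_def)
      show "(\<lambda>u. LINT t|lborel. norm (case (u, t) of (u, t) \<Rightarrow> indicat_real {0..R} u *\<^sub>R f u t)) \<in> borel_measurable lborel"
        unfolding f_def by measurable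
      show "AE u in lborel. norm (LINT t|lborel. norm (case (u, t) of (u, t) \<Rightarrow> indicat_real {0..R} u *\<^sub>R f u t))
          \<le> norm ((indicat_real {0..R} u *\<^sub>R u powr (a - 1)) * (LINT t|lborel. norm (g t)))"
      proof (rule AE_I2)
        fix u :: real
        have nn: "0 \<le> (LINT t|lborel. norm (g t))" by simp
        show "norm (LINT t|lborel. norm (case (u, t) of (u, t) \<Rightarrow> indicat_real {0..R} u *\<^sub>R f u t))
          \<le> norm ((indicat_real {0..R} u *\<^sub>R u powr (a - 1)) * (LINT t|lborel. norm (g t)))"
        proof (cases "u \<in> {0..R}")
          case True
          have "(LINT t|lborel. norm (f u t)) \<le> (LINT t|lborel. u powr (a - 1) * norm (g t))"
            using True f_int ng by (intro integral_mono fnorm) auto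
          thus ?thesis using True nn by (simp add: abs_mult)
        qed simp
      qed
    qed
    show "AE u in lborel. integrable lborel (\<lambda>t. case (u, t) of (u, t) \<Rightarrow> indicat_real {0..R} u *\<^sub>R f u t)"
    proof (rule AE_I2)
      fix u :: real
      show "integrable lborel (\<lambda>t. case (u, t) of (u, t) \<Rightarrow> indicat_real {0..R} u *\<^sub>R f u t)"
        using f_int[of u] by (cases "u \<in> {0..R}") auto
    qed
  qed
  have h_int: "set_integrable lborel {0..R} (\<lambda>u. LINT t|lborel. f u t)" for R
    using lborel_pair.integrable_fst'[OF prod_int[of R]] by (simp add: set_integrable_def)
  have h_integral: "integral {0..R} (\<lambda>u. LINT t|lborel. f u t) = (LINT t|lborel. g t * J R t)" for R
  proof -
    have "integral {0..R} (\<lambda>u. LINT t|lborel. f u t) = (LINT u|lborel. LINT t|lborel. indicator {0..R} u *\<^sub>R f u t)"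
      using set_borel_integral_eq_integral(2)[OF h_int[of R]] by (simp add: set_lebesgue_integral_def)
    also have "\<dots> = (LINT t|lborel. LINT u|lborel. indicator {0..R} u *\<^sub>R f u t)"
      using lborel_pair.Fubini_integral[OF prod_int[of R]] by simp
    also have "\<dots> = (LINT t|lborel. g t * J R t)"
      unfolding J_eq f_def by (simp flip: integral_mult_right_zero)
    finally show ?thesis .
  qed
  have wn: "w t \<notin> \<int>\<^sub>\<le>\<^sub>0" for t using w(1)[of t] a by (auto elim!: nonpos_Ints_cases)
  have J_lim: "((\<lambda>R. J R t) \<longlongrightarrow> G t) at_top" for t
    using cos_Mellin_limit[of "w t"] a unfolding w by (simp add: J_def G_def)
  have "((\<lambda>R. LINT t|lborel. g t * J R t) \<longlongrightarrow> (LINT t|lborel. g t * G t)) at_top"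
  proof (rule integral_dominated_convergence_at_top)
    \<comment> \<open>\<open>norm (w t - 1)\<close> is at most
      \<open>2 * (\<bar>\<sigma>\<bar> + \<bar>t\<bar>)\<close> with
      \<open>\<bar>\<sigma>\<bar> < 1/2\<close>, so the base of the uniform bound is at most
      \<open>2 * (1 + \<bar>t\<bar>)\<close>; \<open>2 powr a\<close> absorbs the 2.\<close>
    define D where "D = (1 / a + 2 + 1 / (1 - a)) * 2 powr a"
    have J_bound: "norm (J R t) \<le> D * (1 + \<bar>t\<bar>) powr a" if "R \<ge> 0" for R t
    proof -
      have "norm (w t - 1) \<le> 2 * (\<bar>\<sigma>\<bar> + \<bar>t\<bar>)"
        using cmod_le[of "Complex \<sigma> t"] by (simp add: w norm_mult)
      hence "1 + norm (w t - 1) \<le> 2 * (1 + \<bar>t\<bar>)" using \<sigma> by simp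
      hence "(1 + norm (w t - 1)) powr a \<le> (2 * (1 + \<bar>t\<bar>)) powr a"
        using a by (intro powr_mono2) auto
      also have "\<dots> = 2 powr a * (1 + \<bar>t\<bar>) powr a" by (rule powr_mult)
      finally have "(1 / a + 2 + 1 / (1 - a)) * (1 + norm (w t - 1)) powr a
          \<le> (1 / a + 2 + 1 / (1 - a)) * (2 powr a * (1 + \<bar>t\<bar>) powr a)"
        using a by (intro mult_left_mono) auto
      moreover have "norm (J R t) \<le> (1 / a + 2 + 1 / (1 - a)) * (1 + norm (w t - 1)) powr a"
        using cos_Mellin_uniform_bound[of "w t" R] a that unfolding J_def w by simp
      ultimately show ?thesis by (simp add: D_def)
    qed
    show "integrable lborel (\<lambda>t. D * ((1 + \<bar>t\<bar>) powr a * norm (g t)))" using int by simp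
    show "\<forall>\<^sub>F R in at_top. AE t in lborel. norm (g t * J R t) \<le> D * ((1 + \<bar>t\<bar>) powr a * norm (g t))"
      using eventually_ge_at_top[of 0]
    proof eventually_elim
      case (elim R)
      have "norm (g t * J R t) \<le> D * ((1 + \<bar>t\<bar>) powr a * norm (g t))" for t
        using mult_left_mono[OF J_bound[OF elim, of t], of "norm (g t)"] by (simp add: norm_mult mult_ac)
      thus ?case by auto
    qed
    show "AE t in lborel. ((\<lambda>R. g t * J R t) \<longlongrightarrow> g t * G t) at_top"
      by (intro AE_I2 tendsto_intros J_lim)
    show "(\<lambda>t. g t * J R t) \<in> borel_measurable lborel" for R
      unfolding J_eq by measurable
    have cw: "continuous_on UNIV w"
      unfolding w_def Complex_eq by (intro continuous_intros)
    have "continuous_on UNIV (\<lambda>t. Gamma (w t))"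
      by (rule continuous_on_compose2[OF holomorphic_on_imp_continuous_on[OF holomorphic_Gamma[of "- \<int>\<^sub>\<le>\<^sub>0"]] cw])
         (use wn in auto)
    hence "continuous_on UNIV G"
      unfolding G_def by (intro continuous_intros cw) auto
    hence [measurable]: "G \<in> borel_measurable borel" by (rule borel_measurable_continuous_onI)
    show "(\<lambda>t. g t * G t) \<in> borel_measurable lborel" by measurable
  qed
  hence "((\<lambda>u. LINT t|lborel. f u t) has_integral (LINT t|lborel. g t * G t)) {0..}"
    using set_borel_integral_eq_integral(1)[OF h_int] by (intro has_integral_atLeast_0I) (simp_all add: h_integral)
  moreover have "G t = of_real (sqrt pi) * 4 powr Complex \<sigma> t * Gamma (1/2 + Complex \<sigma> t) * rGamma (- Complex \<sigma> t)" for t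
    unfolding G_def w_def using \<sigma> by (intro Gamma_cos_eq_Gamma_quotient) auto
  ultimately show ?thesis unfolding f_def by simp
qed

section \<open>The iterated integral\<close>

text \<open>The real powers of \<open>u\<close> cancel: \<open>u powr \<rho>\<close> meets
  \<open>u powr (-1/2)\<close> from the Bessel factor and \<open>u powr (1/2 - \<rho>)\<close> from
  the prefactor at \<open>z / u\<close>. Only the cosine and \<open>u powr (2 * s)\<close>, from
  rescaling \<open>y\<close>, remain.\<close>

lemma K_integrand_MB_form:
  fixes \<rho> \<sigma> z u :: real and k :: nat
  defines "y \<equiv> 4 ^ (k + 1) / z\<^sup>2"
  assumes z: "z > 0" and u: "u > 0"
    and K: "complex_of_real (K_iter \<rho> k (z / u)) =
      of_real (2 powr (- \<rho> + (real k + 1) / 2) * (z / u) powr (\<rho> - 1/2)) / (2 * of_real pi) *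
      (LINT t|lborel. MB_kernel \<rho> k (Complex \<sigma> t) * of_real (4 ^ (k + 1) / (z / u)\<^sup>2) powr Complex \<sigma> t)"
  shows "complex_of_real (K_integrand \<rho> (K_iter \<rho> k) z u) =
    of_real (2 powr (- \<rho> + (real k + 1) / 2) * z powr (\<rho> - 1/2) * sqrt (2 / pi)) / (2 * of_real pi) *
    (LINT t|lborel. MB_kernel \<rho> k (Complex \<sigma> t) * of_real y powr Complex \<sigma> t *
       (of_real u powr (2 * Complex \<sigma> t) * of_real (cos u)))"
proof -
  have y: "y > 0" using z by (simp add: y_def)
  have pw: "of_real (4 ^ (k + 1) / (z / u)\<^sup>2) powr s = of_real y powr s * complex_of_real u powr (2 * s)" for s
  proof -
    have "4 ^ (k + 1) / (z / u)\<^sup>2 = y * u\<^sup>2" by (simp add: y_def power_divide)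
    moreover have "ln (y * u\<^sup>2) = ln y + 2 * ln u"
      using y u by (simp add: ln_mult ln_realpow)
    ultimately have "of_real (4 ^ (k + 1) / (z / u)\<^sup>2) powr s = exp (s * of_real (ln y + 2 * ln u))"
      using y u by (simp add: powr_def Ln_of_real flip: of_real_mult of_real_power)
    also have "\<dots> = exp (s * of_real (ln y)) * exp (2 * s * of_real (ln u))"
      unfolding exp_add [symmetric] by (simp add: algebra_simps)
    finally show ?thesis using y u by (simp add: powr_def Ln_of_real)
  qed
  have bes: "u powr \<rho> * bessel_J (-1/2) u * (z / u) powr (\<rho> - 1/2) = z powr (\<rho> - 1/2) * sqrt (2 / pi) * cos u"
  proof -
    have "u powr \<rho> = u powr (1/2) * u powr (\<rho> - 1/2)" by (simp flip: powr_add)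
    hence 1: "u powr \<rho> * (z / u) powr (\<rho> - 1/2) = sqrt u * z powr (\<rho> - 1/2)"
      using u z by (simp add: powr_divide powr_half_sqrt)
    have 2: "sqrt (2 / (pi * u)) * sqrt u = sqrt (2 / pi)"
      using u by (simp add: real_sqrt_mult [symmetric])
    have "u powr \<rho> * bessel_J (-1/2) u * (z / u) powr (\<rho> - 1/2)
        = (u powr \<rho> * (z / u) powr (\<rho> - 1/2)) * (sqrt (2 / (pi * u)) * cos u)"
      unfolding bessel_J_minus_half[OF u] by simp
    also have "\<dots> = z powr (\<rho> - 1/2) * (sqrt (2 / (pi * u)) * sqrt u) * cos u"
      unfolding 1 by (simp only: mult_ac)
    finally show ?thesis unfolding 2 .
  qed
  define Q where "Q = (LINT t|lborel. MB_kernel \<rho> k (Complex \<sigma> t) * of_real y powr Complex \<sigma> t * of_real u powr (2 * Complex \<sigma> t))"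
  have K': "complex_of_real (K_iter \<rho> k (z / u)) =
      of_real (2 powr (- \<rho> + (real k + 1) / 2) * (z / u) powr (\<rho> - 1/2)) / (2 * of_real pi) * Q"
    unfolding K Q_def pw by (simp only: mult.assoc)
  have "complex_of_real (K_integrand \<rho> (K_iter \<rho> k) z u)
      = of_real (u powr \<rho> * bessel_J (-1/2) u) * complex_of_real (K_iter \<rho> k (z / u))"
    by (simp add: K_integrand_def)
  also have "\<dots> = of_real (2 powr (- \<rho> + (real k + 1) / 2) * (u powr \<rho> * bessel_J (-1/2) u * (z / u) powr (\<rho> - 1/2))) / (2 * of_real pi) * Q"
    unfolding K' by simp
  also have "\<dots> = of_real (2 powr (- \<rho> + (real k + 1) / 2) * z powr (\<rho> - 1/2) * sqrt (2 / pi)) / (2 * of_real pi) * (Q * of_real (cos u))"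
    unfolding bes by simp
  also have "Q * of_real (cos u) = (LINT t|lborel. MB_kernel \<rho> k (Complex \<sigma> t) * of_real y powr Complex \<sigma> t *
       (of_real u powr (2 * Complex \<sigma> t) * of_real (cos u)))"
    unfolding Q_def integral_mult_left_zero [symmetric] by (simp only: mult.assoc)
  finally show ?thesis .
qed

text \<open>The cosine transform supplies the Gamma quotient leading from \<open>k\<close> to
  \<open>Suc k\<close>; its \<open>4 powr s\<close> is absorbed by \<open>y\<close>, and
  \<open>sqrt pi\<close> joins the \<open>sqrt (2 / pi)\<close> of the Bessel factor to give
  \<open>2 powr (1/2)\<close>. The summand \<open>2 * \<sigma> + 1\<close> in the exponent condition
  is the weight required for interchanging the integrals.\<close>

lemma K_integrand_has_integral:
  fixes \<rho> \<sigma> z :: real and k :: nat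
  assumes z: "z > 0" and \<sigma>: "-1/2 < \<sigma>" "\<sigma> < 0"
    and exponent: "(2 * real k + 2) * \<sigma> + (real k - 1) / 2 - \<rho> + (2 * \<sigma> + 1) < -1"
    and K: "\<And>x. x > 0 \<Longrightarrow> complex_of_real (K_iter \<rho> k x) =
      of_real (2 powr (- \<rho> + (real k + 1) / 2) * x powr (\<rho> - 1/2)) / (2 * of_real pi) *
      (LINT t|lborel. MB_kernel \<rho> k (Complex \<sigma> t) * of_real (4 ^ (k + 1) / x\<^sup>2) powr Complex \<sigma> t)"
  shows "((\<lambda>u. complex_of_real (K_integrand \<rho> (K_iter \<rho> k) z u)) has_integral
      of_real (2 powr (- \<rho> + (real (Suc k) + 1) / 2) * z powr (\<rho> - 1/2)) / (2 * of_real pi) *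
      (LINT t|lborel. MB_kernel \<rho> (Suc k) (Complex \<sigma> t) * of_real (4 ^ (Suc k + 1) / z\<^sup>2) powr Complex \<sigma> t)) {0<..}"
proof -
  define y where "y = 4 ^ (k + 1) / z\<^sup>2"
  have y: "y > 0" using z by (simp add: y_def)
  define g where "g = (\<lambda>t. MB_kernel \<rho> k (Complex \<sigma> t) * of_real y powr Complex \<sigma> t)"
  define B where "B = complex_of_real (2 powr (- \<rho> + (real k + 1) / 2) * z powr (\<rho> - 1/2) * sqrt (2 / pi)) / (2 * of_real pi)"
  define V where "V = (LINT t|lborel. g t * (of_real (sqrt pi) * 4 powr Complex \<sigma> t * Gamma (1/2 + Complex \<sigma> t) * rGamma (- Complex \<sigma> t)))"
  have [measurable]: "(\<lambda>t. MB_kernel \<rho> k (Complex \<sigma> t)) \<in> borel_measurable borel"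
    using MB_kernel_line_measurable[of \<sigma> "2 * \<sigma> + 1" k \<rho>] \<sigma> exponent by auto
  have [measurable]: "Complex \<sigma> \<in> borel_measurable borel"
    unfolding Complex_eq [abs_def] by measurable
  have "integrable lborel (\<lambda>t. y powr \<sigma> * ((1 + \<bar>t\<bar>) powr (2 * \<sigma> + 1) * norm (MB_kernel \<rho> k (Complex \<sigma> t))))"
    using \<sigma> exponent by (intro integrable_mult_right MB_kernel_line_integrable) auto
  hence g_int: "integrable lborel (\<lambda>t. (1 + \<bar>t\<bar>) powr (2 * \<sigma> + 1) * norm (g t))"
    using y by (simp add: g_def norm_mult norm_powr_real_powr mult_ac)
  have "((\<lambda>u. LINT t|lborel. g t * (of_real u powr (2 * Complex \<sigma> t) * of_real (cos u))) has_integral V) {0..}"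
    unfolding V_def
    by (rule cos_Mellin_interchange[OF \<sigma> _ g_int]) (unfold g_def, measurable)
  moreover have "negligible {u \<in> {0..} - {0<..}. h u \<noteq> 0}" "negligible {u \<in> {0<..} - {0..}. h u \<noteq> 0}"
    for h :: "real \<Rightarrow> complex"
    by (rule negligible_subset[OF negligible_sing[of 0]]; force)+
  ultimately have "((\<lambda>u. LINT t|lborel. g t * (of_real u powr (2 * Complex \<sigma> t) * of_real (cos u))) has_integral V) {0<..}"
    using has_integral_spike_set_eq by blast
  hence "((\<lambda>u. B * (LINT t|lborel. g t * (of_real u powr (2 * Complex \<sigma> t) * of_real (cos u)))) has_integral B * V) {0<..}"
    by (rule has_integral_mult_right)
  hence "((\<lambda>u. complex_of_real (K_integrand \<rho> (K_iter \<rho> k) z u)) has_integral B * V) {0<..}"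
  proof (rule has_integral_eq[rotated])
    fix u :: real assume u: "u \<in> {0<..}"
    show "B * (LINT t|lborel. g t * (of_real u powr (2 * Complex \<sigma> t) * of_real (cos u)))
        = complex_of_real (K_integrand \<rho> (K_iter \<rho> k) z u)"
      using K_integrand_MB_form[OF z _ K, of u] u z unfolding B_def g_def y_def by simp
  qed
  moreover have "V = of_real (sqrt pi) *
      (LINT t|lborel. MB_kernel \<rho> (Suc k) (Complex \<sigma> t) * of_real (4 ^ (Suc k + 1) / z\<^sup>2) powr Complex \<sigma> t)"
  proof -
    have "of_real (4 ^ (Suc k + 1) / z\<^sup>2) powr s = 4 powr s * of_real y powr s" for s :: complex
    proof -
      have "4 ^ (Suc k + 1) / z\<^sup>2 = 4 * y" by (simp add: y_def)
      moreover have "(of_real 4 * of_real y) powr s = of_real 4 powr s * complex_of_real y powr s"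
        using y by (intro powr_times_real) auto
      ultimately show ?thesis by simp
    qed
    thus ?thesis
      unfolding V_def g_def integral_mult_right_zero [symmetric]
      by (intro Bochner_Integration.integral_cong refl) (simp add: MB_kernel_def mult_ac)
  qed
  moreover have "B * of_real (sqrt pi) = of_real (2 powr (- \<rho> + (real (Suc k) + 1) / 2) * z powr (\<rho> - 1/2)) / (2 * of_real pi)"
  proof -
    have "sqrt (2 / pi) * sqrt pi = 2 powr (1/2)"
      by (simp add: powr_half_sqrt real_sqrt_divide)
    moreover have "2 powr (- \<rho> + (real (Suc k) + 1) / 2) = 2 powr (- \<rho> + (real k + 1) / 2) * 2 powr (1/2)"
      unfolding powr_add [symmetric] by (rule arg_cong) (simp add: field_simps)
    ultimately have "2 powr (- \<rho> + (real k + 1) / 2) * z powr (\<rho> - 1/2) * sqrt (2 / pi) * sqrt pi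
        = 2 powr (- \<rho> + (real (Suc k) + 1) / 2) * z powr (\<rho> - 1/2)"
      by (simp add: mult.assoc mult.left_commute)
    thus ?thesis by (simp add: B_def flip: of_real_mult)
  qed
  ultimately show ?thesis by (simp add: mult.assoc [symmetric])
qed

text \<open>Induction on the number of integrations with a fixed line.
  \<open>a = 2 * \<sigma> + 1\<close> is the distance parameter from the first pole. Integrability
  is no separate estimate: it comes with the \<open>has_integral\<close> statement.\<close>

lemma K_iter_MB_integral:
  fixes \<rho> a :: real
  defines "\<sigma> \<equiv> (a - 1) / 2"
  assumes \<rho>: "\<rho> > -1/2" and a: "0 < a" "a \<le> 1/2" "2 * a < \<rho> + 1/2" and x: "x > 0"
  shows "complex_of_real (K_iter \<rho> k x) =
      of_real (2 powr (- \<rho> + (real k + 1) / 2) * x powr (\<rho> - 1/2)) / (2 * of_real pi) *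
      (LINT t|lborel. MB_kernel \<rho> k (Complex \<sigma> t) * of_real (4 ^ (k + 1) / x\<^sup>2) powr Complex \<sigma> t)" (is "?P k x")
    and K_integrand_integrable: "K_integrand \<rho> (K_iter \<rho> k) x integrable_on {0<..}"
proof -
  have \<sigma>: "-1/2 < \<sigma>" "\<sigma> < 0" using a by (auto simp: \<sigma>_def)
  \<comment> \<open>In terms of \<open>a\<close> this reads
    \<open>(k + 2) * a < k / 2 + 1/2 + \<rho>\<close>. The bound \<open>a \<le> 1/2\<close> takes
    care of \<open>k * a\<close> and \<open>2 * a < \<rho> + 1/2\<close> of the rest, so one
    \<open>a\<close> serves for all \<open>k\<close>.\<close>
  have exponent: "(2 * real k + 2) * \<sigma> + (real k - 1) / 2 - \<rho> + (2 * \<sigma> + 1) < -1" for k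
  proof -
    have "real k * a \<le> real k * (1/2)" using a by (intro mult_left_mono) auto
    thus ?thesis using a by (simp add: \<sigma>_def field_simps)
  qed
  have main: "?P k x" if "x > 0" for k x
    using that
  proof (induction k arbitrary: x)
    case 0
    have "2 * \<sigma> - 1/2 - \<rho> < -1" using a by (simp add: \<sigma>_def field_simps)
    from bessel_J_MB_integral[OF 0 \<rho> \<sigma> this] show ?case by simp
  next
    case (Suc k)
    have int: "((\<lambda>u. complex_of_real (K_integrand \<rho> (K_iter \<rho> k) x u)) has_integral
      of_real (2 powr (- \<rho> + (real (Suc k) + 1) / 2) * x powr (\<rho> - 1/2)) / (2 * of_real pi) *
      (LINT t|lborel. MB_kernel \<rho> (Suc k) (Complex \<sigma> t) * of_real (4 ^ (Suc k + 1) / x\<^sup>2) powr Complex \<sigma> t)) {0<..}"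
      by (rule K_integrand_has_integral[OF Suc.prems \<sigma> exponent Suc.IH])
    \<comment> \<open>\<open>K_iter\<close> uses \<open>integral\<close>, which returns 0 for
      functions that are not integrable; the real integrand must be known to be integrable before
      the two values can be compared.\<close>
    have "K_integrand \<rho> (K_iter \<rho> k) x integrable_on {0<..}"
      using has_integral_linear[OF int bounded_linear_Re] by (auto simp: o_def integrable_on_def)
    from has_integral_of_real[OF integrable_integral[OF this]]
    have "((\<lambda>u. complex_of_real (K_integrand \<rho> (K_iter \<rho> k) x u)) has_integral of_real (K_iter \<rho> (Suc k) x)) {0<..}"
      by simp
    from has_integral_unique[OF this int] show ?case .
  qed
  show "?P k x" using main[OF x] .
  have "((\<lambda>u. complex_of_real (K_integrand \<rho> (K_iter \<rho> k) x u)) has_integral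
      of_real (2 powr (- \<rho> + (real (Suc k) + 1) / 2) * x powr (\<rho> - 1/2)) / (2 * of_real pi) *
      (LINT t|lborel. MB_kernel \<rho> (Suc k) (Complex \<sigma> t) * of_real (4 ^ (Suc k + 1) / x\<^sup>2) powr Complex \<sigma> t)) {0<..}"
    by (rule K_integrand_has_integral[OF x \<sigma> exponent main])
  from has_integral_linear[OF this bounded_linear_Re] show "K_integrand \<rho> (K_iter \<rho> k) x integrable_on {0<..}"
    by (auto simp: o_def integrable_on_def)
qed

text \<open>The first two conjuncts give the equation its meaning: they exclude that an inner
  \<open>integral\<close> has its default value 0 or that the \<open>THE\<close> in
  \<open>meijer_G\<close> is unspecified.\<close>

theorem theorem7p1:
  fixes r :: nat and x \<rho> :: real and as :: "complex list" and y :: complex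
  assumes "r > 0" and "x > 0" and "\<rho> > real r / 2 - 1"
  defines "as \<equiv> replicate (r + 1) (1/2) @ [of_real \<rho> + 1] @ replicate r 0"
    and "y \<equiv> of_real (4 ^ (r + 1) / x\<^sup>2)"
  shows "(\<forall>k<r. \<forall>z>0. K_integrand \<rho> (K_iter \<rho> k) z integrable_on {0<..}) \<and>
    (\<exists>!v. has_meijer_G 0 (r + 1) as [] y v) \<and>
    complex_of_real (K_iter \<rho> r x) =
      of_real (2 powr (- \<rho> + (real r + 1) / 2) * x powr (\<rho> - 1/2)) *
      meijer_G 0 (r + 1) as [] y"
proof -
  have \<rho>: "\<rho> > -1/2" using assms(1,3) by simp
  \<comment> \<open>The quotient by 4 gives \<open>2 * a \<le> (\<rho> + 1/2) / 2\<close>, strictly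
    below \<open>\<rho> + 1/2\<close>; the minimum with 1/2 makes the choice valid for every number
    of integrations.\<close>
  define a where "a = min (1/2) ((\<rho> + 1/2) / 4)"
  have a: "0 < a" "a \<le> 1/2" "2 * a < \<rho> + 1/2" using \<rho> by (auto simp: a_def min_def)
  define \<sigma> where "\<sigma> = (a - 1) / 2"
  have \<sigma>: "-1/2 < \<sigma>" using a by (simp add: \<sigma>_def)
  have exponent: "(2 * real r + 2) * \<sigma> + (real r - 1) / 2 - \<rho> < -1"
  proof -
    have "real r * a \<le> real r * (1/2)" using a by (intro mult_left_mono) auto
    thus ?thesis using a by (simp add: \<sigma>_def field_simps)
  qed
  define y' where "y' = 4 ^ (r + 1) / x\<^sup>2"
  have y': "y' > 0" "y = of_real y'" using \<open>x > 0\<close> by (simp_all add: y'_def y_def)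
  define I where "I = (LINT t|lborel. MB_kernel \<rho> r (Complex \<sigma> t) * of_real y' powr Complex \<sigma> t)"
  have G_iff: "has_meijer_G 0 (r + 1) as [] y v \<longleftrightarrow>
      (\<exists>L J. vertical_contour L \<and> range (\<lambda>k. of_real (-1/2 - real k)) \<subseteq> left_of_contour L \<and>
        ((\<lambda>t. MB_kernel \<rho> r (L t) * of_real y' powr L t * vector_derivative L (at t)) has_integral J) UNIV \<and>
        v = 1 / (2 * of_real pi * \<i>) * J)" for v
    unfolding has_meijer_G_def as_def separates_poles_iff meijer_integrand_eq_MB_kernel y'(2) ..
  have line: "vertical_contour (Complex \<sigma>)" "range (\<lambda>k. of_real (-1/2 - real k)) \<subseteq> left_of_contour (Complex \<sigma>)"
    "((\<lambda>t. MB_kernel \<rho> r (Complex \<sigma> t) * of_real y' powr Complex \<sigma> t * vector_derivative (Complex \<sigma>) (at t)) has_integral I * \<i>) UNIV"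
  proof -
    show "vertical_contour (Complex \<sigma>)" by (rule vertical_line_vertical_contour)
    show "range (\<lambda>k. of_real (-1/2 - real k)) \<subseteq> left_of_contour (Complex \<sigma>)"
      using \<sigma> by (auto intro!: vertical_line_left)
    have [measurable]: "(\<lambda>t. MB_kernel \<rho> r (Complex \<sigma> t)) \<in> borel_measurable borel"
      using MB_kernel_line_measurable[of \<sigma> 0 r \<rho>] \<sigma> exponent by auto
    have [measurable]: "Complex \<sigma> \<in> borel_measurable borel"
      unfolding Complex_eq [abs_def] by measurable
    have "integrable lborel (\<lambda>t. MB_kernel \<rho> r (Complex \<sigma> t) * of_real y' powr Complex \<sigma> t)"
    proof (rule Bochner_Integration.integrable_bound)
      show "integrable lborel (\<lambda>t. y' powr \<sigma> * ((1 + \<bar>t\<bar>) powr 0 * norm (MB_kernel \<rho> r (Complex \<sigma> t))))"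
        using \<sigma> exponent by (intro integrable_mult_right MB_kernel_line_integrable) auto
      show "AE t in lborel. norm (MB_kernel \<rho> r (Complex \<sigma> t) * of_real y' powr Complex \<sigma> t)
          \<le> norm (y' powr \<sigma> * ((1 + \<bar>t\<bar>) powr 0 * norm (MB_kernel \<rho> r (Complex \<sigma> t))))"
      proof (rule AE_I2)
        fix t :: real
        have "1 + \<bar>t\<bar> > 0" by linarith
        thus "norm (MB_kernel \<rho> r (Complex \<sigma> t) * of_real y' powr Complex \<sigma> t)
          \<le> norm (y' powr \<sigma> * ((1 + \<bar>t\<bar>) powr 0 * norm (MB_kernel \<rho> r (Complex \<sigma> t))))"
          using y' by (simp add: norm_mult norm_powr_real_powr)
      qed
    qed measurable
    from has_integral_mult_left[OF has_integral_integral_lborel[OF this], of \<i>]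
    show "((\<lambda>t. MB_kernel \<rho> r (Complex \<sigma> t) * of_real y' powr Complex \<sigma> t * vector_derivative (Complex \<sigma>) (at t)) has_integral I * \<i>) UNIV"
      by (simp add: I_def vector_derivative_vertical_line)
  qed
  have G: "has_meijer_G 0 (r + 1) as [] y v \<longleftrightarrow> v = I / (2 * of_real pi)" for v
  proof
    assume "has_meijer_G 0 (r + 1) as [] y v"
    then obtain L J where L: "vertical_contour L" "range (\<lambda>k. of_real (-1/2 - real k)) \<subseteq> left_of_contour L"
        "((\<lambda>t. MB_kernel \<rho> r (L t) * of_real y' powr L t * vector_derivative L (at t)) has_integral J) UNIV"
      and v: "v = 1 / (2 * of_real pi * \<i>) * J"
      unfolding G_iff by blast
    \<comment> \<open>The contour \<open>L\<close> is compared with the line at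
      \<open>\<sigma>\<close>, which also serves as the reference abscissa \<open>c0\<close>; the
      factor \<open>\<i>\<close> is the derivative of its parametrisation.\<close>
    have "J = I * \<i>"
      using MB_contour_integral_unique[OF y'(1) \<sigma> _ L line] exponent by simp
    thus "v = I / (2 * of_real pi)" using v by simp
  next
    assume v: "v = I / (2 * of_real pi)"
    show "has_meijer_G 0 (r + 1) as [] y v"
      unfolding G_iff by (rule exI[of _ "Complex \<sigma>"], rule exI[of _ "I * \<i>"]) (use line v in simp)
  qed
  have "meijer_G 0 (r + 1) as [] y = I / (2 * of_real pi)"
    unfolding meijer_G_def G by (rule the_equality) auto
  moreover have "complex_of_real (K_iter \<rho> r x) =
      of_real (2 powr (- \<rho> + (real r + 1) / 2) * x powr (\<rho> - 1/2)) / (2 * of_real pi) * I"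
    unfolding I_def y'_def \<sigma>_def by (rule K_iter_MB_integral[OF \<rho> a \<open>x > 0\<close>])
  ultimately have "complex_of_real (K_iter \<rho> r x) =
      of_real (2 powr (- \<rho> + (real r + 1) / 2) * x powr (\<rho> - 1/2)) * meijer_G 0 (r + 1) as [] y"
    by simp
  moreover have "\<exists>!v. has_meijer_G 0 (r + 1) as [] y v" unfolding G by blast
  moreover have "\<forall>k<r. \<forall>z>0. K_integrand \<rho> (K_iter \<rho> k) z integrable_on {0<..}"
    using K_integrand_integrable[OF \<rho> a] by blast
  ultimately show ?thesis by blast
qed

end
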